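(* Let $a,b,c,\epsilon,\kappa,\lambda,\sigma$ be real constants with $(a+b)c\neq 0$ and with $\epsilon,\kappa,\lambda,\sigma$ not all zero. The system $$F_1\equiv u_t+(a+b)vu_x+(au+c)v_x+\epsilon u_{txx}+\kappa v_{xxx}=0,\qquad F_2\equiv v_t+(bu+c)u_x+(a+b)vv_x+\lambda u_{xxx}+\sigma v_{txx}=0$$ is nonlinearly self-adjoint. The substitutions $\bar u=\varphi(t,x,u,v)$, $\bar v=\psi(t,x,u,v)$ realizing the nonlinear self-adjointness are exactly the pairs $(\varphi,\psi)$, not both identically zero, of the following form, where the $c_i$ are arbitrary real constants subject to the stated restrictions. (i) If $b=0$: $$\varphi=(c_1t+c_2)av+c_3c\ln(au+c)-c_1x+c_4,\qquad \psi=c_3av+(c_1t+c_2)(au+c)+c_5,$$ where $c_1=0$ if $(\epsilon,\sigma)\neq(0,0)$; $c_2=0$ if $\epsilon\neq\sigma$; $c_3=0$ if $(\epsilon,\kappa,\lambda)\neq(0,0,0)$. (ii) If $a=b$: $$\varphi=(au+c)[c_1\ln(au+c)+c_2],\qquad \psi=c_1av+c_3,$$ where $c_1=0$ if $(\epsilon,\kappa,\lambda)\neq(0,0,0)$; $c_2=0$ if $\kappa\neq 0$. (iii) If $b(a-b)\neq 0$: (iii.a) if $a=0$: $$\varphi=c_1e^{bu/c}-c_2(bu+2c),\qquad \psi=c_2bv+c_3,$$ where $c_1=0$ if $(\epsilon,\kappa)\neq(0,0)$; $c_2=0$ if $\kappa\neq-\lambda$; (iii.b) if $a\neq 0$: $$\varphi=c_1(au+c)^{b/a}+c_2[b^2u+(2b-a)c],\qquad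 \psi=c_2(a-b)bv+c_3,$$ where $c_1=0$ if $(\epsilon,\kappa)\neq(0,0)$; $c_2=0$ if $\lambda a\neq(\kappa+\lambda)b$.
   Context: Let $\bar u,\bar v$ be new dependent variables and $\mathcal L=\bar uF_1+\bar vF_2$ the formal Lagrangian. The adjoint expressions are $F_1^*=-\delta\mathcal L/\delta u$, $F_2^*=-\delta\mathcal L/\delta v$ (Euler–Lagrange operators), i.e. $$F_1^*=\bar u_t+(a+b)v\bar u_x+(bu+c)\bar v_x+b\bar uv_x+\epsilon\bar u_{txx}+\lambda\bar v_{xxx},$$ $$F_2^*=\bar v_t+(au+c)\bar u_x+(a+b)v\bar v_x-b\bar uu_x+\kappa\bar u_{xxx}+\sigma\bar v_{txx}.$$ The system is called nonlinearly self-adjoint if there are smooth functions $\varphi(t,x,u,v)$, $\psi(t,x,u,v)$, not both identically zero, and coefficients $M,N,P,Q$ (functions of $t,x,u,v$ and derivatives of $u,v$) such that, after substituting $\bar u=\varphi(t,x,u,v)$, $\bar v=\psi(t,x,u,v)$ (with derivatives of $\bar u,\bar v$ computed as total derivatives of $\varphi,\psi$), $$F_1^*\big|_{(\bar u,\bar v)=(\varphi,\psi)}=MF_1+NF_2,\qquad F_2^*\big|_{(\bar u,\bar v)=(\varphi,\psi)}=PF_1+QF_2$$ hold identically in $t,x,u,v$ and the derivatives of $u,v$. Such pairs $(\varphi,\psi)$ are the substitutions realizing the nonlinear self-adjointness. When $a\neq0$, functions are considered on the region $au+c>0$, so that $\ln(au+c)$ and $(au+c)^{b/a}$ are defined. 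*)

theory Defs
  imports "HOL-Analysis.Analysis" "HOL-Library.Groups_Big_Fun"
begin

text \<open>Jet coordinates in the independent variables \<open>t\<close>, \<open>x\<close> and dependent variables indexed
  by \<open>'d\<close>: \<open>Der w i j\<close> stands for the derivative of \<open>w\<close> taken \<open>i\<close> times in \<open>t\<close> and \<open>j\<close> times in
  \<open>x\<close>. A function of \<open>t\<close>, \<open>x\<close>, the dependent variables and their derivatives is a function
  \<open>'d jet \<Rightarrow> real\<close>.\<close>

datatype 'd jet_coord = Time | Space | Der 'd nat nat

type_synonym 'd jet = "'d jet_coord \<Rightarrow> real"

definition jet_pderiv :: "'d jet_coord \<Rightarrow> ('d jet \<Rightarrow> real) \<Rightarrow> 'd jet \<Rightarrow> real" where
  "jet_pderiv y f z = deriv (\<lambda>s. f (z(y := s))) (z y)"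

text \<open>The sums below are over all multi-indices; they have finite support for functions depending
  on finitely many jet coordinates, the only ones they are applied to.\<close>

definition total_dt :: "('d jet \<Rightarrow> real) \<Rightarrow> 'd jet \<Rightarrow> real" where
  "total_dt f z = jet_pderiv Time f z
     + Sum_any (\<lambda>(w, i, j). z (Der w (Suc i) j) * jet_pderiv (Der w i j) f z)"

definition total_dx :: "('d jet \<Rightarrow> real) \<Rightarrow> 'd jet \<Rightarrow> real" where
  "total_dx f z = jet_pderiv Space f z
     + Sum_any (\<lambda>(w, i, j). z (Der w i (Suc j)) * jet_pderiv (Der w i j) f z)"

definition total_deriv :: "nat \<Rightarrow> nat \<Rightarrow> ('d jet \<Rightarrow> real) \<Rightarrow> 'd jet \<Rightarrow> real" where
  "total_deriv i j f = (total_dt ^^ i) ((total_dx ^^ j) f)"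

definition euler_op :: "'d \<Rightarrow> ('d jet \<Rightarrow> real) \<Rightarrow> 'd jet \<Rightarrow> real" where
  "euler_op w f z =
     Sum_any (\<lambda>(i, j). (-1) ^ (i + j) * total_deriv i j (jet_pderiv (Der w i j) f) z)"


text \<open>The dependent variables: \<open>Orig U\<close>, \<open>Orig V\<close> are \<open>u\<close>, \<open>v\<close>, and \<open>Bar U\<close>, \<open>Bar V\<close> are the new
  variables written with a bar.\<close>

datatype dep = U | V

datatype ext_dep = Orig dep | Bar dep

definition formal_lagrangian ::
    "(dep jet \<Rightarrow> real) \<Rightarrow> (dep jet \<Rightarrow> real) \<Rightarrow> ext_dep jet \<Rightarrow> real" where
  "formal_lagrangian F1 F2 z =
     z (Der (Bar U) 0 0) * F1 (z \<circ> map_jet_coord Orig)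
     + z (Der (Bar V) 0 0) * F2 (z \<circ> map_jet_coord Orig)"

text \<open>Note the sign convention: minus the variational derivative.\<close>

definition adjoint_expr ::
    "(dep jet \<Rightarrow> real) \<Rightarrow> (dep jet \<Rightarrow> real) \<Rightarrow> dep \<Rightarrow> ext_dep jet \<Rightarrow> real" where
  "adjoint_expr F1 F2 w z = - euler_op (Orig w) (formal_lagrangian F1 F2) z"


type_synonym base = "real \<times> real \<times> real \<times> real"

definition base_pt :: "dep jet \<Rightarrow> base" where
  "base_pt z = (z Time, z Space, z (Der U 0 0), z (Der V 0 0))"

text \<open>Replacing the barred variables by \<open>\<phi>(t,x,u,v)\<close>, \<open>\<psi>(t,x,u,v)\<close> and their derivatives by the
  total derivatives of \<open>\<phi>\<close>, \<open>\<psi>\<close>.\<close>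

fun subst_jet :: "(base \<Rightarrow> real) \<Rightarrow> (base \<Rightarrow> real) \<Rightarrow> dep jet \<Rightarrow> ext_dep jet" where
  "subst_jet \<phi> \<psi> z Time = z Time"
| "subst_jet \<phi> \<psi> z Space = z Space"
| "subst_jet \<phi> \<psi> z (Der (Orig w) i j) = z (Der w i j)"
| "subst_jet \<phi> \<psi> z (Der (Bar U) i j) = total_deriv i j (\<lambda>y. \<phi> (base_pt y)) z"
| "subst_jet \<phi> \<psi> z (Der (Bar V) i j) = total_deriv i j (\<lambda>y. \<psi> (base_pt y)) z"


text \<open>\<open>C\<^sup>k\<close> functions on an open set, and smooth functions.\<close>

fun higher_differentiable_on ::
    "'a::real_normed_vector set \<Rightarrow> ('a \<Rightarrow> 'b::real_normed_vector) \<Rightarrow> nat \<Rightarrow> bool" where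
  "higher_differentiable_on S f 0 \<longleftrightarrow> continuous_on S f"
| "higher_differentiable_on S f (Suc k) \<longleftrightarrow>
     (\<forall>x\<in>S. f differentiable (at x)) \<and>
     (\<forall>h. higher_differentiable_on S (\<lambda>x. frechet_derivative f (at x) h) k)"

definition smooth_on ::
    "'a::real_normed_vector set \<Rightarrow> ('a \<Rightarrow> 'b::real_normed_vector) \<Rightarrow> bool" where
  "smooth_on S f \<longleftrightarrow> (\<forall>k. higher_differentiable_on S f k)"


text \<open>\<open>\<Omega>\<close> is the open region of \<open>(t,x,u,v)\<close>-space on which all functions are considered. The
  coefficients \<open>M\<close>, \<open>N\<close>, \<open>P\<close>, \<open>Q\<close> are arbitrary functions on the jet space of \<open>u\<close>, \<open>v\<close>; no
  regularity is imposed on them.\<close>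

definition self_adjoint_subst ::
    "base set \<Rightarrow> (dep jet \<Rightarrow> real) \<Rightarrow> (dep jet \<Rightarrow> real)
      \<Rightarrow> (base \<Rightarrow> real) \<Rightarrow> (base \<Rightarrow> real) \<Rightarrow> bool" where
  "self_adjoint_subst \<Omega> F1 F2 \<phi> \<psi> \<longleftrightarrow>
     smooth_on \<Omega> \<phi> \<and> smooth_on \<Omega> \<psi> \<and>
     (\<exists>p\<in>\<Omega>. \<phi> p \<noteq> 0 \<or> \<psi> p \<noteq> 0) \<and>
     (\<exists>M N P Q :: dep jet \<Rightarrow> real. \<forall>z. base_pt z \<in> \<Omega> \<longrightarrow>
        adjoint_expr F1 F2 U (subst_jet \<phi> \<psi> z) = M z * F1 z + N z * F2 z \<and>
        adjoint_expr F1 F2 V (subst_jet \<phi> \<psi> z) = P z * F1 z + Q z * F2 z)"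

definition nonlinearly_self_adjoint ::
    "base set \<Rightarrow> (dep jet \<Rightarrow> real) \<Rightarrow> (dep jet \<Rightarrow> real) \<Rightarrow> bool" where
  "nonlinearly_self_adjoint \<Omega> F1 F2 \<longleftrightarrow> (\<exists>\<phi> \<psi>. self_adjoint_subst \<Omega> F1 F2 \<phi> \<psi>)"


definition sys_F1 :: "real \<Rightarrow> real \<Rightarrow> real \<Rightarrow> real \<Rightarrow> real \<Rightarrow> dep jet \<Rightarrow> real" where
  "sys_F1 a b c \<epsilon> \<kappa> z =
     z (Der U 1 0) + (a + b) * z (Der V 0 0) * z (Der U 0 1)
     + (a * z (Der U 0 0) + c) * z (Der V 0 1)
     + \<epsilon> * z (Der U 1 2) + \<kappa> * z (Der V 0 3)"

definition sys_F2 :: "real \<Rightarrow> real \<Rightarrow> real \<Rightarrow> real \<Rightarrow> real \<Rightarrow> dep jet \<Rightarrow> real" where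
  "sys_F2 a b c lam \<sigma> z =
     z (Der V 1 0) + (b * z (Der U 0 0) + c) * z (Der U 0 1)
     + (a + b) * z (Der V 0 0) * z (Der V 0 1)
     + lam * z (Der U 0 3) + \<sigma> * z (Der V 1 2)"

definition region :: "real \<Rightarrow> real \<Rightarrow> base set" where
  "region a c = {(t, x, u, v). a \<noteq> 0 \<longrightarrow> a * u + c > 0}"


text \<open>The explicit form of the adjoint expressions of this system is
  \<open>adjoint_expr_sys_U\<close>, \<open>adjoint_expr_sys_V\<close> below.\<close>

lemma jet_pderiv_quad: "jet_pderiv y (\<lambda>z. (p * z A + q) * z B) z
   = (if y = A then p * z B else 0) + (if y = B then p * z A + q else 0)" for z :: "'d jet"
proof -
  have "((\<lambda>s. (p * (z(y:=s)) A + q) * (z(y:=s)) B) has_field_derivative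
     ((if y = A then p * z B else 0) + (if y = B then p * z A + q else 0))) (at (z y))"
    by (auto intro!: derivative_eq_intros)
  then show ?thesis unfolding jet_pderiv_def by (rule DERIV_imp_deriv)
qed

lemma Sum_any_two:
  fixes g :: "'d \<Rightarrow> nat \<Rightarrow> nat \<Rightarrow> real"
  shows "Sum_any (\<lambda>(w, i, j). g w i j * ((if Der w i j = Der w1 i1 j1 then r else 0)
        + (if Der w i j = Der w2 i2 j2 then s else 0))) = g w1 i1 j1 * r + g w2 i2 j2 * s"
proof -
  have "Sum_any (\<lambda>(w, i, j). g w i j * ((if Der w i j = Der w1 i1 j1 then r else 0)
        + (if Der w i j = Der w2 i2 j2 then s else 0)))
     = (\<Sum>(w,i,j)\<in>{(w1,i1,j1),(w2,i2,j2)}. g w i j * ((if Der w i j = Der w1 i1 j1 then r else 0)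
        + (if Der w i j = Der w2 i2 j2 then s else 0)))"
    by (rule Sum_any.expand_superset) (auto split: if_splits)
  also have "\<dots> = g w1 i1 j1 * r + g w2 i2 j2 * s"
    by (cases "(w1,i1,j1) = (w2,i2,j2)") (auto simp: algebra_simps)
  finally show ?thesis .
qed

lemma total_dx_quad:
  "total_dx (\<lambda>z. (p * z (Der w1 i1 j1) + q) * z (Der w2 i2 j2)) =
   (\<lambda>z :: 'd jet. p * z (Der w1 i1 (Suc j1)) * z (Der w2 i2 j2)
     + (p * z (Der w1 i1 j1) + q) * z (Der w2 i2 (Suc j2)))"
  unfolding total_dx_def jet_pderiv_quad by (rule ext, subst Sum_any_two) (simp)

lemma total_dt_quad:
  "total_dt (\<lambda>z. (p * z (Der w1 i1 j1) + q) * z (Der w2 i2 j2)) =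
   (\<lambda>z :: 'd jet. p * z (Der w1 (Suc i1) j1) * z (Der w2 i2 j2)
     + (p * z (Der w1 i1 j1) + q) * z (Der w2 (Suc i2) j2))"
  unfolding total_dt_def jet_pderiv_quad by (rule ext, subst Sum_any_two) (simp)

lemma total_dx_lin: "total_dx (\<lambda>z::'d jet. q * z (Der w2 i2 j2)) = (\<lambda>z. q * z (Der w2 i2 (Suc j2)))"
  using total_dx_quad[of 0 w2 0 0 q w2 i2 j2] by simp

lemma total_dt_lin: "total_dt (\<lambda>z::'d jet. q * z (Der w2 i2 j2)) = (\<lambda>z. q * z (Der w2 (Suc i2) j2))"
  using total_dt_quad[of 0 w2 0 0 q w2 i2 j2] by simp

lemma total_dx_zero: "total_dx (\<lambda>z::'d jet. 0) = (\<lambda>z. 0)"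
  and total_dt_zero: "total_dt (\<lambda>z::'d jet. 0) = (\<lambda>z. 0)"
  using total_dx_lin[of 0] total_dt_lin[of 0] by simp_all

lemma total_deriv_zero: "total_deriv i j (\<lambda>z::'d jet. 0) = (\<lambda>z. 0)"
proof -
  have "(total_dx ^^ j) (\<lambda>z::'d jet. 0) = (\<lambda>z. 0)" by (induction j) (auto simp: total_dx_zero)
  moreover have "(total_dt ^^ i) (\<lambda>z::'d jet. 0) = (\<lambda>z. 0)" by (induction i) (auto simp: total_dt_zero)
  ultimately show ?thesis by (simp add: total_deriv_def)
qed

lemma jet_pderiv_lagrangian_U:
  "jet_pderiv (Der (Orig U) i j)
     (formal_lagrangian (sys_F1 a b c \<epsilon> \<kappa>) (sys_F2 a b c lam \<sigma>)) = (\<lambda>z.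
   if i = 0 \<and> j = 0 then a * z (Der (Orig V) 0 1) * z (Der (Bar U) 0 0)
     + b * z (Der (Orig U) 0 1) * z (Der (Bar V) 0 0) else
   if i = 1 \<and> j = 0 then z (Der (Bar U) 0 0) else
   if i = 0 \<and> j = 1 then (a + b) * z (Der (Orig V) 0 0) * z (Der (Bar U) 0 0)
     + (b * z (Der (Orig U) 0 0) + c) * z (Der (Bar V) 0 0) else
   if i = 1 \<and> j = 2 then \<epsilon> * z (Der (Bar U) 0 0) else
   if i = 0 \<and> j = 3 then lam * z (Der (Bar V) 0 0) else 0)"
proof (rule ext)
  fix z
  consider "i = 0 \<and> j = 0" | "i = 1 \<and> j = 0" | "i = 0 \<and> j = 1" | "i = 1 \<and> j = 2" | "i = 0 \<and> j = 3"
    | "\<not> (i = 0 \<and> j = 0)" "\<not> (i = 1 \<and> j = 0)" "\<not> (i = 0 \<and> j = 1)"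
      "\<not> (i = 1 \<and> j = 2)" "\<not> (i = 0 \<and> j = 3)"
    by blast
  then show "jet_pderiv (Der (Orig U) i j)
     (formal_lagrangian (sys_F1 a b c \<epsilon> \<kappa>) (sys_F2 a b c lam \<sigma>)) z =
   (if i = 0 \<and> j = 0 then a * z (Der (Orig V) 0 1) * z (Der (Bar U) 0 0)
     + b * z (Der (Orig U) 0 1) * z (Der (Bar V) 0 0) else
   if i = 1 \<and> j = 0 then z (Der (Bar U) 0 0) else
   if i = 0 \<and> j = 1 then (a + b) * z (Der (Orig V) 0 0) * z (Der (Bar U) 0 0)
     + (b * z (Der (Orig U) 0 0) + c) * z (Der (Bar V) 0 0) else
   if i = 1 \<and> j = 2 then \<epsilon> * z (Der (Bar U) 0 0) else
   if i = 0 \<and> j = 3 then lam * z (Der (Bar V) 0 0) else 0)"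
    unfolding jet_pderiv_def formal_lagrangian_def sys_F1_def sys_F2_def o_def
    by cases (simp_all, (rule DERIV_imp_deriv, auto intro!: derivative_eq_intros simp: algebra_simps)+)
qed

lemma jet_pderiv_lagrangian_V:
  "jet_pderiv (Der (Orig V) i j)
     (formal_lagrangian (sys_F1 a b c \<epsilon> \<kappa>) (sys_F2 a b c lam \<sigma>)) = (\<lambda>z.
   if i = 0 \<and> j = 0 then (a + b) * z (Der (Orig U) 0 1) * z (Der (Bar U) 0 0)
     + (a + b) * z (Der (Orig V) 0 1) * z (Der (Bar V) 0 0) else
   if i = 1 \<and> j = 0 then z (Der (Bar V) 0 0) else
   if i = 0 \<and> j = 1 then (a + b) * z (Der (Orig V) 0 0) * z (Der (Bar V) 0 0)
     + (a * z (Der (Orig U) 0 0) + c) * z (Der (Bar U) 0 0) else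
   if i = 1 \<and> j = 2 then \<sigma> * z (Der (Bar V) 0 0) else
   if i = 0 \<and> j = 3 then \<kappa> * z (Der (Bar U) 0 0) else 0)"
proof (rule ext)
  fix z
  consider "i = 0 \<and> j = 0" | "i = 1 \<and> j = 0" | "i = 0 \<and> j = 1" | "i = 1 \<and> j = 2" | "i = 0 \<and> j = 3"
    | "\<not> (i = 0 \<and> j = 0)" "\<not> (i = 1 \<and> j = 0)" "\<not> (i = 0 \<and> j = 1)"
      "\<not> (i = 1 \<and> j = 2)" "\<not> (i = 0 \<and> j = 3)"
    by blast
  then show "jet_pderiv (Der (Orig V) i j)
     (formal_lagrangian (sys_F1 a b c \<epsilon> \<kappa>) (sys_F2 a b c lam \<sigma>)) z =
   (if i = 0 \<and> j = 0 then (a + b) * z (Der (Orig U) 0 1) * z (Der (Bar U) 0 0)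
     + (a + b) * z (Der (Orig V) 0 1) * z (Der (Bar V) 0 0) else
   if i = 1 \<and> j = 0 then z (Der (Bar V) 0 0) else
   if i = 0 \<and> j = 1 then (a + b) * z (Der (Orig V) 0 0) * z (Der (Bar V) 0 0)
     + (a * z (Der (Orig U) 0 0) + c) * z (Der (Bar U) 0 0) else
   if i = 1 \<and> j = 2 then \<sigma> * z (Der (Bar V) 0 0) else
   if i = 0 \<and> j = 3 then \<kappa> * z (Der (Bar U) 0 0) else 0)"
    unfolding jet_pderiv_def formal_lagrangian_def sys_F1_def sys_F2_def o_def
    by cases (simp_all, (rule DERIV_imp_deriv, auto intro!: derivative_eq_intros simp: algebra_simps)+)
qed

lemma jet_pderiv_quad2:
  fixes z :: "'d jet"
  shows "jet_pderiv y (\<lambda>z. p * z A * z B + (q * z C + r) * z D) z =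
    (if y = A then p * z B else 0) + (if y = B then p * z A else 0)
    + ((if y = C then q * z D else 0) + (if y = D then q * z C + r else 0))"
proof -
  have "((\<lambda>s. p * (z(y := s)) A * (z(y := s)) B + (q * (z(y := s)) C + r) * (z(y := s)) D)
    has_field_derivative
    (if y = A then p * z B else 0) + (if y = B then p * z A else 0)
    + ((if y = C then q * z D else 0) + (if y = D then q * z C + r else 0))) (at (z y))"
    by (auto intro!: derivative_eq_intros simp: algebra_simps)
  then show ?thesis unfolding jet_pderiv_def by (rule DERIV_imp_deriv)
qed

lemma total_dx_quad2:
  "total_dx (\<lambda>z. p * z (Der w1 i1 j1) * z (Der w2 i2 j2)
       + (q * z (Der w3 i3 j3) + r) * z (Der w4 i4 j4)) =
   (\<lambda>z :: 'd jet. p * z (Der w1 i1 (Suc j1)) * z (Der w2 i2 j2)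
     + p * z (Der w1 i1 j1) * z (Der w2 i2 (Suc j2))
     + (q * z (Der w3 i3 (Suc j3)) * z (Der w4 i4 j4)
     + (q * z (Der w3 i3 j3) + r) * z (Der w4 i4 (Suc j4))))"
proof -
  define G where "G = (\<lambda>(g :: 'd \<Rightarrow> nat \<Rightarrow> nat \<Rightarrow> real) w1 i1 j1 (r1::real) w2 i2 j2 r2 (w, i, j).
    g w i j * ((if Der w i j = Der w1 i1 j1 then r1 else 0)
      + (if Der w i j = Der w2 i2 j2 then r2 else 0)))"
  have fin: "finite {p. G g w1 i1 j1 r1 w2 i2 j2 r2 p \<noteq> 0}" for g w1 i1 j1 r1 w2 i2 j2 r2
    by (rule finite_subset[of _ "{(w1,i1,j1),(w2,i2,j2)}"])
      (auto simp: G_def split: if_splits)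
  have *: "Sum_any (\<lambda>(w, i, j). g w i j *
        ((if Der w i j = Der w1 i1 j1 then r1 else 0)
        + (if Der w i j = Der w2 i2 j2 then r2 else 0)
        + ((if Der w i j = Der w3 i3 j3 then r3 else 0)
        + (if Der w i j = Der w4 i4 j4 then r4 else 0))))
      = g w1 i1 j1 * r1 + g w2 i2 j2 * r2 + (g w3 i3 j3 * r3 + g w4 i4 j4 * r4)"
    (is "Sum_any ?F = ?R") for g and r1 r2 r3 r4 :: real
  proof -
    have "?F = (\<lambda>p. G g w1 i1 j1 r1 w2 i2 j2 r2 p + G g w3 i3 j3 r3 w4 i4 j4 r4 p)"
      by (rule ext) (simp add: G_def case_prod_unfold ring_distribs)
    then have "Sum_any ?F = Sum_any (G g w1 i1 j1 r1 w2 i2 j2 r2)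
        + Sum_any (G g w3 i3 j3 r3 w4 i4 j4 r4)"
      by (simp add: Sum_any.distrib fin)
    also have "\<dots> = ?R"
      unfolding G_def by (simp only: Sum_any_two prod.case)
    finally show ?thesis .
  qed
  show ?thesis
    unfolding total_dx_def jet_pderiv_quad2 by (rule ext, subst *) simp
qed

lemma euler_op_sys:
  assumes "\<And>i j. (i, j) \<notin> {(0,0),(1,0),(0,1),(1,2),(0,3)} \<Longrightarrow> jet_pderiv (Der w i j) f = (\<lambda>z. 0)"
  shows "euler_op w f z = (\<Sum>(i,j)\<in>{(0,0),(1,0),(0,1),(1,2),(0,3)}.
    (-1) ^ (i + j) * total_deriv i j (jet_pderiv (Der w i j) f) z)"
  unfolding euler_op_def
proof (rule Sum_any.expand_superset)
  show "{p. (case p of (i, j) \<Rightarrow> (-1) ^ (i + j) * total_deriv i j (jet_pderiv (Der w i j) f) z) \<noteq> 0}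
    \<subseteq> {(0,0),(1,0),(0,1),(1,2),(0,3)}" (is "?A \<subseteq> ?B")
  proof (rule subsetI, rule ccontr)
    fix p assume p: "p \<in> ?A" "p \<notin> ?B"
    obtain i j where ij: "p = (i, j)" by (cases p)
    have "jet_pderiv (Der w i j) f = (\<lambda>z. 0)"
      using p(2) unfolding ij by (rule assms)
    then show False using p(1) by (simp add: ij total_deriv_zero)
  qed
qed simp

lemma adjoint_expr_sys_U:
  "adjoint_expr (sys_F1 a b c \<epsilon> \<kappa>) (sys_F2 a b c lam \<sigma>) U z =
     z (Der (Bar U) 1 0) + (a + b) * z (Der (Orig V) 0 0) * z (Der (Bar U) 0 1)
     + (b * z (Der (Orig U) 0 0) + c) * z (Der (Bar V) 0 1)
     + b * z (Der (Bar U) 0 0) * z (Der (Orig V) 0 1)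
     + \<epsilon> * z (Der (Bar U) 1 2) + lam * z (Der (Bar V) 0 3)"
  unfolding adjoint_expr_def
  apply (subst euler_op_sys)
  subgoal for i j by (cases i; cases j) (auto simp: jet_pderiv_lagrangian_U)
  apply (simp add: jet_pderiv_lagrangian_U total_deriv_def eval_nat_numeral total_dx_quad2
      total_dx_lin total_dt_lin total_dx_lin[of 1, simplified] total_dt_lin[of 1, simplified])
  apply (simp add: algebra_simps)
  done

lemma adjoint_expr_sys_V:
  "adjoint_expr (sys_F1 a b c \<epsilon> \<kappa>) (sys_F2 a b c lam \<sigma>) V z =
     z (Der (Bar V) 1 0) + (a * z (Der (Orig U) 0 0) + c) * z (Der (Bar U) 0 1)
     + (a + b) * z (Der (Orig V) 0 0) * z (Der (Bar V) 0 1)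
     - b * z (Der (Bar U) 0 0) * z (Der (Orig U) 0 1)
     + \<kappa> * z (Der (Bar U) 0 3) + \<sigma> * z (Der (Bar V) 1 2)"
  unfolding adjoint_expr_def
  apply (subst euler_op_sys)
  subgoal for i j by (cases i; cases j) (auto simp: jet_pderiv_lagrangian_V)
  apply (simp add: jet_pderiv_lagrangian_V total_deriv_def eval_nat_numeral total_dx_quad2
      total_dx_lin total_dt_lin total_dx_lin[of 1, simplified] total_dt_lin[of 1, simplified])
  apply (simp add: algebra_simps)
  done

end

theory Submission
  imports Defs
begin

text \<open>
  The coefficients \<open>M\<close>, \<open>N\<close>, \<open>P\<close>, \<open>Q\<close> are arbitrary functions on jets. The identities
  \<open>F\<^sub>1\<^sup>* = M F\<^sub>1 + N F\<^sub>2\<close>, \<open>F\<^sub>2\<^sup>* = P F\<^sub>1 + Q F\<^sub>2\<close> therefore say exactly that \<open>F\<^sub>1\<^sup>*\<close> and \<open>F\<^sub>2\<^sup>*\<close>, after the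
  substitution, vanish at all jets with \<open>F\<^sub>1 = F\<^sub>2 = 0\<close> (\<open>self_adjoint_subst_iff_adj\<close>). On these jets \<open>u\<^sub>t\<close>
  and \<open>v\<^sub>t\<close> are determined by the other coordinates, which are free; so the coefficients of the free
  coordinates have to vanish.

  The coordinates \<open>u\<^sub>t\<^sub>x\<close>, \<open>v\<^sub>t\<^sub>x\<close>, \<open>u\<^sub>x\<^sub>x\<close>, \<open>v\<^sub>x\<^sub>x\<close> show that the dispersive terms force \<open>\<phi>\<close> or \<open>\<psi>\<close> to be affine in
  \<open>u\<close>, \<open>v\<close> (\<open>affine_cases\<close>). This makes the remaining coefficients short (\<open>determining_equations\<close>):
  there are two transport equations for \<open>\<phi>\<close> and \<open>\<psi>\<close>, the relations \<open>\<psi>\<^sub>u = \<phi>\<^sub>v\<close> and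
  \<open>(b u + c) \<psi>\<^sub>v + b \<phi> = (a u + c) \<phi>\<^sub>u\<close>, and algebraic constraints such as \<open>\<kappa> \<phi>\<^sub>u = \<lambda> \<psi>\<^sub>v\<close>. Differentiating these
  equations and using \<open>(a + b) c \<noteq> 0\<close> one finds that \<open>\<phi>\<^sub>x\<close> is a constant \<open>\<gamma>\<close>, that \<open>\<psi>\<^sub>x = 0\<close>, and
  \<open>\<phi> = \<gamma> x + f(u) + (E0 - a \<gamma> t) v\<close>, \<open>\<psi> = D0 - c \<gamma> t + (E0 - a \<gamma> t) u + G v\<close>
  with \<open>b \<gamma> = b E0 = 0\<close> and \<open>(a u + c) f' = b f + (b u + c) G\<close> (\<open>explicit_form\<close>). Conversely, for functions of this
  form that satisfy the algebraic constraints, the adjoint expressions are combinations of \<open>F\<^sub>1\<close> and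
  \<open>F\<^sub>2\<close> with the coefficients \<open>f'\<close>, \<open>E0 - a \<gamma> t\<close>, \<open>E0 - a \<gamma> t\<close>, \<open>G\<close>
  (\<open>substitution_form_solves_adjoint\<close>).

  So the substitutions are described by one linear first-order equation for \<open>f\<close>, for all
  parameters at once (\<open>self_adjoint_subst_iff\<close>). The cases of the theorem are the cases of its solution:
  for \<open>b = 0\<close> it can be integrated directly, for \<open>a = b\<close> it is resonant, for \<open>a = 0\<close> it has constant
  coefficients, and otherwise it is of Euler type. The constraints \<open>\<kappa> f' = \<lambda> G\<close> and, for \<open>\<epsilon> \<noteq> 0\<close>, \<open>f'\<close> constant
  become the restrictions on the constants \<open>c\<^sub>i\<close>.
\<close>

section \<open>Smooth functions and their directional derivatives\<close>

locale open_domain =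
  fixes S :: "'a::real_normed_vector set"
  assumes open_S: "open S"
begin

text \<open>Extending directional derivatives by \<open>0\<close> outside \<open>S\<close> turns identities that hold on \<open>S\<close> into
  equalities of functions, so that they can be differentiated again by plain rewriting.\<close>

definition pd :: "'a \<Rightarrow> ('a \<Rightarrow> real) \<Rightarrow> 'a \<Rightarrow> real" where
  "pd h f p = (if p \<in> S then frechet_derivative f (at p) h else 0)"

lemma pd_cong:
  assumes "\<And>p. p \<in> S \<Longrightarrow> f p = g p"
  shows "pd h f = pd h g"
proof
  fix p
  have "(f has_derivative D) (at p) \<longleftrightarrow> (g has_derivative D) (at p)" if "p \<in> S" for D
    using has_derivative_transform_within_open[OF _ open_S that] assms by metis
  then show "pd h f p = pd h g p"
    by (simp add: pd_def frechet_derivative_def)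
qed

lemma pd_eqI:
  assumes "(f has_derivative D) (at p)" "p \<in> S"
  shows "pd h f p = D h"
  using frechet_derivative_at[OF assms(1)] assms(2) by (simp add: pd_def)

lemma pd_const [simp]: "pd h (\<lambda>_. r) = (\<lambda>_. 0)"
  by (auto simp: pd_def)

lemma higher_differentiable_on_cong:
  assumes "\<And>p. p \<in> S \<Longrightarrow> f p = g p"
  shows "higher_differentiable_on S f k \<longleftrightarrow> higher_differentiable_on S (g :: 'a \<Rightarrow> real) k"
  using assms
proof (induction k arbitrary: f g)
  case 0
  then show ?case by (simp cong: continuous_on_cong)
next
  case (Suc k)
  have "f differentiable (at p) \<longleftrightarrow> g differentiable (at p)" if "p \<in> S" for p
    unfolding differentiable_def
    using has_derivative_transform_within_open[OF _ open_S that] Suc.prems by metis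
  moreover have "frechet_derivative f (at p) h = frechet_derivative g (at p) h" if "p \<in> S" for p h
    using pd_cong[of f g h] Suc.prems that by (metis pd_def)
  ultimately show ?case
    unfolding higher_differentiable_on.simps
    by (intro arg_cong2[where f = "(\<and>)"] ball_cong all_cong1 Suc.IH) simp_all
qed

lemma higher_differentiable_on_Suc:
  "higher_differentiable_on S f (Suc k) \<longleftrightarrow>
    (\<forall>p\<in>S. f differentiable (at p)) \<and> (\<forall>h. higher_differentiable_on S (pd h f) k)"
proof -
  have "higher_differentiable_on S (\<lambda>p. frechet_derivative f (at p) h) k
    \<longleftrightarrow> higher_differentiable_on S (pd h f) k" for h
    by (rule higher_differentiable_on_cong) (simp add: pd_def)
  then show ?thesis by simp
qed

lemma higher_differentiable_on_pd:
  "higher_differentiable_on S f (Suc k) \<Longrightarrow> higher_differentiable_on S (pd h f) k"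
  by (simp only: higher_differentiable_on_Suc)

text \<open>The form in which smoothness of a concrete function is proved: any formula for the
  derivative may be used in place of \<^const>\<open>frechet_derivative\<close>.\<close>

lemma higher_differentiable_on_SucI:
  assumes "\<And>p. p \<in> S \<Longrightarrow> (f has_derivative (\<lambda>h. D h p)) (at p)"
    and "\<And>h. higher_differentiable_on S (D h) k"
  shows "higher_differentiable_on S (f :: 'a \<Rightarrow> real) (Suc k)"
  unfolding higher_differentiable_on_Suc
proof safe
  show "f differentiable (at p)" if "p \<in> S" for p
    using assms(1)[OF that] by (auto simp: differentiable_def)
  have "pd h f p = D h p" if "p \<in> S" for h p
    using assms(1)[OF that] that by (rule pd_eqI)
  then show "higher_differentiable_on S (pd h f) k" for h
    using higher_differentiable_on_cong[of "pd h f" "D h" k] assms(2) by simp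
qed

lemma smooth_on_cong:
  "(\<And>p. p \<in> S \<Longrightarrow> f p = g p) \<Longrightarrow> smooth_on S f \<longleftrightarrow> smooth_on S (g :: 'a \<Rightarrow> real)"
  unfolding smooth_on_def by (intro all_cong1 higher_differentiable_on_cong)

lemma smooth_on_pd: "smooth_on S f \<Longrightarrow> smooth_on S (pd h f)"
  unfolding smooth_on_def by (intro allI higher_differentiable_on_pd) (erule spec)

lemma smooth_on_has_derivative:
  assumes "smooth_on S f" "p \<in> S"
  shows "(f has_derivative (\<lambda>h. pd h f p)) (at p)"
proof -
  have "f differentiable (at p)"
    using assms(2) assms(1)[unfolded smooth_on_def, rule_format, of 1] by simp
  then show ?thesis
    using frechet_derivative_works[of f "at p"] assms(2) by (simp add: pd_def)
qed

lemma smooth_on_continuous: "smooth_on S f \<Longrightarrow> continuous_on S f"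
  unfolding smooth_on_def by (drule spec[of _ 0]) simp

lemma higher_differentiable_on_SucD:
  "higher_differentiable_on S (f :: 'a \<Rightarrow> real) (Suc k) \<Longrightarrow> higher_differentiable_on S f k"
proof (induction k arbitrary: f)
  case 0
  then show ?case
    by (auto intro!: differentiable_imp_continuous_on simp: differentiable_on_def
        intro: differentiable_at_withinI differentiable_at_imp_differentiable_on)
next
  case (Suc k)
  then show ?case by (meson higher_differentiable_on_Suc)
qed

lemma higher_differentiable_on_has_derivative:
  assumes "higher_differentiable_on S f (Suc k)" "p \<in> S"
  shows "(f has_derivative (\<lambda>h. pd h f p)) (at p)"
  using assms frechet_derivative_works[of f "at p"] by (simp add: pd_def)

lemma higher_differentiable_on_add:
  assumes "higher_differentiable_on S f k" "higher_differentiable_on S g k"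
  shows "higher_differentiable_on S (\<lambda>p. f p + g p :: real) k"
  using assms
proof (induction k arbitrary: f g)
  case 0
  then show ?case by (simp add: continuous_on_add)
next
  case (Suc k)
  show ?case
  proof (rule higher_differentiable_on_SucI)
    show "((\<lambda>p. f p + g p) has_derivative (\<lambda>h. pd h f p + pd h g p)) (at p)" if "p \<in> S" for p
      using Suc.prems that by (intro has_derivative_add higher_differentiable_on_has_derivative)
    show "higher_differentiable_on S (\<lambda>p. pd h f p + pd h g p) k" for h
      by (intro Suc.IH higher_differentiable_on_pd Suc.prems)
  qed
qed

lemma higher_differentiable_on_mult:
  assumes "higher_differentiable_on S f k" "higher_differentiable_on S g k"
  shows "higher_differentiable_on S (\<lambda>p. f p * g p :: real) k"
  using assms
proof (induction k arbitrary: f g)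
  case 0
  then show ?case by (simp add: continuous_on_mult)
next
  case (Suc k)
  show ?case
  proof (rule higher_differentiable_on_SucI)
    show "((\<lambda>p. f p * g p) has_derivative (\<lambda>h. f p * pd h g p + pd h f p * g p)) (at p)"
      if "p \<in> S" for p
      using Suc.prems that by (intro has_derivative_mult higher_differentiable_on_has_derivative)
    show "higher_differentiable_on S (\<lambda>p. f p * pd h g p + pd h f p * g p) k" for h
      by (rule higher_differentiable_on_add)
        (rule Suc.IH higher_differentiable_on_pd[OF Suc.prems(1)] higher_differentiable_on_pd[OF Suc.prems(2)]
          higher_differentiable_on_SucD[OF Suc.prems(1)] higher_differentiable_on_SucD[OF Suc.prems(2)])+
  qed
qed

lemma higher_differentiable_on_const: "higher_differentiable_on S (\<lambda>_. r :: real) k"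
  by (induction k arbitrary: r) (simp_all add: frechet_derivative_const)

lemma higher_differentiable_on_linear:
  assumes "bounded_linear f"
  shows "higher_differentiable_on S (f :: 'a \<Rightarrow> real) k"
proof (cases k)
  case 0
  then show ?thesis by (simp add: linear_continuous_on assms)
next
  case (Suc m)
  show ?thesis
    unfolding Suc
    by (rule higher_differentiable_on_SucI[where D = "\<lambda>h p. f h"])
      (rule bounded_linear_imp_has_derivative[OF assms] higher_differentiable_on_const)+
qed

lemma smooth_on_add: "smooth_on S f \<Longrightarrow> smooth_on S g \<Longrightarrow> smooth_on S (\<lambda>p. f p + g p :: real)"
  and smooth_on_mult: "smooth_on S f \<Longrightarrow> smooth_on S g \<Longrightarrow> smooth_on S (\<lambda>p. f p * g p :: real)"
  and smooth_on_const: "smooth_on S (\<lambda>_. r :: real)"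
  and smooth_on_linear: "bounded_linear f' \<Longrightarrow> smooth_on S (f' :: 'a \<Rightarrow> real)"
  by (simp_all add: smooth_on_def higher_differentiable_on_add higher_differentiable_on_mult
      higher_differentiable_on_const higher_differentiable_on_linear)

text \<open>Bootstrapping: when the derivative of \<open>f\<close> is \<open>D\<close> up to a factor depending only on the
  direction, and \<open>D\<close> is as regular as \<open>f\<close> (as for a solution of an ordinary differential equation),
  each order of differentiability yields the next. This avoids computing the higher derivatives of
  logarithms, exponentials and powers.\<close>

lemma smooth_on_bootstrap:
  assumes "\<And>p. p \<in> S \<Longrightarrow> (f has_derivative (\<lambda>h. l h * D p)) (at p)"
    and "\<And>k. higher_differentiable_on S f k \<Longrightarrow> higher_differentiable_on S D k"
  shows "smooth_on S (f :: 'a \<Rightarrow> real)"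
  unfolding smooth_on_def
proof
  fix k
  show "higher_differentiable_on S f k"
  proof (induction k)
    case 0
    have "continuous (at p) f" if "p \<in> S" for p
      using has_derivative_continuous assms(1) that by blast
    then show ?case by (simp add: continuous_at_imp_continuous_on)
  next
    case (Suc k)
    show ?case
      by (rule higher_differentiable_on_SucI, rule assms(1), assumption)
        (rule assms(2) higher_differentiable_on_mult higher_differentiable_on_const Suc)+
  qed
qed

lemma DERIV_along_line:
  assumes "smooth_on S f" "p + s *\<^sub>R h \<in> S"
  shows "((\<lambda>s. f (p + s *\<^sub>R h)) has_real_derivative pd h f (p + s *\<^sub>R h)) (at s)"
proof -
  let ?D = "\<lambda>h'. pd h' f (p + s *\<^sub>R h)"
  have D: "(f has_derivative ?D) (at (p + s *\<^sub>R h))"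
    by (rule smooth_on_has_derivative[OF assms])
  have "((\<lambda>s. p + s *\<^sub>R h) has_derivative (\<lambda>r. r *\<^sub>R h)) (at s)"
    by (auto intro!: derivative_eq_intros)
  from has_derivative_compose[OF this D]
  have "((\<lambda>s. f (p + s *\<^sub>R h)) has_derivative (\<lambda>r. ?D (r *\<^sub>R h))) (at s)" .
  moreover have "?D (r *\<^sub>R h) = ?D h * r" for r
    using linear_cmul[OF has_derivative_linear[OF D], of r h] by simp
  ultimately show ?thesis
    by (simp add: has_field_derivative_def)
qed

lemma constant_along_segment:
  assumes f: "smooth_on S f" and pq: "closed_segment p q \<subseteq> S"
    and z: "\<And>y. y \<in> S \<Longrightarrow> pd (q - p) f y = 0"
  shows "f q = f p"
proof -
  have seg: "p + s *\<^sub>R (q - p) \<in> S" if "0 \<le> s" "s \<le> 1" for s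
    using pq that by (force simp: closed_segment_def algebra_simps)
  have "((\<lambda>s. f (p + s *\<^sub>R (q - p))) has_real_derivative 0) (at s)" if "0 \<le> s" "s \<le> 1" for s
    using DERIV_along_line[OF f seg[OF that]] z[OF seg[OF that]] by simp
  from MVT2[OF zero_less_one this] show ?thesis by auto
qed

text \<open>Two applications of the mean value theorem. The left-hand side is symmetric in \<open>h\<close> and \<open>k\<close>,
  the right-hand side is not: this is where the symmetry of second derivatives comes from.\<close>

lemma second_difference:
  assumes f: "smooth_on S f" and s: "s > 0"
    and sq: "\<And>\<xi> \<eta>. \<xi> \<in> {0..s} \<Longrightarrow> \<eta> \<in> {0..s} \<Longrightarrow> p + \<xi> *\<^sub>R h + \<eta> *\<^sub>R k \<in> S"
  obtains \<xi> \<eta> where "\<xi> \<in> {0..s}" "\<eta> \<in> {0..s}"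
    "f (p + s *\<^sub>R h + s *\<^sub>R k) - f (p + s *\<^sub>R h) - f (p + s *\<^sub>R k) + f p
      = s * s * pd k (pd h f) (p + \<xi> *\<^sub>R h + \<eta> *\<^sub>R k)"
proof -
  define g where "g = (\<lambda>r. f (p + s *\<^sub>R k + r *\<^sub>R h) - f (p + r *\<^sub>R h))"
  have g: "(g has_real_derivative pd h f (p + s *\<^sub>R k + r *\<^sub>R h) - pd h f (p + r *\<^sub>R h)) (at r)"
    if "0 \<le> r" "r \<le> s" for r
    unfolding g_def
  proof (intro DERIV_diff DERIV_along_line f)
    show "p + s *\<^sub>R k + r *\<^sub>R h \<in> S" "p + r *\<^sub>R h \<in> S"
      using that sq[of r 0] sq[of r s] s by (simp_all add: ac_simps)
  qed
  obtain \<xi> where \<xi>: "\<xi> > 0" "\<xi> < s"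
    "g s - g 0 = s * (pd h f (p + s *\<^sub>R k + \<xi> *\<^sub>R h) - pd h f (p + \<xi> *\<^sub>R h))"
    using MVT2[OF s g] by auto
  have g': "((\<lambda>r. pd h f (p + \<xi> *\<^sub>R h + r *\<^sub>R k)) has_real_derivative
    pd k (pd h f) (p + \<xi> *\<^sub>R h + r *\<^sub>R k)) (at r)" if "0 \<le> r" "r \<le> s" for r
    using that \<xi> sq[of \<xi> r] by (intro DERIV_along_line smooth_on_pd f) simp
  obtain \<eta> where \<eta>: "\<eta> > 0" "\<eta> < s"
    "pd h f (p + \<xi> *\<^sub>R h + s *\<^sub>R k) - pd h f (p + \<xi> *\<^sub>R h + 0 *\<^sub>R k)
      = s * pd k (pd h f) (p + \<xi> *\<^sub>R h + \<eta> *\<^sub>R k)"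
    using MVT2[OF s g'] by auto
  show thesis
  proof (rule that[of \<xi> \<eta>])
    show "\<xi> \<in> {0..s}" "\<eta> \<in> {0..s}" using \<xi> \<eta> by auto
    show "f (p + s *\<^sub>R h + s *\<^sub>R k) - f (p + s *\<^sub>R h) - f (p + s *\<^sub>R k) + f p
      = s * s * pd k (pd h f) (p + \<xi> *\<^sub>R h + \<eta> *\<^sub>R k)"
      using \<xi>(3) \<eta>(3) by (simp add: g_def algebra_simps)
  qed
qed

text \<open>Both mixed derivatives are limits of the same second difference quotient.\<close>

lemma pd_commute:
  assumes f: "smooth_on S f"
  shows "pd h (pd k f) = pd k (pd h f)"
proof
  fix p
  show "pd h (pd k f) p = pd k (pd h f) p"
  proof (cases "p \<in> S")
    case True
    define A where "A = (\<lambda>q. pd k (pd h f) q)"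
    define B where "B = (\<lambda>q. pd h (pd k f) q)"
    have half: "dist (A p) (B p) \<le> e + e" if e: "e > 0" for e
    proof -
      have "isCont A p" "isCont B p"
        unfolding A_def B_def
        using True smooth_on_continuous[OF smooth_on_pd[OF smooth_on_pd[OF f]]]
        by (simp_all add: continuous_on_eq_continuous_at[OF open_S])
      then obtain d1 d2 where d1: "d1 > 0" "\<And>q. dist q p < d1 \<Longrightarrow> dist (A q) (A p) < e"
        and d2: "d2 > 0" "\<And>q. dist q p < d2 \<Longrightarrow> dist (B q) (B p) < e"
        unfolding continuous_at_eps_delta using e by metis
      obtain d3 where d3: "d3 > 0" "ball p d3 \<subseteq> S"
        using open_S True open_contains_ball by blast
      define d where "d = min d1 (min d2 d3)"
      \<comment> \<open>the squares spanned by \<open>s h\<close> and \<open>s k\<close> at \<open>p\<close> then lie within distance \<open>d\<close> of \<open>p\<close>\<close>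
      define s where "s = d / (norm h + norm k + 1)"
      have d: "d > 0" using d1 d2 d3 by (simp add: d_def)
      have nn: "norm h + norm k + 1 > 0"
        using norm_ge_zero[of h] norm_ge_zero[of k] by linarith
      then have s: "s > 0" using d by (simp add: s_def)
      have close: "dist (p + \<xi> *\<^sub>R h' + \<eta> *\<^sub>R k') p < d"
        if "\<xi> \<in> {0..s}" "\<eta> \<in> {0..s}" "norm h' + norm k' = norm h + norm k" for \<xi> \<eta> h' k'
      proof -
        have "dist (p + \<xi> *\<^sub>R h' + \<eta> *\<^sub>R k') p \<le> \<xi> * norm h' + \<eta> * norm k'"
          using that norm_triangle_ineq[of "\<xi> *\<^sub>R h'" "\<eta> *\<^sub>R k'"]
          by (simp add: dist_norm add.assoc)
        also have "\<dots> \<le> s * norm h' + s * norm k'"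
          using that by (intro add_mono mult_right_mono) auto
        also have "\<dots> = s * (norm h + norm k)"
          using that by (metis distrib_left)
        also have "\<dots> < s * (norm h + norm k + 1)"
          using s by simp
        also have "\<dots> = d" using nn by (simp add: s_def)
        finally show ?thesis .
      qed
      have inS: "q \<in> S" if "dist q p < d" for q
        using that d3 by (auto simp: d_def dist_commute)
      obtain \<xi>1 \<eta>1 where 1: "\<xi>1 \<in> {0..s}" "\<eta>1 \<in> {0..s}"
        "f (p + s *\<^sub>R h + s *\<^sub>R k) - f (p + s *\<^sub>R h) - f (p + s *\<^sub>R k) + f p
          = s * s * A (p + \<xi>1 *\<^sub>R h + \<eta>1 *\<^sub>R k)"
        unfolding A_def by (rule second_difference[OF f s, of p h k]) (blast intro: close inS)+
      obtain \<xi>2 \<eta>2 where 2: "\<xi>2 \<in> {0..s}" "\<eta>2 \<in> {0..s}"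
        "f (p + s *\<^sub>R k + s *\<^sub>R h) - f (p + s *\<^sub>R k) - f (p + s *\<^sub>R h) + f p
          = s * s * B (p + \<xi>2 *\<^sub>R k + \<eta>2 *\<^sub>R h)"
        unfolding B_def
        by (rule second_difference[OF f s, of p k h]) (blast intro: close inS add.commute)+
      have "A (p + \<xi>1 *\<^sub>R h + \<eta>1 *\<^sub>R k) = B (p + \<xi>2 *\<^sub>R k + \<eta>2 *\<^sub>R h)"
        using 1(3) 2(3) s by (simp add: add.commute add.left_commute diff_diff_eq)
      moreover have "dist (A (p + \<xi>1 *\<^sub>R h + \<eta>1 *\<^sub>R k)) (A p) < e"
        using close[OF 1(1,2)] by (intro d1) (auto simp: d_def)
      moreover have "dist (B (p + \<xi>2 *\<^sub>R k + \<eta>2 *\<^sub>R h)) (B p) < e"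
        using close[OF 2(1,2)] by (intro d2) (auto simp: d_def)
      ultimately show ?thesis
        by (simp add: dist_real_def)
    qed
    have "dist (A p) (B p) \<le> 0"
      using half[of "dist (A p) (B p) / 4"] by (cases "dist (A p) (B p) > 0") auto
    then show ?thesis by (simp add: A_def B_def)
  qed (simp add: pd_def)
qed

end

section \<open>Total derivatives of functions on jets\<close>

text \<open>Only finitely many partial derivatives may be nonzero at the jet \<open>z\<close>; this makes the sums
  over all multi-indices in the total derivatives finite, so that they are linear in \<open>f\<close>.\<close>

definition jet_differentiable :: "('d jet \<Rightarrow> real) \<Rightarrow> 'd jet \<Rightarrow> bool" where
  "jet_differentiable f z \<longleftrightarrow>
     (\<forall>y. ((\<lambda>s. f (z(y := s))) has_real_derivative jet_pderiv y f z) (at (z y))) \<and>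
     finite {y. jet_pderiv y f z \<noteq> 0}"

lemma jet_differentiableI:
  assumes "\<And>y. ((\<lambda>s. f (z(y := s))) has_real_derivative G y) (at (z y))"
    and "finite {y. G y \<noteq> 0}"
  shows "jet_differentiable f z" and "jet_pderiv y f z = G y"
proof -
  have "jet_pderiv y f z = G y" for y
    unfolding jet_pderiv_def by (rule DERIV_imp_deriv) (rule assms)
  then show "jet_differentiable f z" "jet_pderiv y f z = G y"
    using assms by (simp_all add: jet_differentiable_def)
qed

definition has_total :: "('d jet \<Rightarrow> real) \<Rightarrow> real \<Rightarrow> real \<Rightarrow> 'd jet \<Rightarrow> bool" where
  "has_total f ft fx z \<longleftrightarrow> jet_differentiable f z \<and> total_dt f z = ft \<and> total_dx f z = fx"

lemma finite_support_Der:
  assumes "finite {y. G y \<noteq> (0 :: real)}"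
  shows "finite {p. (case p of (w, i, j) \<Rightarrow> c w i j * G (Der w i j)) \<noteq> 0}"
proof -
  have "finite ((\<lambda>(w, i, j). Der w i j) -` {y. G y \<noteq> 0})"
    using assms by (intro finite_vimageI) (auto simp: inj_def)
  then show ?thesis
    by (rule rev_finite_subset) (auto split: prod.splits)
qed

lemma Sum_any_linear:
  fixes G H :: "'d jet_coord \<Rightarrow> real"
  assumes "finite {y. G y \<noteq> 0}" "finite {y. H y \<noteq> 0}"
  shows "Sum_any (\<lambda>(w, i, j). c w i j * (p * G (Der w i j) + q * H (Der w i j)))
    = p * Sum_any (\<lambda>(w, i, j). c w i j * G (Der w i j)) + q * Sum_any (\<lambda>(w, i, j). c w i j * H (Der w i j))"
proof -
  have *: "finite {a. (case a of (w, i, j) \<Rightarrow> r * (c w i j * K (Der w i j))) \<noteq> 0}"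
    if "finite {y. K y \<noteq> 0}" for K r
    using finite_support_Der[OF that, of "\<lambda>w i j. r * c w i j"] by (simp add: mult.assoc)
  have "(\<lambda>(w, i, j). c w i j * (p * G (Der w i j) + q * H (Der w i j)))
    = (\<lambda>a. (case a of (w, i, j) \<Rightarrow> p * (c w i j * G (Der w i j)))
        + (case a of (w, i, j) \<Rightarrow> q * (c w i j * H (Der w i j))))"
    by (auto simp: algebra_simps)
  then have "Sum_any (\<lambda>(w, i, j). c w i j * (p * G (Der w i j) + q * H (Der w i j)))
    = Sum_any (\<lambda>(w, i, j). p * (c w i j * G (Der w i j)))
      + Sum_any (\<lambda>(w, i, j). q * (c w i j * H (Der w i j)))"
    using Sum_any.distrib[OF *[OF assms(1)] *[OF assms(2)], of p q] by simp
  moreover have "Sum_any (\<lambda>(w, i, j). r * (c w i j * K (Der w i j)))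
    = r * Sum_any (\<lambda>(w, i, j). c w i j * K (Der w i j))" if "finite {y. K y \<noteq> 0}" for K r
    using Sum_any_right_distrib[OF finite_support_Der[OF that, of c], of r]
    by (simp add: case_prod_unfold)
  ultimately show ?thesis using assms by simp
qed

text \<open>The common part of the sum rule and the Leibniz rule: both total derivatives depend linearly on
  the partial derivatives.\<close>

lemma has_total_combine:
  assumes "has_total f ft fx z" "has_total g gt gx z"
    and "\<And>y. ((\<lambda>s. h (z(y := s))) has_real_derivative
              p * jet_pderiv y f z + q * jet_pderiv y g z) (at (z y))"
  shows "has_total h (p * ft + q * gt) (p * fx + q * gx) z"
proof -
  have fin: "finite {y. jet_pderiv y f z \<noteq> 0}" "finite {y. jet_pderiv y g z \<noteq> 0}"
    using assms by (simp_all add: has_total_def jet_differentiable_def)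
  then have "finite {y. p * jet_pderiv y f z + q * jet_pderiv y g z \<noteq> 0}"
    by (intro finite_subset[OF _ finite_UnI[OF fin]]) auto
  note h = jet_differentiableI[OF assms(3) this]
  have "total_dt h z = p * total_dt f z + q * total_dt g z"
    "total_dx h z = p * total_dx f z + q * total_dx g z"
    unfolding total_dt_def total_dx_def h(2) Sum_any_linear[OF fin] by (simp_all add: algebra_simps)
  then show ?thesis
    using assms(1,2) h(1) by (simp add: has_total_def)
qed

lemma has_total_add:
  assumes "has_total f ft fx z" "has_total g gt gx z"
  shows "has_total (\<lambda>z. f z + g z) (ft + gt) (fx + gx) z"
proof -
  have "((\<lambda>s. f (z(y := s)) + g (z(y := s))) has_real_derivative
      1 * jet_pderiv y f z + 1 * jet_pderiv y g z) (at (z y))" for y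
    using assms by (auto intro!: derivative_eq_intros simp: has_total_def jet_differentiable_def)
  from has_total_combine[OF assms this] show ?thesis by simp
qed

lemma has_total_mult:
  assumes "has_total f ft fx z" "has_total g gt gx z"
  shows "has_total (\<lambda>z. f z * g z) (ft * g z + f z * gt) (fx * g z + f z * gx) z"
proof -
  have "((\<lambda>s. f (z(y := s)) * g (z(y := s))) has_real_derivative
      g z * jet_pderiv y f z + f z * jet_pderiv y g z) (at (z y))" for y
  proof -
    have "((\<lambda>s. f (z(y := s))) has_real_derivative jet_pderiv y f z) (at (z y))"
      "((\<lambda>s. g (z(y := s))) has_real_derivative jet_pderiv y g z) (at (z y))"
      using assms by (simp_all add: has_total_def jet_differentiable_def)
    from DERIV_mult[OF this] show ?thesis by (simp add: mult.commute)
  qed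
  from has_total_combine[OF assms this] show ?thesis by (simp add: mult.commute)
qed

lemma has_total_coord:
  "has_total (\<lambda>z. z (Der w i j)) (z (Der w (Suc i) j)) (z (Der w i (Suc j))) (z :: 'd jet)"
proof -
  have "((\<lambda>s. (z(y := s)) (Der w i j)) has_real_derivative (if y = Der w i j then 1 else 0)) (at (z y))"
    for y by (auto intro!: derivative_eq_intros)
  from jet_differentiableI(1)[OF this] show ?thesis
    using total_dt_lin[of 1 w i j] total_dx_lin[of 1 w i j] by (simp add: has_total_def)
qed

locale base_region = open_domain S for S :: "base set"
begin

abbreviation "dT \<equiv> pd (1, 0, 0, 0)"
abbreviation "dX \<equiv> pd (0, 1, 0, 0)"
abbreviation "dU \<equiv> pd (0, 0, 1, 0)"
abbreviation "dV \<equiv> pd (0, 0, 0, 1)"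

lemma pd_decompose:
  assumes "smooth_on S f" "p \<in> S"
  shows "pd (h1, h2, h3, h4) f p = h1 * dT f p + h2 * dX f p + h3 * dU f p + h4 * dV f p"
proof -
  have lin: "linear (\<lambda>h. pd h f p)"
    using smooth_on_has_derivative[OF assms] by (rule has_derivative_linear)
  have "pd (h1, h2, h3, h4) f p = pd (h1 *\<^sub>R (1, 0, 0, 0) + h2 *\<^sub>R (0, 1, 0, 0)
      + h3 *\<^sub>R (0, 0, 1, 0) + h4 *\<^sub>R (0, 0, 0, 1)) f p"
    by simp
  also have "\<dots> = h1 *\<^sub>R dT f p + h2 *\<^sub>R dX f p + h3 *\<^sub>R dU f p + h4 *\<^sub>R dV f p"
    by (simp only: linear_add[OF lin] linear_cmul[OF lin])
  finally show ?thesis by simp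
qed

lemma DERIV_T: "smooth_on S f \<Longrightarrow> (t, x, u, v) \<in> S \<Longrightarrow>
    ((\<lambda>s. f (s, x, u, v)) has_real_derivative dT f (t, x, u, v)) (at t)"
  and DERIV_X: "smooth_on S f \<Longrightarrow> (t, x, u, v) \<in> S \<Longrightarrow>
    ((\<lambda>s. f (t, s, u, v)) has_real_derivative dX f (t, x, u, v)) (at x)"
  and DERIV_U: "smooth_on S f \<Longrightarrow> (t, x, u, v) \<in> S \<Longrightarrow>
    ((\<lambda>s. f (t, x, s, v)) has_real_derivative dU f (t, x, u, v)) (at u)"
  and DERIV_V: "smooth_on S f \<Longrightarrow> (t, x, u, v) \<in> S \<Longrightarrow>
    ((\<lambda>s. f (t, x, u, s)) has_real_derivative dV f (t, x, u, v)) (at v)"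
  using DERIV_along_line[of f "(0, x, u, v)" t "(1, 0, 0, 0)"]
    DERIV_along_line[of f "(t, 0, u, v)" x "(0, 1, 0, 0)"]
    DERIV_along_line[of f "(t, x, 0, v)" u "(0, 0, 1, 0)"]
    DERIV_along_line[of f "(t, x, u, 0)" v "(0, 0, 0, 1)"]
  by simp_all

lemma eventually_line: "p + s *\<^sub>R h \<in> S \<Longrightarrow> \<forall>\<^sub>F r in nhds s. p + r *\<^sub>R h \<in> S"
proof -
  assume *: "p + s *\<^sub>R h \<in> S"
  have "((\<lambda>r. p + r *\<^sub>R h) \<longlongrightarrow> p + s *\<^sub>R h) (nhds s)"
    by (intro tendsto_intros) (auto simp: filterlim_ident)
  from topological_tendstoD[OF this open_S *] show ?thesis .
qed

lemma eventually_T: "(t, x, u, v) \<in> S \<Longrightarrow> \<forall>\<^sub>F s in nhds t. (s, x, u, v) \<in> S"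
  and eventually_X: "(t, x, u, v) \<in> S \<Longrightarrow> \<forall>\<^sub>F s in nhds x. (t, s, u, v) \<in> S"
  and eventually_U: "(t, x, u, v) \<in> S \<Longrightarrow> \<forall>\<^sub>F s in nhds u. (t, x, s, v) \<in> S"
  and eventually_V: "(t, x, u, v) \<in> S \<Longrightarrow> \<forall>\<^sub>F s in nhds v. (t, x, u, s) \<in> S"
  using eventually_line[of "(0, x, u, v)" t "(1, 0, 0, 0)"]
    eventually_line[of "(t, 0, u, v)" x "(0, 1, 0, 0)"]
    eventually_line[of "(t, x, 0, v)" u "(0, 0, 1, 0)"]
    eventually_line[of "(t, x, u, 0)" v "(0, 0, 0, 1)"]
  by simp_all

lemma eventually_base_pt:
  assumes "base_pt z \<in> S"
  shows "\<forall>\<^sub>F s in nhds (z y). base_pt (z(y := s)) \<in> S"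
proof -
  consider "y = Time" | "y = Space" | "y = Der U 0 0" | "y = Der V 0 0"
    | "y \<noteq> Time" "y \<noteq> Space" "y \<noteq> Der U 0 0" "y \<noteq> Der V 0 0"
    by blast
  then show ?thesis
  proof cases
    case 5
    then have "base_pt (z(y := s)) = base_pt z" for s by (simp add: base_pt_def)
    then show ?thesis using assms by simp
  qed (use assms in \<open>simp_all add: base_pt_def eventually_T eventually_X eventually_U eventually_V\<close>)
qed

text \<open>Changing one jet coordinate slightly does not leave the region, hence total derivatives are
  local. This allows iterating them on functions whose first total derivative is known over \<open>S\<close>
  only.\<close>

lemma total_cong:
  assumes "\<And>z. base_pt z \<in> S \<Longrightarrow> f z = g z" "base_pt z \<in> S"
  shows "total_dt f z = total_dt g z" "total_dx f z = total_dx g z"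
proof -
  have "jet_pderiv y f z = jet_pderiv y g z" for y
    unfolding jet_pderiv_def
    by (rule deriv_cong_ev[OF eventually_mono[OF eventually_base_pt[OF assms(2)]]])
      (simp_all add: assms(1))
  then show "total_dt f z = total_dt g z" "total_dx f z = total_dx g z"
    by (simp_all add: total_dt_def total_dx_def)
qed

text \<open>\<open>Dt f\<close>, \<open>Dx f\<close>, \<open>Dxx f\<close>, \<open>Dtx f\<close>, \<open>Dxxx f\<close> and \<open>Dtxx f\<close> are the total derivatives of
  \<open>f(t,x,u,v)\<close> written out, each by one more application of the Leibniz rule to the previous one. They are
  kept nested: \<open>Dx (dU f)\<close> stands for three terms, and most arguments below only need the coefficient of
  one jet coordinate.\<close>

definition Dt :: "(base \<Rightarrow> real) \<Rightarrow> dep jet \<Rightarrow> real" where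
  "Dt f z = dT f (base_pt z) + z (Der U 1 0) * dU f (base_pt z) + z (Der V 1 0) * dV f (base_pt z)"

definition Dx :: "(base \<Rightarrow> real) \<Rightarrow> dep jet \<Rightarrow> real" where
  "Dx f z = dX f (base_pt z) + z (Der U 0 1) * dU f (base_pt z) + z (Der V 0 1) * dV f (base_pt z)"

lemma has_total_base:
  assumes f: "smooth_on S f" and z: "base_pt z \<in> S"
  shows "has_total (\<lambda>y. f (base_pt y)) (Dt f z) (Dx f z) z"
proof -
  define G where "G y = (if y = Time then dT f (base_pt z) else if y = Space then dX f (base_pt z)
    else if y = Der U 0 0 then dU f (base_pt z) else if y = Der V 0 0 then dV f (base_pt z) else 0)" for y
  have D: "((\<lambda>s. f (base_pt (z(y := s)))) has_real_derivative G y) (at (z y))" for y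
    using z DERIV_T[OF f] DERIV_X[OF f] DERIV_U[OF f] DERIV_V[OF f]
    unfolding G_def base_pt_def by auto
  have "{y. G y \<noteq> 0} \<subseteq> {Time, Space, Der U 0 0, Der V 0 0}"
    by (auto simp: G_def split: if_splits)
  then have fin: "finite {y. G y \<noteq> 0}" by (rule finite_subset) simp
  have S2: "Sum_any (\<lambda>(w, i, j). c w i j * G (Der w i j))
    = c U 0 0 * dU f (base_pt z) + c V 0 0 * dV f (base_pt z)" for c
  proof -
    have "(\<lambda>(w, i, j). c w i j * G (Der w i j)) = (\<lambda>(w, i, j). c w i j *
      ((if Der w i j = Der U 0 0 then dU f (base_pt z) else 0)
        + (if Der w i j = Der V 0 0 then dV f (base_pt z) else 0)))"
      by (auto simp: G_def fun_eq_iff)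
    then show ?thesis by (simp only: Sum_any_two)
  qed
  show ?thesis
    using jet_differentiableI[OF D fin] S2[of "\<lambda>w i j. z (Der w (Suc i) j)"]
      S2[of "\<lambda>w i j. z (Der w i (Suc j))"]
    by (simp add: has_total_def total_dt_def total_dx_def Dt_def Dx_def G_def)
qed

definition Dxx :: "(base \<Rightarrow> real) \<Rightarrow> dep jet \<Rightarrow> real" where
  "Dxx f z = Dx (dX f) z + (z (Der U 0 2) * dU f (base_pt z) + z (Der U 0 1) * Dx (dU f) z)
     + (z (Der V 0 2) * dV f (base_pt z) + z (Der V 0 1) * Dx (dV f) z)"

definition Dtx :: "(base \<Rightarrow> real) \<Rightarrow> dep jet \<Rightarrow> real" where
  "Dtx f z = Dt (dX f) z + (z (Der U 1 1) * dU f (base_pt z) + z (Der U 0 1) * Dt (dU f) z)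
     + (z (Der V 1 1) * dV f (base_pt z) + z (Der V 0 1) * Dt (dV f) z)"

lemma has_total_Dx:
  assumes f: "smooth_on S f" and z: "base_pt z \<in> S"
  shows "has_total (Dx f) (Dtx f z) (Dxx f z) z"
  unfolding Dx_def[abs_def] Dxx_def Dtx_def
  using has_total_add[OF has_total_add[OF has_total_base[OF smooth_on_pd[OF f] z]
        has_total_mult[OF has_total_coord[of U 0 1] has_total_base[OF smooth_on_pd[OF f] z]]]
        has_total_mult[OF has_total_coord[of V 0 1] has_total_base[OF smooth_on_pd[OF f] z]],
        of "(0,1,0,0)" "(0,0,1,0)" "(0,0,0,1)"]
  by (simp add: numeral_2_eq_2 Dx_def)

definition Dxxx :: "(base \<Rightarrow> real) \<Rightarrow> dep jet \<Rightarrow> real" where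
  "Dxxx f z = Dxx (dX f) z
     + (z (Der U 0 3) * dU f (base_pt z) + 2 * z (Der U 0 2) * Dx (dU f) z + z (Der U 0 1) * Dxx (dU f) z)
     + (z (Der V 0 3) * dV f (base_pt z) + 2 * z (Der V 0 2) * Dx (dV f) z + z (Der V 0 1) * Dxx (dV f) z)"

definition Dtxx :: "(base \<Rightarrow> real) \<Rightarrow> dep jet \<Rightarrow> real" where
  "Dtxx f z = Dtx (dX f) z
     + (z (Der U 1 2) * dU f (base_pt z) + z (Der U 0 2) * Dt (dU f) z
        + z (Der U 1 1) * Dx (dU f) z + z (Der U 0 1) * Dtx (dU f) z)
     + (z (Der V 1 2) * dV f (base_pt z) + z (Der V 0 2) * Dt (dV f) z
        + z (Der V 1 1) * Dx (dV f) z + z (Der V 0 1) * Dtx (dV f) z)"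

lemma has_total_Dxx:
  assumes f: "smooth_on S f" and z: "base_pt z \<in> S"
  shows "has_total (Dxx f) (Dtxx f z) (Dxxx f z) z"
proof -
  have s: "smooth_on S (pd h f)" for h by (rule smooth_on_pd[OF f])
  have t: "has_total (\<lambda>z. z (Der w 0 2) * pd h f (base_pt z) + z (Der w 0 1) * Dx (pd h f) z)
     (z (Der w 1 2) * pd h f (base_pt z) + z (Der w 0 2) * Dt (pd h f) z
        + z (Der w 1 1) * Dx (pd h f) z + z (Der w 0 1) * Dtx (pd h f) z)
     (z (Der w 0 3) * pd h f (base_pt z) + 2 * z (Der w 0 2) * Dx (pd h f) z
        + z (Der w 0 1) * Dxx (pd h f) z) z" for w h
    using has_total_add[OF has_total_mult[OF has_total_coord[of w 0 2] has_total_base[OF s z]]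
        has_total_mult[OF has_total_coord[of w 0 1] has_total_Dx[OF s z]], of h h]
    by (simp add: eval_nat_numeral algebra_simps)
  have "Dxx f = (\<lambda>z. Dx (dX f) z + (z (Der U 0 2) * dU f (base_pt z) + z (Der U 0 1) * Dx (dU f) z)
     + (z (Der V 0 2) * dV f (base_pt z) + z (Der V 0 1) * Dx (dV f) z))"
    by (simp add: fun_eq_iff Dxx_def)
  then show ?thesis
    unfolding Dxxx_def Dtxx_def by (simp only:) (intro has_total_add has_total_Dx s z t)
qed

lemma total_derivs:
  assumes f: "smooth_on S f" and z: "base_pt z \<in> S"
  shows "total_deriv 0 0 (\<lambda>y. f (base_pt y)) z = f (base_pt z)"
    and "total_deriv 1 0 (\<lambda>y. f (base_pt y)) z = Dt f z"
    and "total_deriv 0 1 (\<lambda>y. f (base_pt y)) z = Dx f z"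
    and "total_deriv 0 3 (\<lambda>y. f (base_pt y)) z = Dxxx f z"
    and "total_deriv 1 2 (\<lambda>y. f (base_pt y)) z = Dtxx f z"
proof -
  have 1: "total_dt (\<lambda>y. f (base_pt y)) z = Dt f z" "total_dx (\<lambda>y. f (base_pt y)) z = Dx f z"
    if "base_pt z \<in> S" for z
    using has_total_base[OF f that] by (simp_all add: has_total_def)
  have 2: "total_dx (total_dx (\<lambda>y. f (base_pt y))) z = Dxx f z" if "base_pt z \<in> S" for z
    using total_cong(2)[of "total_dx (\<lambda>y. f (base_pt y))" "Dx f" z] 1 has_total_Dx[OF f that] that
    by (simp add: has_total_def)
  have 3: "total_dx (total_dx (total_dx (\<lambda>y. f (base_pt y)))) z = Dxxx f z"
    "total_dt (total_dx (total_dx (\<lambda>y. f (base_pt y)))) z = Dtxx f z"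
    using total_cong[of "total_dx (total_dx (\<lambda>y. f (base_pt y)))" "Dxx f" z] 2 has_total_Dxx[OF f z] z
    by (simp_all add: has_total_def)
  show "total_deriv 0 0 (\<lambda>y. f (base_pt y)) z = f (base_pt z)"
    "total_deriv 1 0 (\<lambda>y. f (base_pt y)) z = Dt f z"
    "total_deriv 0 1 (\<lambda>y. f (base_pt y)) z = Dx f z"
    "total_deriv 0 3 (\<lambda>y. f (base_pt y)) z = Dxxx f z"
    "total_deriv 1 2 (\<lambda>y. f (base_pt y)) z = Dtxx f z"
    using 1[OF z] 3 by (simp_all add: total_deriv_def eval_nat_numeral)
qed

section \<open>Functions that are affine in the dependent variables\<close>

text \<open>Oriented so that rewriting moves \<open>\<partial>\<^sub>u\<close> and \<open>\<partial>\<^sub>v\<close> inside and \<open>\<partial>\<^sub>t\<close> outside.\<close>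

lemma pd_normal_order:
  assumes "smooth_on S f"
  shows "dX (dT f) = dT (dX f)" "dU (dT f) = dT (dU f)" "dV (dT f) = dT (dV f)"
    "dU (dX f) = dX (dU f)" "dV (dX f) = dX (dV f)" "dV (dU f) = dU (dV f)"
  by (rule pd_commute[OF assms])+

text \<open>Since \<open>x\<close>-derivatives of the coefficients are excluded too, on a convex region this means
  \<open>f = A(t,x) + B(t) u + C(t) v\<close>.\<close>

definition affine_in_uv :: "(base \<Rightarrow> real) \<Rightarrow> bool" where
  "affine_in_uv f \<longleftrightarrow> dX (dU f) = (\<lambda>_. 0) \<and> dU (dU f) = (\<lambda>_. 0) \<and> dU (dV f) = (\<lambda>_. 0)
     \<and> dX (dV f) = (\<lambda>_. 0) \<and> dV (dV f) = (\<lambda>_. 0)"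

text \<open>The left-hand sides are \<open>Dx (dU f)\<close> and \<open>Dx (dV f)\<close> at the first-order jet \<open>u\<^sub>x = r\<close>, \<open>v\<^sub>x = s\<close>;
  up to numerical factors they are the coefficients of \<open>u\<^sub>t\<^sub>x\<close>, \<open>v\<^sub>t\<^sub>x\<close> in \<open>Dtxx f\<close> and of \<open>u\<^sub>x\<^sub>x\<close>, \<open>v\<^sub>x\<^sub>x\<close> in
  \<open>Dxxx f\<close>.\<close>

lemma affine_in_uv_iff:
  assumes "smooth_on S f"
  shows "affine_in_uv f \<longleftrightarrow> (\<forall>t x u v r s. (t, x, u, v) \<in> S \<longrightarrow>
    dX (dU f) (t,x,u,v) + r * dU (dU f) (t,x,u,v) + s * dV (dU f) (t,x,u,v) = 0 \<and>
    dX (dV f) (t,x,u,v) + r * dU (dV f) (t,x,u,v) + s * dV (dV f) (t,x,u,v) = 0)" (is "_ \<longleftrightarrow> ?R")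
proof
  assume ?R
  then have R: "dX (dU f) p + r * dU (dU f) p + s * dU (dV f) p = 0 \<and>
    dX (dV f) p + r * dU (dV f) p + s * dV (dV f) p = 0" if "p \<in> S" for p r s
    using that pd_normal_order(6)[OF assms] by (cases p) auto
  have "dX (dU f) p = 0 \<and> dU (dU f) p = 0 \<and> dU (dV f) p = 0 \<and> dX (dV f) p = 0 \<and> dV (dV f) p = 0"
    for p
  proof (cases "p \<in> S")
    case True
    show ?thesis using R[OF True, of 0 0] R[OF True, of 1 0] R[OF True, of 0 1] by simp
  qed (simp add: pd_def)
  then show "affine_in_uv f" by (simp add: affine_in_uv_def fun_eq_iff)
qed (simp add: affine_in_uv_def pd_normal_order(6)[OF assms])

lemma affine_in_uv_jets:
  assumes f: "smooth_on S f" and a: "affine_in_uv f"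
  shows "Dxxx f z = dX (dX (dX f)) (base_pt z) + z (Der U 0 3) * dU f (base_pt z)
      + z (Der V 0 3) * dV f (base_pt z)"
    and "Dtxx f z = dT (dX (dX f)) (base_pt z)
      + z (Der U 1 2) * dU f (base_pt z) + z (Der U 0 2) * dT (dU f) (base_pt z)
      + z (Der V 1 2) * dV f (base_pt z) + z (Der V 0 2) * dT (dV f) (base_pt z)"
  using a by (simp_all add: affine_in_uv_def Dt_def Dx_def Dxx_def Dxxx_def Dtx_def Dtxx_def
      pd_normal_order f smooth_on_pd)

text \<open>Raising one jet coordinate by \<open>1\<close> reads off its coefficient, because \<open>Dtxx f\<close> is affine in
  \<open>u\<^sub>t\<^sub>x\<close>, \<open>v\<^sub>t\<^sub>x\<close> and \<open>Dxxx f\<close> is affine in \<open>u\<^sub>x\<^sub>x\<close>, \<open>v\<^sub>x\<^sub>x\<close>.\<close>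

lemma Dtxx_shift:
  assumes "smooth_on S f"
  shows "Dtxx f (z(Der U 1 1 := z (Der U 1 1) + 1)) = Dtxx f z + 2 * Dx (dU f) z"
    "Dtxx f (z(Der V 1 1 := z (Der V 1 1) + 1)) = Dtxx f z + 2 * Dx (dV f) z"
  by (simp_all add: Dt_def Dx_def Dtx_def Dtxx_def base_pt_def pd_normal_order assms distrib_left distrib_right)

lemma Dxxx_shift:
  assumes "smooth_on S f"
  shows "Dxxx f (z(Der U 0 2 := z (Der U 0 2) + 1)) = Dxxx f z + 3 * Dx (dU f) z"
    "Dxxx f (z(Der V 0 2 := z (Der V 0 2) + 1)) = Dxxx f z + 3 * Dx (dV f) z"
  by (simp_all add: Dx_def Dxx_def Dxxx_def base_pt_def pd_normal_order assms distrib_left distrib_right)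

lemma Dx_Dt_unshifted:
  assumes "y \<in> {Der w 1 1, Der w 0 2}"
  shows "base_pt (z(y := r)) = base_pt z" "Dx f (z(y := r)) = Dx f z" "Dt f (z(y := r)) = Dt f z"
  using assms by (auto simp: base_pt_def Dx_def Dt_def)

lemma Dxxx_unshifted:
  shows "Dxx f (z(Der w 1 1 := r)) = Dxx f z" "Dxxx f (z(Der w 1 1 := r)) = Dxxx f z"
  by (auto simp: base_pt_def Dx_def Dxx_def Dxxx_def)

end

section \<open>The adjoint system on solution jets\<close>

locale dispersive_system =
  fixes a b c \<epsilon> \<kappa> lam \<sigma> :: real
  assumes ab_c: "(a + b) * c \<noteq> 0"
begin

abbreviation "R \<equiv> region a c"
abbreviation "F1 \<equiv> sys_F1 a b c \<epsilon> \<kappa>"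
abbreviation "F2 \<equiv> sys_F2 a b c lam \<sigma>"

lemma open_region: "open R"
proof (cases "a = 0")
  case False
  then have "R = {p. 0 < a * fst (snd (snd p)) + c}"
    by (auto simp: region_def)
  then show ?thesis
    by (simp add: open_Collect_less continuous_intros)
qed (simp add: region_def case_prod_unfold)

end

sublocale dispersive_system \<subseteq> base_region "region a c"
  by unfold_locales (rule open_region)

context dispersive_system begin

text \<open>The adjoint expressions \<open>F\<^sub>1\<^sup>*\<close> and \<open>F\<^sub>2\<^sup>*\<close> after the substitution.\<close>

definition adj1 :: "(base \<Rightarrow> real) \<Rightarrow> (base \<Rightarrow> real) \<Rightarrow> dep jet \<Rightarrow> real" where
  "adj1 \<phi> \<psi> z = Dt \<phi> z + (a + b) * z (Der V 0 0) * Dx \<phi> z + (b * z (Der U 0 0) + c) * Dx \<psi> z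
     + b * \<phi> (base_pt z) * z (Der V 0 1) + \<epsilon> * Dtxx \<phi> z + lam * Dxxx \<psi> z"

definition adj2 :: "(base \<Rightarrow> real) \<Rightarrow> (base \<Rightarrow> real) \<Rightarrow> dep jet \<Rightarrow> real" where
  "adj2 \<phi> \<psi> z = Dt \<psi> z + (a * z (Der U 0 0) + c) * Dx \<phi> z + (a + b) * z (Der V 0 0) * Dx \<psi> z
     - b * \<phi> (base_pt z) * z (Der U 0 1) + \<kappa> * Dxxx \<phi> z + \<sigma> * Dtxx \<psi> z"

lemma adjoint_expr_subst_jet:
  assumes "smooth_on R \<phi>" "smooth_on R \<psi>" "base_pt z \<in> R"
  shows "adjoint_expr F1 F2 U (subst_jet \<phi> \<psi> z) = adj1 \<phi> \<psi> z"
    and "adjoint_expr F1 F2 V (subst_jet \<phi> \<psi> z) = adj2 \<phi> \<psi> z"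
  using assms by (simp_all add: adjoint_expr_sys_U adjoint_expr_sys_V adj1_def adj2_def
      total_derivs[unfolded One_nat_def])

text \<open>With coefficients free of any regularity requirement, membership in the ideal generated by \<open>f\<close> and
  \<open>g\<close> only means vanishing on their common zeros: elsewhere one may divide by whichever of the two is
  nonzero.\<close>

lemma in_ideal_iff:
  fixes A f g :: "'z \<Rightarrow> real"
  shows "(\<exists>M N. \<forall>z\<in>Z. A z = M z * f z + N z * g z) \<longleftrightarrow> (\<forall>z\<in>Z. f z = 0 \<longrightarrow> g z = 0 \<longrightarrow> A z = 0)"
proof
  assume *: "\<forall>z\<in>Z. f z = 0 \<longrightarrow> g z = 0 \<longrightarrow> A z = 0"
  have "A z = (if f z = 0 then 0 else A z / f z) * f z + (if f z = 0 then A z / g z else 0) * g z"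
    if "z \<in> Z" for z
    using * that by auto
  then show "\<exists>M N. \<forall>z\<in>Z. A z = M z * f z + N z * g z" by (intro exI ballI)
qed auto

lemma self_adjoint_subst_iff_adj:
  "self_adjoint_subst R F1 F2 \<phi> \<psi> \<longleftrightarrow> smooth_on R \<phi> \<and> smooth_on R \<psi> \<and>
     (\<exists>p\<in>R. \<phi> p \<noteq> 0 \<or> \<psi> p \<noteq> 0) \<and>
     (\<forall>z. base_pt z \<in> R \<longrightarrow> F1 z = 0 \<longrightarrow> F2 z = 0 \<longrightarrow> adj1 \<phi> \<psi> z = 0 \<and> adj2 \<phi> \<psi> z = 0)"
proof (cases "smooth_on R \<phi> \<and> smooth_on R \<psi>")
  case True
  let ?Z = "{z. base_pt z \<in> R}"
  have "(\<exists>M N P Q. \<forall>z. base_pt z \<in> R \<longrightarrow>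
        adjoint_expr F1 F2 U (subst_jet \<phi> \<psi> z) = M z * F1 z + N z * F2 z \<and>
        adjoint_expr F1 F2 V (subst_jet \<phi> \<psi> z) = P z * F1 z + Q z * F2 z)
    \<longleftrightarrow> (\<exists>M N P Q. \<forall>z\<in>?Z. adj1 \<phi> \<psi> z = M z * F1 z + N z * F2 z \<and>
          adj2 \<phi> \<psi> z = P z * F1 z + Q z * F2 z)"
    using True by (simp add: adjoint_expr_subst_jet)
  also have "\<dots> \<longleftrightarrow> (\<exists>M N. \<forall>z\<in>?Z. adj1 \<phi> \<psi> z = M z * F1 z + N z * F2 z) \<and>
        (\<exists>P Q. \<forall>z\<in>?Z. adj2 \<phi> \<psi> z = P z * F1 z + Q z * F2 z)"
    unfolding ball_conj_distrib by simp
  finally show ?thesis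
    using True unfolding self_adjoint_subst_def in_ideal_iff by auto
qed (auto simp: self_adjoint_subst_def)

text \<open>The jet over a base point with prescribed higher coordinates \<open>K\<close>, the coordinates
  \<open>u\<^sub>t\<close> and \<open>v\<^sub>t\<close> being solved for from the system.\<close>

definition solved_jet :: "real \<Rightarrow> real \<Rightarrow> real \<Rightarrow> real \<Rightarrow> dep jet \<Rightarrow> dep jet" where
  "solved_jet t x u v K = K(Time := t, Space := x, Der U 0 0 := u, Der V 0 0 := v,
     Der U 1 0 := - ((a + b) * v * K (Der U 0 1) + (a * u + c) * K (Der V 0 1)
        + \<epsilon> * K (Der U 1 2) + \<kappa> * K (Der V 0 3)),
     Der V 1 0 := - ((b * u + c) * K (Der U 0 1) + (a + b) * v * K (Der V 0 1)
        + lam * K (Der U 0 3) + \<sigma> * K (Der V 1 2)))"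

lemma solved_jet:
  "base_pt (solved_jet t x u v K) = (t, x, u, v)" "F1 (solved_jet t x u v K) = 0"
  "F2 (solved_jet t x u v K) = 0"
  by (simp_all add: solved_jet_def base_pt_def sys_F1_def sys_F2_def)

lemma solved_jet_coords:
  "solved_jet t x u v K (Der U 0 0) = u" "solved_jet t x u v K (Der V 0 0) = v"
  "solved_jet t x u v K (Der U 1 0) = - ((a + b) * v * K (Der U 0 1) + (a * u + c) * K (Der V 0 1)
        + \<epsilon> * K (Der U 1 2) + \<kappa> * K (Der V 0 3))"
  "solved_jet t x u v K (Der V 1 0) = - ((b * u + c) * K (Der U 0 1) + (a + b) * v * K (Der V 0 1)
        + lam * K (Der U 0 3) + \<sigma> * K (Der V 1 2))"
  "(i, j) \<noteq> (0, 0) \<Longrightarrow> (i, j) \<noteq> (1, 0) \<Longrightarrow> solved_jet t x u v K (Der w i j) = K (Der w i j)"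
  by (auto simp: solved_jet_def)

end

section \<open>Determining equations\<close>

locale adjoint_pair = dispersive_system a b c \<epsilon> \<kappa> lam \<sigma> for a b c \<epsilon> \<kappa> lam \<sigma> +
  fixes \<phi> \<psi> :: "base \<Rightarrow> real"
  assumes \<phi>: "smooth_on R \<phi>" and \<psi>: "smooth_on R \<psi>"
    and adj: "\<And>z. base_pt z \<in> R \<Longrightarrow> F1 z = 0 \<Longrightarrow> F2 z = 0 \<Longrightarrow> adj1 \<phi> \<psi> z = 0 \<and> adj2 \<phi> \<psi> z = 0"
    and dispersive: "(\<epsilon>, \<kappa>, lam, \<sigma>) \<noteq> (0, 0, 0, 0)"
begin

lemma adj_solved_jet:
  assumes "(t, x, u, v) \<in> R"
  shows "adj1 \<phi> \<psi> (solved_jet t x u v K) = 0" "adj2 \<phi> \<psi> (solved_jet t x u v K) = 0"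
  using adj[of "solved_jet t x u v K"] assms by (simp_all add: solved_jet)

text \<open>The coordinates \<open>u\<^sub>t\<^sub>x\<close>, \<open>v\<^sub>t\<^sub>x\<close>, \<open>u\<^sub>x\<^sub>x\<close>, \<open>v\<^sub>x\<^sub>x\<close> do not occur in the system, so they can be varied on
  solution jets. The first two occur in the adjoint system only through \<open>\<epsilon> D\<^sub>tD\<^sub>x\<^sup>2\<phi>\<close> and \<open>\<sigma> D\<^sub>tD\<^sub>x\<^sup>2\<psi>\<close>; the
  last two, in the absence of the latter terms, only through \<open>\<lambda> D\<^sub>x\<^sup>3\<psi>\<close> and \<open>\<kappa> D\<^sub>x\<^sup>3\<phi>\<close>. Their
  coefficients are the expressions that characterise functions affine in \<open>u\<close>, \<open>v\<close>.\<close>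

lemma affine_cases:
  shows "\<epsilon> \<noteq> 0 \<or> \<sigma> = 0 \<and> \<kappa> \<noteq> 0 \<Longrightarrow> affine_in_uv \<phi>"
    and "\<sigma> \<noteq> 0 \<or> \<epsilon> = 0 \<and> lam \<noteq> 0 \<Longrightarrow> affine_in_uv \<psi>"
proof -
  have *: "\<epsilon> * Dx (dU \<phi>) z = 0 \<and> \<epsilon> * Dx (dV \<phi>) z = 0 \<and> \<sigma> * Dx (dU \<psi>) z = 0 \<and> \<sigma> * Dx (dV \<psi>) z = 0 \<and>
     (\<sigma> = 0 \<longrightarrow> \<kappa> * Dx (dU \<phi>) z = 0 \<and> \<kappa> * Dx (dV \<phi>) z = 0) \<and>
     (\<epsilon> = 0 \<longrightarrow> lam * Dx (dU \<psi>) z = 0 \<and> lam * Dx (dV \<psi>) z = 0)"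
    if z: "base_pt z \<in> R" "F1 z = 0" "F2 z = 0" for z
  proof -
    have sh: "adj1 \<phi> \<psi> (z(y := z y + 1)) = 0" "adj2 \<phi> \<psi> (z(y := z y + 1)) = 0"
      if "y \<in> {Der U 1 1, Der U 0 2, Der V 1 1, Der V 0 2}" for y
      using adj[of "z(y := z y + 1)"] z that by (auto simp: base_pt_def sys_F1_def sys_F2_def)
    have 0: "adj1 \<phi> \<psi> z = 0" "adj2 \<phi> \<psi> z = 0" using adj z by auto
    have "adj1 \<phi> \<psi> (z(Der U 1 1 := z (Der U 1 1) + 1)) = adj1 \<phi> \<psi> z + 2 * (\<epsilon> * Dx (dU \<phi>) z)"
      "adj1 \<phi> \<psi> (z(Der V 1 1 := z (Der V 1 1) + 1)) = adj1 \<phi> \<psi> z + 2 * (\<epsilon> * Dx (dV \<phi>) z)"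
      "adj2 \<phi> \<psi> (z(Der U 1 1 := z (Der U 1 1) + 1)) = adj2 \<phi> \<psi> z + 2 * (\<sigma> * Dx (dU \<psi>) z)"
      "adj2 \<phi> \<psi> (z(Der V 1 1 := z (Der V 1 1) + 1)) = adj2 \<phi> \<psi> z + 2 * (\<sigma> * Dx (dV \<psi>) z)"
      "\<epsilon> = 0 \<Longrightarrow>
        adj1 \<phi> \<psi> (z(Der U 0 2 := z (Der U 0 2) + 1)) = adj1 \<phi> \<psi> z + 3 * (lam * Dx (dU \<psi>) z)"
      "\<epsilon> = 0 \<Longrightarrow>
        adj1 \<phi> \<psi> (z(Der V 0 2 := z (Der V 0 2) + 1)) = adj1 \<phi> \<psi> z + 3 * (lam * Dx (dV \<psi>) z)"
      "\<sigma> = 0 \<Longrightarrow>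
        adj2 \<phi> \<psi> (z(Der U 0 2 := z (Der U 0 2) + 1)) = adj2 \<phi> \<psi> z + 3 * (\<kappa> * Dx (dU \<phi>) z)"
      "\<sigma> = 0 \<Longrightarrow>
        adj2 \<phi> \<psi> (z(Der V 0 2 := z (Der V 0 2) + 1)) = adj2 \<phi> \<psi> z + 3 * (\<kappa> * Dx (dV \<phi>) z)"
      unfolding adj1_def adj2_def
      by (simp_all add: Dx_Dt_unshifted Dxxx_unshifted
          Dtxx_shift Dxxx_shift \<phi> \<psi> distrib_left del: One_nat_def)
    then show ?thesis
      using 0 sh[of "Der U 1 1"] sh[of "Der V 1 1"] sh[of "Der U 0 2"] sh[of "Der V 0 2"] by auto
  qed
  have "\<epsilon> \<noteq> 0 \<or> \<sigma> = 0 \<and> \<kappa> \<noteq> 0 \<Longrightarrow> Dx (dU \<phi>) (solved_jet t x u v K) = 0 \<and> Dx (dV \<phi>) (solved_jet t x u v K) = 0"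
    "\<sigma> \<noteq> 0 \<or> \<epsilon> = 0 \<and> lam \<noteq> 0 \<Longrightarrow> Dx (dU \<psi>) (solved_jet t x u v K) = 0 \<and> Dx (dV \<psi>) (solved_jet t x u v K) = 0"
    if "(t, x, u, v) \<in> R" for t x u v K
    using *[of "solved_jet t x u v K"] that by (auto simp: solved_jet)
  from this[where K = "(\<lambda>_. 0)(Der U 0 1 := r, Der V 0 1 := s)" for r s]
  show "\<epsilon> \<noteq> 0 \<or> \<sigma> = 0 \<and> \<kappa> \<noteq> 0 \<Longrightarrow> affine_in_uv \<phi>" "\<sigma> \<noteq> 0 \<or> \<epsilon> = 0 \<and> lam \<noteq> 0 \<Longrightarrow> affine_in_uv \<psi>"
    by (simp_all add: affine_in_uv_iff \<phi> \<psi>, simp_all add: Dx_def solved_jet, simp_all add: solved_jet_def)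
qed

text \<open>The nonlinear terms of \<open>D\<^sub>tD\<^sub>x\<^sup>2\<phi>\<close> can be dropped: either \<open>\<epsilon> = 0\<close> or \<open>\<phi>\<close> is affine in \<open>u\<close>, \<open>v\<close>.\<close>

lemma eps_Dtxx: "\<epsilon> * Dtxx \<phi> z = \<epsilon> * (dT (dX (dX \<phi>)) (base_pt z)
      + z (Der U 1 2) * dU \<phi> (base_pt z) + z (Der U 0 2) * dT (dU \<phi>) (base_pt z)
      + z (Der V 1 2) * dV \<phi> (base_pt z) + z (Der V 0 2) * dT (dV \<phi>) (base_pt z))"
  using affine_in_uv_jets(2)[OF \<phi> affine_cases(1)] by (cases "\<epsilon> = 0") simp_all

lemma sigma_Dtxx: "\<sigma> * Dtxx \<psi> z = \<sigma> * (dT (dX (dX \<psi>)) (base_pt z)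
      + z (Der U 1 2) * dU \<psi> (base_pt z) + z (Der U 0 2) * dT (dU \<psi>) (base_pt z)
      + z (Der V 1 2) * dV \<psi> (base_pt z) + z (Der V 0 2) * dT (dV \<psi>) (base_pt z))"
  using affine_in_uv_jets(2)[OF \<psi> affine_cases(2)] by (cases "\<sigma> = 0") simp_all

text \<open>Each equation comes from one solution jet at which at most one of the free coordinates is nonzero.
  At the jet with all of them zero the adjoint system is the pair of transport equations that comes
  first, and subtracting it isolates the coefficient of the chosen coordinate: \<open>v\<^sub>t\<^sub>x\<^sub>x\<close> and \<open>u\<^sub>t\<^sub>x\<^sub>x\<close>
  give the third and the fourth equation, \<open>u\<^sub>x\<^sub>x\<^sub>x\<close> the fifth, \<open>v\<^sub>x\<^sub>x\<close> and \<open>u\<^sub>x\<^sub>x\<close> the next two, \<open>v\<^sub>x\<close> and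
  \<open>u\<^sub>x\<close> the last two.\<close>

lemma determining_equations:
  assumes p: "(t, x, u, v) \<in> R"
  shows "dT \<phi> (t,x,u,v) + (a + b) * v * dX \<phi> (t,x,u,v) + (b * u + c) * dX \<psi> (t,x,u,v)
      + \<epsilon> * dT (dX (dX \<phi>)) (t,x,u,v) + lam * dX (dX (dX \<psi>)) (t,x,u,v) = 0" (is "?c1 = 0")
    and "dT \<psi> (t,x,u,v) + (a * u + c) * dX \<phi> (t,x,u,v) + (a + b) * v * dX \<psi> (t,x,u,v)
      + \<kappa> * dX (dX (dX \<phi>)) (t,x,u,v) + \<sigma> * dT (dX (dX \<psi>)) (t,x,u,v) = 0" (is "?c2 = 0")
    and "\<epsilon> * dV \<phi> (t,x,u,v) = \<sigma> * dV \<phi> (t,x,u,v)" (is ?N1)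
    and "\<epsilon> * dU \<psi> (t,x,u,v) = \<sigma> * dU \<psi> (t,x,u,v)" (is ?N2)
    and "\<kappa> * dU \<phi> (t,x,u,v) = lam * dV \<psi> (t,x,u,v)" (is ?X)
    and "\<epsilon> * dT (dV \<phi>) (t,x,u,v) + 3 * lam * dX (dV \<psi>) (t,x,u,v) = 0" (is ?T1)
    and "\<sigma> * dT (dU \<psi>) (t,x,u,v) + 3 * \<kappa> * dX (dU \<phi>) (t,x,u,v) = 0" (is ?T2)
    and "dU \<psi> (t,x,u,v) = dV \<phi> (t,x,u,v)" (is ?S)
    and "(b * u + c) * dV \<psi> (t,x,u,v) + b * \<phi> (t,x,u,v) = (a * u + c) * dU \<phi> (t,x,u,v)" (is ?L)
proof -
  let ?O = "(\<lambda>_. 0) :: dep jet"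
  note A1 = adj_solved_jet(1)[OF p, unfolded adj1_def eps_Dtxx]
  note A2 = adj_solved_jet(2)[OF p, unfolded adj2_def sigma_Dtxx]
  note exps = Dt_def Dx_def Dxx_def Dxxx_def solved_jet solved_jet_coords[unfolded One_nat_def] pd_normal_order \<phi> \<psi> smooth_on_pd
  show C1: "?c1 = 0" using A1[of ?O] by (simp add: exps)
  show C2: "?c2 = 0" using A2[of ?O] by (simp add: exps)
  have "?c1 + (\<epsilon> * dV \<phi> (t,x,u,v) - \<sigma> * dV \<phi> (t,x,u,v)) = 0"
    using A1[of "?O(Der V 1 2 := 1)"] by (simp add: exps algebra_simps)
  with C1 show N1: ?N1 by linarith
  have "?c2 + (\<sigma> * dU \<psi> (t,x,u,v) - \<epsilon> * dU \<psi> (t,x,u,v)) = 0"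
    using A2[of "?O(Der U 1 2 := 1)"] by (simp add: exps algebra_simps)
  with C2 show N2: ?N2 by linarith
  show X: ?X using A2[of "?O(Der U 0 3 := 1)"] C2 by (simp add: exps algebra_simps)
  show T1: ?T1 using A1[of "?O(Der V 0 2 := 1)"] C1 by (simp add: exps algebra_simps)
  show T2: ?T2 using A2[of "?O(Der U 0 2 := 1)"] C2 by (simp add: exps algebra_simps)
  have kappa_Dxxx: "\<kappa> * Dxxx \<phi> z = \<kappa> * (dX (dX (dX \<phi>)) (base_pt z) + z (Der U 0 3) * dU \<phi> (base_pt z)
      + z (Der V 0 3) * dV \<phi> (base_pt z))" if "\<epsilon> \<noteq> 0 \<or> \<sigma> = 0 \<or> \<kappa> = 0" for z
    using affine_in_uv_jets(1)[OF \<phi> affine_cases(1)] that by (cases "\<kappa> = 0") auto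
  have lam_Dxxx: "lam * Dxxx \<psi> z = lam * (dX (dX (dX \<psi>)) (base_pt z) + z (Der U 0 3) * dU \<psi> (base_pt z)
      + z (Der V 0 3) * dV \<psi> (base_pt z))" if "\<sigma> \<noteq> 0" for z
    using affine_in_uv_jets(1)[OF \<psi> affine_cases(2)] that by auto
  have au: "a * u + c \<noteq> 0" using p ab_c by (cases "a = 0") (auto simp: region_def)
  \<comment> \<open>Both remaining equations are read off from \<open>F\<^sub>2\<^sup>*\<close>, the first one with the factor \<open>a u + c\<close>, which
    has no zeros; \<open>b u + c\<close>, the factor in \<open>F\<^sub>1\<^sup>*\<close>, may have some. The expression \<open>F\<^sub>2\<^sup>*\<close> is spoiled by \<open>\<kappa> D\<^sub>x\<^sup>3\<phi>\<close> only if \<open>\<epsilon> = 0\<close> and \<open>\<sigma>\<close>, \<open>\<kappa>\<close> are nonzero. Then the third and the fourth equation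
    give \<open>\<phi>\<^sub>v = \<psi>\<^sub>u = 0\<close>, and \<open>\<psi>\<close> is affine, so that \<open>F\<^sub>1\<^sup>*\<close> can be used instead.\<close>
  show S: ?S
  proof (cases "\<epsilon> \<noteq> 0 \<or> \<sigma> = 0 \<or> \<kappa> = 0")
    case True
    have "?c2 + ((a * u + c) * dV \<phi> (t,x,u,v) - (a * u + c) * dU \<psi> (t,x,u,v)) = 0"
      using A2[of "?O(Der V 0 1 := 1)", unfolded kappa_Dxxx[OF True]] by (simp add: exps algebra_simps)
    with C2 have "(a * u + c) * dV \<phi> (t,x,u,v) = (a * u + c) * dU \<psi> (t,x,u,v)" by linarith
    then show ?thesis using au by simp
  qed (use N1 N2 in auto)
  show L: ?L
  proof (cases "\<epsilon> \<noteq> 0 \<or> \<sigma> = 0 \<or> \<kappa> = 0")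
    case True
    show ?thesis
      using A2[of "?O(Der U 0 1 := 1)", unfolded kappa_Dxxx[OF True]] C2 by (simp add: exps algebra_simps)
  next
    case False
    then have "\<sigma> \<noteq> 0" by simp
    show ?thesis
      using A1[of "?O(Der V 0 1 := 1)", unfolded lam_Dxxx[OF \<open>\<sigma> \<noteq> 0\<close>]] C1 S
      by (simp add: exps algebra_simps)
  qed
qed

end

section \<open>Solving the determining equations\<close>

context base_region begin

text \<open>For differentiating an identity \<open>A = 0\<close> that holds throughout the region.\<close>

lemma vanishing_DERIV:
  assumes A: "\<And>t x u v. (t, x, u, v) \<in> S \<Longrightarrow> A t x u v = 0" and p: "(t, x, u, v) \<in> S"
  shows "((\<lambda>s. A s x u v) has_real_derivative d) (at t) \<Longrightarrow> d = 0"
    and "((\<lambda>s. A t s u v) has_real_derivative d) (at x) \<Longrightarrow> d = 0"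
    and "((\<lambda>s. A t x s v) has_real_derivative d) (at u) \<Longrightarrow> d = 0"
    and "((\<lambda>s. A t x u s) has_real_derivative d) (at v) \<Longrightarrow> d = 0"
proof -
  have *: "d = 0" if "(B has_real_derivative d) (at r)" "\<forall>\<^sub>F s in nhds r. B s = 0" for B r
    using that DERIV_cong_ev[of r r B "\<lambda>_. 0" d d] DERIV_unique[of "\<lambda>_. 0 :: real" 0 r d] by simp
  show "((\<lambda>s. A s x u v) has_real_derivative d) (at t) \<Longrightarrow> d = 0"
    by (erule *) (rule eventually_mono[OF eventually_T[OF p] A])
  show "((\<lambda>s. A t s u v) has_real_derivative d) (at x) \<Longrightarrow> d = 0"
    by (erule *) (rule eventually_mono[OF eventually_X[OF p] A])
  show "((\<lambda>s. A t x s v) has_real_derivative d) (at u) \<Longrightarrow> d = 0"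
    by (erule *) (rule eventually_mono[OF eventually_U[OF p] A])
  show "((\<lambda>s. A t x u s) has_real_derivative d) (at v) \<Longrightarrow> d = 0"
    by (erule *) (rule eventually_mono[OF eventually_V[OF p] A])
qed

lemma pd_cmult:
  assumes "smooth_on S f"
  shows "pd h (\<lambda>p. r * f p) = (\<lambda>p. r * pd h f p)"
proof
  fix p
  have "((\<lambda>p. r * f p) has_derivative (\<lambda>h. r * pd h f p)) (at p)" if "p \<in> S"
    using smooth_on_has_derivative[OF assms that] by (rule has_derivative_mult_right)
  from pd_eqI[OF this] show "pd h (\<lambda>p. r * f p) p = r * pd h f p"
    by (cases "p \<in> S") (auto simp: pd_def)
qed

lemma pd_outside: "p \<notin> S \<Longrightarrow> pd h f p = 0"
  by (simp add: pd_def)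

lemma pd_ext:
  assumes "\<And>t x u v. (t, x, u, v) \<in> S \<Longrightarrow> pd h f (t, x, u, v) = r * pd k g (t, x, u, v)"
  shows "pd h f = (\<lambda>p. r * pd k g p)"
proof
  fix p
  show "pd h f p = r * pd k g p"
    using assms by (cases "p \<in> S"; cases p) (auto simp: pd_outside)
qed

lemma pd_zeroI: "(\<And>t x u v. (t, x, u, v) \<in> S \<Longrightarrow> pd h f (t, x, u, v) = 0) \<Longrightarrow> pd h f = (\<lambda>_. 0)"
  using pd_ext[of h f 0 h f] by simp

lemma constant_if_pd_zero:
  assumes S: "convex S" and f: "smooth_on S f"
    and z: "dT f = (\<lambda>_. 0)" "dX f = (\<lambda>_. 0)" "dU f = (\<lambda>_. 0)" "dV f = (\<lambda>_. 0)"
  obtains k where "\<And>p. p \<in> S \<Longrightarrow> f p = k"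
proof -
  have "f q = f p" if "p \<in> S" "q \<in> S" for p q
  proof (rule constant_along_segment[OF f])
    show "closed_segment p q \<subseteq> S" using S that by (simp add: closed_segment_subset)
    show "pd (q - p) f y = 0" if "y \<in> S" for y
      using pd_decompose[OF f that] z by (cases "q - p") simp
  qed
  then have "\<And>p. p \<in> S \<Longrightarrow> f p = f (SOME p. p \<in> S)"
    using someI[of "\<lambda>p. p \<in> S"] by metis
  then show thesis by (rule that)
qed

end

context dispersive_system begin

abbreviation "I \<equiv> {u. a \<noteq> 0 \<longrightarrow> a * u + c > 0}"

lemma region_iff: "(t, x, u, v) \<in> R \<longleftrightarrow> u \<in> I"
  by (simp add: region_def)

lemma I_nonempty: obtains u0 where "u0 \<in> I"
  by (rule that[of "if a = 0 then 0 else (1 - c) / a"]) simp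

lemma convex_I: "convex I"
proof (cases "a = 0")
  case False
  then have "I = {u. inner a u > - c}" by auto
  then show ?thesis by (simp only: convex_halfspace_gt)
qed simp

lemma convex_region: "convex R"
proof -
  have "R = UNIV \<times> UNIV \<times> I \<times> UNIV" by (auto simp: region_def)
  then show ?thesis by (simp only:) (intro convex_Times convex_UNIV convex_I)
qed

end

context adjoint_pair begin

lemma symmetry_relations:
  shows psi_U: "dU \<psi> = dV \<phi>"
    and phi_L: "\<And>t x u v. (t, x, u, v) \<in> R \<Longrightarrow> (b * u + c) * dV \<psi> (t,x,u,v) + b * \<phi> (t,x,u,v)
       - (a * u + c) * dU \<phi> (t,x,u,v) = 0"
proof -
  show "dU \<psi> = dV \<phi>"
    using pd_ext[of "(0,0,1,0)" \<psi> 1 "(0,0,0,1)" \<phi>] determining_equations(8) by simp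
  show "\<And>t x u v. (t, x, u, v) \<in> R \<Longrightarrow> (b * u + c) * dV \<psi> (t,x,u,v) + b * \<phi> (t,x,u,v)
       - (a * u + c) * dU \<phi> (t,x,u,v) = 0"
    using determining_equations(9) by simp
qed

lemmas smooth = \<phi> \<psi> smooth_on_pd[OF \<phi>] smooth_on_pd[OF \<psi>]
    smooth_on_pd[OF smooth_on_pd[OF \<phi>]] smooth_on_pd[OF smooth_on_pd[OF \<psi>]]
    smooth_on_pd[OF smooth_on_pd[OF smooth_on_pd[OF \<phi>]]] smooth_on_pd[OF smooth_on_pd[OF smooth_on_pd[OF \<psi>]]]
lemmas diff_rules = smooth[THEN DERIV_T] smooth[THEN DERIV_X] smooth[THEN DERIV_U] smooth[THEN DERIV_V]
    DERIV_const DERIV_ident DERIV_add DERIV_diff DERIV_mult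
lemmas order = pd_normal_order smooth

text \<open>As one of the dispersion coefficients is nonzero, \<open>\<phi>\<close> or \<open>\<psi>\<close> is affine in \<open>u\<close>, \<open>v\<close>. If it is \<open>\<phi>\<close>,
  then \<open>\<psi>\<^sub>u = \<phi>\<^sub>v\<close> controls the derivatives of \<open>\<psi>\<^sub>u\<close>, and differentiating
  \<open>(b u + c) \<psi>\<^sub>v + b \<phi> = (a u + c) \<phi>\<^sub>u\<close> with respect to \<open>u\<close> expresses \<open>b \<psi>\<^sub>v\<close> by \<open>\<phi>\<^sub>u\<close>.\<close>

lemma affine_psi: "affine_in_uv \<psi>"
proof (cases "affine_in_uv \<phi>")
  case False
  then show ?thesis using affine_cases dispersive by auto
next
  case True
  then have z: "dX (dU \<phi>) = (\<lambda>_. 0)" "dU (dU \<phi>) = (\<lambda>_. 0)" "dU (dV \<phi>) = (\<lambda>_. 0)"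
    "dX (dV \<phi>) = (\<lambda>_. 0)" "dV (dV \<phi>) = (\<lambda>_. 0)"
    by (simp_all add: affine_in_uv_def)
  have UV: "dU (dV \<psi>) = (\<lambda>_. 0)"
    using z(5) psi_U pd_normal_order(6)[OF \<psi>] by simp
  have bV: "b * dV \<psi> p = (a - b) * dU \<phi> p" for p
  proof (cases p)
    case (fields t x u v)
    show ?thesis
    proof (cases "p \<in> R")
      case True
      then have p: "(t, x, u, v) \<in> R" by (simp add: fields)
      have "b * dV \<psi> (t,x,u,v) + b * dU \<phi> (t,x,u,v) - a * dU \<phi> (t,x,u,v) = 0"
        by (rule vanishing_DERIV(3)[OF _ p], rule phi_L, assumption)
        (rule DERIV_cong, (rule p diff_rules)+, simp add: fields z UV)
      then show ?thesis by (simp add: fields algebra_simps)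
    qed (simp add: pd_outside)
  qed
  have V: "pd h (dV \<psi>) = (\<lambda>_. 0)" if "pd h (dU \<phi>) = (\<lambda>_. 0)" for h
  proof (cases "b = 0")
    case True
    then have "a \<noteq> 0" using ab_c by auto
    \<comment> \<open>for \<open>b = 0\<close> the relation \<open>b \<psi>\<^sub>v = (a - b) \<phi>\<^sub>u\<close> says nothing about \<open>\<psi>\<^sub>v\<close>, but forces \<open>\<phi>\<^sub>u = 0\<close>\<close>
    then have U: "dU \<phi> = (\<lambda>_. 0)" using bV True by (auto simp: fun_eq_iff)
    have "dV \<psi> = (\<lambda>_. 0)"
      using phi_L ab_c by (intro pd_zeroI) (simp add: True U)
    then show ?thesis by simp
  next
    case False
    define r where "r = (a - b) / b"
    have "dV \<psi> = (\<lambda>p. r * dU \<phi> p)"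
      using bV False by (auto simp: fun_eq_iff field_simps r_def)
    then show ?thesis using that pd_cmult[OF smooth_on_pd[OF \<phi>]] by simp
  qed
  show ?thesis
    using z UV V psi_U pd_normal_order(6)[OF \<phi>] by (simp add: affine_in_uv_def)
qed

lemma psi_second: "dX (dU \<psi>) = (\<lambda>_. 0)" "dU (dU \<psi>) = (\<lambda>_. 0)" "dU (dV \<psi>) = (\<lambda>_. 0)"
    "dX (dV \<psi>) = (\<lambda>_. 0)" "dV (dV \<psi>) = (\<lambda>_. 0)"
  and phi_second: "dX (dV \<phi>) = (\<lambda>_. 0)" "dU (dV \<phi>) = (\<lambda>_. 0)" "dV (dV \<phi>) = (\<lambda>_. 0)"
  using affine_psi psi_U pd_normal_order(6)[OF \<psi>] by (simp_all add: affine_in_uv_def)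

lemma b_phi_V:
  assumes p: "(t, x, u, v) \<in> R"
  shows "b * dV \<phi> (t, x, u, v) = 0"
  by (rule vanishing_DERIV(4)[OF _ p], rule phi_L, assumption)
        (rule DERIV_cong, (rule p diff_rules)+, simp add: psi_second phi_second order)

text \<open>The \<open>v\<close>-derivatives of the two transport equations.\<close>

lemma phi_TV: "dT (dV \<phi>) = (\<lambda>p. - (a + b) * dX \<phi> p)"
proof (rule pd_ext)
  fix t x u v assume p: "(t, x, u, v) \<in> R"
  have "dT (dV \<phi>) (t, x, u, v) + (a + b) * dX \<phi> (t, x, u, v) = 0"
    by (rule vanishing_DERIV(4)[OF _ p], rule determining_equations(1), assumption)
        (rule DERIV_cong, (rule p diff_rules)+, simp add: psi_second phi_second order)
  then show "dT (dV \<phi>) (t, x, u, v) = - (a + b) * dX \<phi> (t, x, u, v)" by (simp add: algebra_simps)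
qed

lemma psi_TV: "dT (dV \<psi>) = (\<lambda>p. - (a + b) * dX \<psi> p)"
proof (rule pd_ext)
  fix t x u v assume p: "(t, x, u, v) \<in> R"
  have "dT (dV \<psi>) (t, x, u, v) + (a + b) * dX \<psi> (t, x, u, v) = 0"
    by (rule vanishing_DERIV(4)[OF _ p], rule determining_equations(2), assumption)
        (rule DERIV_cong, (rule p diff_rules)+, simp add: psi_second phi_second order)
  then show "dT (dV \<psi>) (t, x, u, v) = - (a + b) * dX \<psi> (t, x, u, v)" by (simp add: algebra_simps)
qed

text \<open>Since \<open>a + b \<noteq> 0\<close>, the previous two relations make \<open>\<phi>\<^sub>x\<close> and \<open>\<psi>\<^sub>x\<close> multiples of \<open>\<phi>\<^sub>t\<^sub>v\<close> and \<open>\<psi>\<^sub>t\<^sub>v\<close>. So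
  they inherit the vanishing derivatives of \<open>\<phi>\<^sub>v\<close> and \<open>\<psi>\<^sub>v\<close>.\<close>

lemma X_second: "dX (dX \<phi>) = (\<lambda>_. 0)" "dX (dU \<phi>) = (\<lambda>_. 0)" "dX (dX \<psi>) = (\<lambda>_. 0)"
proof -
  have "pd h (dX \<phi>) = (\<lambda>_. 0)" if "pd h (dV \<phi>) = (\<lambda>_. 0)" for h
  proof -
    have "(\<lambda>p. - (a + b) * pd h (dX \<phi>) p) = pd h (dT (dV \<phi>))"
      unfolding phi_TV by (rule pd_cmult[OF smooth_on_pd[OF \<phi>], symmetric])
    also have "\<dots> = dT (pd h (dV \<phi>))" by (rule pd_commute[OF smooth_on_pd[OF \<phi>]])
    finally show ?thesis using ab_c that by (simp add: fun_eq_iff)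
  qed
  from this[OF phi_second(1)] this[OF phi_second(2)]
  show "dX (dX \<phi>) = (\<lambda>_. 0)" "dX (dU \<phi>) = (\<lambda>_. 0)" by (simp_all add: order)
  have "(\<lambda>p. - (a + b) * dX (dX \<psi>) p) = dX (dT (dV \<psi>))"
    unfolding psi_TV by (rule pd_cmult[OF smooth_on_pd[OF \<psi>], symmetric])
  also have "\<dots> = (\<lambda>_. 0)" by (simp add: order psi_second)
  finally show "dX (dX \<psi>) = (\<lambda>_. 0)" using ab_c by (simp add: fun_eq_iff)
qed

text \<open>The third-order terms of the transport equations contain two derivatives in \<open>x\<close> and thus
  disappear.\<close>

lemma transport:
  assumes "(t, x, u, v) \<in> R"
  shows "dT \<phi> (t,x,u,v) + (a + b) * v * dX \<phi> (t,x,u,v) + (b * u + c) * dX \<psi> (t,x,u,v) = 0"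
    and "dT \<psi> (t,x,u,v) + (a * u + c) * dX \<phi> (t,x,u,v) + (a + b) * v * dX \<psi> (t,x,u,v) = 0"
  using determining_equations(1,2)[OF assms] by (simp_all add: X_second)

lemma TX_zero: "dT (dX \<phi>) = (\<lambda>_. 0)" "dT (dX \<psi>) = (\<lambda>_. 0)"
proof -
  show "dT (dX \<phi>) = (\<lambda>_. 0)"
  proof (rule pd_zeroI)
    fix t x u v assume p: "(t, x, u, v) \<in> R"
    show "dT (dX \<phi>) (t, x, u, v) = 0"
      by (rule vanishing_DERIV(2)[OF _ p], rule transport(1), assumption)
        (rule DERIV_cong, (rule p diff_rules)+, simp add: X_second order)
  qed
  show "dT (dX \<psi>) = (\<lambda>_. 0)"
  proof (rule pd_zeroI)
    fix t x u v assume p: "(t, x, u, v) \<in> R"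
    show "dT (dX \<psi>) (t, x, u, v) = 0"
      by (rule vanishing_DERIV(2)[OF _ p], rule transport(2), assumption)
        (rule DERIV_cong, (rule p diff_rules)+, simp add: X_second order)
  qed
qed

text \<open>Comparing \<open>\<psi>\<^sub>t\<^sub>u = - a \<phi>\<^sub>x\<close>, the \<open>u\<close>-derivative of the second transport equation, with
  \<open>\<phi>\<^sub>t\<^sub>v = - (a + b) \<phi>\<^sub>x\<close>.\<close>

lemma b_phi_X:
  assumes p: "(t, x, u, v) \<in> R"
  shows "b * dX \<phi> (t, x, u, v) = 0"
proof -
  have "dT (dU \<psi>) (t, x, u, v) + a * dX \<phi> (t, x, u, v) = 0"
    by (rule vanishing_DERIV(3)[OF _ p], rule transport(2), assumption)
        (rule DERIV_cong, (rule p diff_rules)+, simp add: X_second psi_second order)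
  then show ?thesis by (simp add: psi_U phi_TV algebra_simps)
qed

text \<open>The \<open>t\<close>-derivative of \<open>(b u + c) \<psi>\<^sub>v + b \<phi> = (a u + c) \<phi>\<^sub>u\<close> becomes, by the transport equations, a
  polynomial in \<open>u\<close> times \<open>\<psi>\<^sub>x\<close>. Since \<open>\<psi>\<^sub>x\<close> does not depend on \<open>u\<close>, both coefficients of this
  polynomial annihilate it, and the constant one is \<open>(a + b) c \<noteq> 0\<close>.\<close>

lemma psi_X: "dX \<psi> = (\<lambda>_. 0)"
proof (rule pd_zeroI)
  have e: "(2 * b\<^sup>2 * u + (a + b) * c) * dX \<psi> (t, x, u, v) = 0" if p: "(t, x, u, v) \<in> R" for t x u v
  proof -
    have 1: "dT (dU \<phi>) (t, x, u, v) + b * dX \<psi> (t, x, u, v) = 0"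
      by (rule vanishing_DERIV(3)[OF _ p], rule transport(1), assumption)
        (rule DERIV_cong, (rule p diff_rules)+, simp add: X_second psi_second order)
    have 2: "(b * u + c) * dT (dV \<psi>) (t,x,u,v) + b * dT \<phi> (t,x,u,v)
        - (a * u + c) * dT (dU \<phi>) (t,x,u,v) = 0"
      by (rule vanishing_DERIV(1)[OF _ p], rule phi_L, assumption)
        (rule DERIV_cong, (rule p diff_rules)+, simp add: X_second psi_second order)
    have 3: "dT (dV \<psi>) (t, x, u, v) = - (a + b) * dX \<psi> (t, x, u, v)" by (simp add: psi_TV)
    from 1 2 3 transport(1)[OF p] b_phi_X[OF p] show ?thesis by algebra
  qed
  fix t x u v assume p: "(t, x, u, v) \<in> R"
  have "2 * b\<^sup>2 * dX \<psi> (t, x, u, v) = 0"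
    by (rule vanishing_DERIV(3)[OF _ p], rule e, assumption)
        (rule DERIV_cong, (rule p diff_rules)+, simp add: X_second psi_second order)
  then show "dX \<psi> (t, x, u, v) = 0" using e[OF p] ab_c by (auto simp: distrib_right)
qed

lemma phi_X_constant: "\<exists>\<gamma>. \<forall>p\<in>R. dX \<phi> p = \<gamma>"
  using constant_if_pd_zero[OF convex_region smooth_on_pd[OF \<phi>], of "(0,1,0,0)"]
  by (simp add: order TX_zero X_second phi_second) blast

lemma psi_V_constant: "\<exists>G. \<forall>p\<in>R. dV \<psi> p = G"
  using constant_if_pd_zero[OF convex_region smooth_on_pd[OF \<psi>], of "(0,0,0,1)"]
  by (simp add: psi_second psi_TV psi_X) blast

lemma phi_V_affine:
  assumes \<gamma>: "\<And>p. p \<in> R \<Longrightarrow> dX \<phi> p = \<gamma>"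
  shows "\<exists>E0. \<forall>t x u v. (t, x, u, v) \<in> R \<longrightarrow> dV \<phi> (t, x, u, v) = E0 - a * \<gamma> * t"
proof -
  have TV: "dT (dV \<phi>) p = - a * \<gamma>" if "p \<in> R" for p
    using that b_phi_X[of "fst p" "fst (snd p)" "fst (snd (snd p))" "snd (snd (snd p))"]
    by (simp add: phi_TV \<gamma> algebra_simps)
  have "smooth_on R (\<lambda>p. dV \<phi> p + a * \<gamma> * fst p)"
    by (intro smooth_on_add smooth_on_mult smooth_on_const smooth_on_linear smooth_on_pd \<phi> bounded_linear_fst)
  moreover have "pd h (\<lambda>p. dV \<phi> p + a * \<gamma> * fst p) p = pd h (dV \<phi>) p + a * \<gamma> * fst h" if "p \<in> R" for h p
    using that
    by (intro pd_eqI has_derivative_add has_derivative_mult_right smooth_on_has_derivative smooth_on_pd \<phi>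
        bounded_linear_imp_has_derivative bounded_linear_fst)
  ultimately obtain k where k: "\<And>p. p \<in> R \<Longrightarrow> dV \<phi> p + a * \<gamma> * fst p = k"
    by (rule_tac constant_if_pd_zero[OF convex_region, of "\<lambda>p. dV \<phi> p + a * \<gamma> * fst p"])
      (auto intro!: pd_zeroI simp: phi_second TV)
  show ?thesis
    by (rule exI[of _ k]) (use k in fastforce)
qed

text \<open>All derivatives except \<open>\<phi>\<^sub>u\<close> are now explicit, so both functions are recovered by integrating along
  coordinate lines. These stay in the region in the directions \<open>t\<close>, \<open>x\<close>, \<open>v\<close>; in the direction \<open>u\<close> the region
  is an interval. The unknown function \<open>f\<close> is \<open>\<phi>(0,0,u,0)\<close>.\<close>

lemma explicit_form:
  obtains \<gamma> E0 D0 G f where "b * \<gamma> = 0" "b * E0 = 0"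
    "\<And>p. p \<in> R \<Longrightarrow> dX \<phi> p = \<gamma>" "\<And>p. p \<in> R \<Longrightarrow> dV \<psi> p = G"
    "\<And>t x u v. (t, x, u, v) \<in> R \<Longrightarrow> dV \<phi> (t, x, u, v) = E0 - a * \<gamma> * t"
    "\<And>t x u v. (t, x, u, v) \<in> R \<Longrightarrow> \<phi> (t, x, u, v) = \<gamma> * x + f u + (E0 - a * \<gamma> * t) * v"
    "\<And>t x u v. (t, x, u, v) \<in> R \<Longrightarrow>
       \<psi> (t, x, u, v) = D0 - c * \<gamma> * t + (E0 - a * \<gamma> * t) * u + G * v"
proof -
  obtain \<gamma> where \<gamma>: "\<And>p. p \<in> R \<Longrightarrow> dX \<phi> p = \<gamma>" using phi_X_constant by blast
  obtain G where G: "\<And>p. p \<in> R \<Longrightarrow> dV \<psi> p = G" using psi_V_constant by blast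
  obtain E0 where E0: "\<And>t x u v. (t, x, u, v) \<in> R \<Longrightarrow> dV \<phi> (t, x, u, v) = E0 - a * \<gamma> * t"
    using phi_V_affine[OF \<gamma>] by blast
  obtain u0 where "u0 \<in> I" by (rule I_nonempty)
  then have u0: "(t, x, u0, v) \<in> R" for t x v using region_iff by blast
  have R: "(t, x, u, v) \<in> R \<longleftrightarrow> (0, 0, u, 0) \<in> R" for t x u v
    by (simp add: region_def)
  have b\<gamma>: "b * \<gamma> = 0" using b_phi_X[OF u0] \<gamma>[OF u0] by simp
  have "b * (E0 - a * \<gamma> * 0) = 0" using b_phi_V[OF u0] E0[OF u0] by metis
  then have bE: "b * E0 = 0" by simp
  have T: "dT \<phi> (t, x, u, v) = - a * \<gamma> * v" "dT \<psi> (t, x, u, v) = - (a * u + c) * \<gamma>"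
    if "(t, x, u, v) \<in> R" for t x u v
  proof -
    have "dT \<phi> (t, x, u, v) + (a + b) * v * \<gamma> = 0" "dT \<psi> (t, x, u, v) + (a * u + c) * \<gamma> = 0"
      using transport[OF that] by (simp_all add: psi_X \<gamma>[OF that])
    with b\<gamma> show "dT \<phi> (t, x, u, v) = - a * \<gamma> * v" "dT \<psi> (t, x, u, v) = - (a * u + c) * \<gamma>"
      by algebra+
  qed
  have line: "g s = g 0 + k * s" if "\<And>r. (g has_real_derivative k) (at r)" for g k and s :: real
  proof -
    have "((\<lambda>r. g r - k * r) has_real_derivative k - k * 1) (at r)" for r
      by (intro DERIV_diff that DERIV_cmult DERIV_ident)
    then have "((\<lambda>r. g r - k * r) has_real_derivative 0) (at r)" for r by simp
    then show ?thesis using DERIV_isconst_all[of "\<lambda>r. g r - k * r" s 0] by simp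
  qed
  show thesis
  proof (rule that[OF b\<gamma> bE \<gamma> G E0], assumption, assumption, assumption)
    fix t x u v assume p: "(t, x, u, v) \<in> R"
    have q: "(t', x', u, v') \<in> R" for t' x' v' using p R by blast
    have "\<phi> (t, x, u, v) = \<phi> (t, x, u, 0) + (E0 - a * \<gamma> * t) * v"
      by (rule line) (use DERIV_V[OF \<phi> q] E0[OF q] in simp)
    also have "\<phi> (t, x, u, 0) = \<phi> (t, 0, u, 0) + \<gamma> * x"
      by (rule line) (use DERIV_X[OF \<phi> q] \<gamma>[OF q] in simp)
    also have "\<phi> (t, 0, u, 0) = \<phi> (0, 0, u, 0) + 0 * t"
      by (rule line, rule DERIV_cong[OF DERIV_T[OF \<phi> q]]) (simp add: T(1)[OF q])
    finally show "\<phi> (t, x, u, v) = \<gamma> * x + \<phi> (0, 0, u, 0) + (E0 - a * \<gamma> * t) * v" by simp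
    have "\<psi> (t, x, u, v) = \<psi> (t, x, u, 0) + G * v"
      by (rule line) (use DERIV_V[OF \<psi> q] G[OF q] in simp)
    also have "\<psi> (t, x, u, 0) = \<psi> (t, 0, u, 0) + 0 * x"
      by (rule line) (use DERIV_X[OF \<psi> q] psi_X in simp)
    also have "\<psi> (t, 0, u, 0) = \<psi> (0, 0, u, 0) + (- (a * u + c) * \<gamma>) * t"
      by (rule line, rule DERIV_cong[OF DERIV_T[OF \<psi> q]]) (simp add: T(2)[OF q])
    also have "\<psi> (0, 0, u, 0) = \<psi> (0, 0, u0, 0) + E0 * (u - u0)"
    proof -
      have I: "convex {r. (0, 0, r, 0) \<in> R}"
        unfolding region_iff using convex_I by simp
      have "((\<lambda>r. \<psi> (0, 0, r, 0) - E0 * r) has_real_derivative 0) (at r)" if r: "(0, 0, r, 0) \<in> R" for r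
      proof (rule DERIV_cong[OF DERIV_diff[OF DERIV_U[OF \<psi> r] DERIV_cmult[OF DERIV_ident]]])
        show "dU \<psi> (0, 0, r, 0) - E0 * 1 = 0" using E0[OF r] by (simp add: psi_U)
      qed
      then have "\<exists>k. \<forall>r\<in>{r. (0, 0, r, 0) \<in> R}. \<psi> (0, 0, r, 0) - E0 * r = k"
        by (intro has_field_derivative_zero_constant I) (auto intro: has_field_derivative_at_within)
      then show ?thesis using q[of 0 0 0] u0[of 0 0 0] by (auto simp: algebra_simps)
    qed
    finally show "\<psi> (t, x, u, v) = (\<psi> (0, 0, u0, 0) - E0 * u0) - c * \<gamma> * t + (E0 - a * \<gamma> * t) * u + G * v"
      by (simp add: algebra_simps)
  qed
qed

end

context base_region begin

lemma pd_explicit: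
  assumes f: "smooth_on S f" and g: "\<And>t x u v. (t, x, u, v) \<in> S \<Longrightarrow> f (t, x, u, v) = g t x u v"
    and p: "(t, x, u, v) \<in> S"
  shows "((\<lambda>s. g s x u v) has_real_derivative d) (at t) \<Longrightarrow> dT f (t, x, u, v) = d"
    and "((\<lambda>s. g t s u v) has_real_derivative d) (at x) \<Longrightarrow> dX f (t, x, u, v) = d"
    and "((\<lambda>s. g t x s v) has_real_derivative d) (at u) \<Longrightarrow> dU f (t, x, u, v) = d"
    and "((\<lambda>s. g t x u s) has_real_derivative d) (at v) \<Longrightarrow> dV f (t, x, u, v) = d"
proof -
  note v = vanishing_DERIV[of "\<lambda>t x u v. f (t, x, u, v) - g t x u v", OF _ p]
  show "((\<lambda>s. g s x u v) has_real_derivative d) (at t) \<Longrightarrow> dT f (t, x, u, v) = d"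
    using v(1)[OF _ DERIV_diff[OF DERIV_T[OF f p]]] g by fastforce
  show "((\<lambda>s. g t s u v) has_real_derivative d) (at x) \<Longrightarrow> dX f (t, x, u, v) = d"
    using v(2)[OF _ DERIV_diff[OF DERIV_X[OF f p]]] g by fastforce
  show "((\<lambda>s. g t x s v) has_real_derivative d) (at u) \<Longrightarrow> dU f (t, x, u, v) = d"
    using v(3)[OF _ DERIV_diff[OF DERIV_U[OF f p]]] g by fastforce
  show "((\<lambda>s. g t x u s) has_real_derivative d) (at v) \<Longrightarrow> dV f (t, x, u, v) = d"
    using v(4)[OF _ DERIV_diff[OF DERIV_V[OF f p]]] g by fastforce
qed

lemma pd_of_constant: "(\<And>p. p \<in> S \<Longrightarrow> f p = k) \<Longrightarrow> pd h f = (\<lambda>_. 0)"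
  using pd_cong[of f "\<lambda>_. k" h] by simp

end

context dispersive_system begin

section \<open>All substitutions in terms of an ordinary differential equation\<close>

text \<open>What the determining equations say about \<open>f(u) = \<phi>(0,0,u,0)\<close> and the constant \<open>G = \<psi>\<^sub>v\<close>. The last
  condition is the affinity of \<open>\<phi>\<close> in \<open>u\<close>, \<open>v\<close> for \<open>\<epsilon> \<noteq> 0\<close>.\<close>

definition profile :: "real \<Rightarrow> (real \<Rightarrow> real) \<Rightarrow> (real \<Rightarrow> real) \<Rightarrow> bool" where
  "profile G f f' \<longleftrightarrow>
     (\<forall>u\<in>I. (f has_real_derivative f' u) (at u) \<and> (a * u + c) * f' u = b * f u + (b * u + c) * G
        \<and> \<kappa> * f' u = lam * G) \<and>
     (\<epsilon> \<noteq> 0 \<longrightarrow> (\<exists>B. \<forall>u\<in>I. f' u = B))"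

text \<open>The restrictions on \<open>\<gamma> = \<phi>\<^sub>x\<close> and on the value \<open>E0\<close> of \<open>\<phi>\<^sub>v = \<psi>\<^sub>u\<close> at \<open>t = 0\<close>.\<close>

definition compatible :: "real \<Rightarrow> real \<Rightarrow> bool" where
  "compatible \<gamma> E0 \<longleftrightarrow> b * \<gamma> = 0 \<and> b * E0 = 0 \<and> (\<epsilon> \<noteq> \<sigma> \<longrightarrow> \<gamma> = 0 \<and> E0 = 0) \<and>
     ((\<epsilon>, \<sigma>) \<noteq> (0, 0) \<longrightarrow> \<gamma> = 0)"

definition substitution_form ::
  "real \<Rightarrow> real \<Rightarrow> real \<Rightarrow> real \<Rightarrow> (real \<Rightarrow> real) \<Rightarrow> (base \<Rightarrow> real) \<Rightarrow> (base \<Rightarrow> real) \<Rightarrow> bool" where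
  "substitution_form \<gamma> E0 D0 G f \<phi> \<psi> \<longleftrightarrow> (\<forall>(t, x, u, v)\<in>R.
     \<phi> (t, x, u, v) = \<gamma> * x + f u + (E0 - a * \<gamma> * t) * v \<and>
     \<psi> (t, x, u, v) = D0 - c * \<gamma> * t + (E0 - a * \<gamma> * t) * u + G * v)"

lemma au_c_nonzero: "u \<in> I \<Longrightarrow> a * u + c \<noteq> 0"
  using ab_c by (cases "a = 0") auto

lemma coordinate_smooth:
  "smooth_on R (\<lambda>p. fst p)" "smooth_on R (\<lambda>p. fst (snd p))" "smooth_on R (\<lambda>p. fst (snd (snd p)))"
  "smooth_on R (\<lambda>p. snd (snd (snd p)))"
  by (intro smooth_on_linear bounded_linear_intros)+

lemma u_has_derivative:
  "((\<lambda>p. fst (snd (snd p))) has_derivative (\<lambda>h. fst (snd (snd h)))) (at (p :: base))"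
  by (auto intro!: derivative_eq_intros)

lemma smooth_reciprocal: "smooth_on R (\<lambda>p. inverse (a * fst (snd (snd p)) + c))"
proof (rule smooth_on_bootstrap)
  fix p assume p: "p \<in> R"
  then have "a * fst (snd (snd p)) + c \<noteq> 0" using au_c_nonzero by (cases p) (auto simp: region_def)
  then show "((\<lambda>p. inverse (a * fst (snd (snd p)) + c)) has_derivative
    (\<lambda>h. (- a * fst (snd (snd h))) * (inverse (a * fst (snd (snd p)) + c) * inverse (a * fst (snd (snd p)) + c)))) (at p)"
    by (auto intro!: derivative_eq_intros)
next
  fix k assume "higher_differentiable_on R (\<lambda>p. inverse (a * fst (snd (snd p)) + c)) k"
  then show "higher_differentiable_on R (\<lambda>p. inverse (a * fst (snd (snd p)) + c) * inverse (a * fst (snd (snd p)) + c)) k"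
    by (intro higher_differentiable_on_mult)
qed

text \<open>Dividing by \<open>a u + c\<close> gives \<open>f'\<close> as a smooth expression in \<open>u\<close> and \<open>f\<close>.\<close>

lemma smooth_profile:
  assumes "profile G f f'"
  shows "smooth_on R (\<lambda>p. f (fst (snd (snd p))))"
proof (rule smooth_on_bootstrap)
  let ?u = "\<lambda>p :: base. fst (snd (snd p))"
  let ?D = "\<lambda>p :: base. (b * f (?u p) + (b * ?u p + c) * G) * inverse (a * ?u p + c)"
  fix p assume "p \<in> R"
  then have u: "?u p \<in> I" by (cases p) (simp add: region_def)
  then have "(f has_real_derivative f' (?u p)) (at (?u p))"
    and "(a * ?u p + c) * f' (?u p) = b * f (?u p) + (b * ?u p + c) * G"
    using assms unfolding profile_def by blast+
  moreover from this(2) have "f' (?u p) = ?D p"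
    unfolding divide_inverse[symmetric] nonzero_eq_divide_eq[OF au_c_nonzero[OF u]]
    by (simp only: mult.commute)
  ultimately have "(f has_real_derivative ?D p) (at (?u p))" by (simp only:)
  then have "(f has_derivative (\<lambda>r. r * ?D p)) (at (?u p))"
    unfolding has_field_derivative_def by (rule has_derivative_eq_rhs) (simp add: fun_eq_iff)
  from has_derivative_compose[OF u_has_derivative this]
  show "((\<lambda>p. f (?u p)) has_derivative (\<lambda>h. ?u h * ?D p)) (at p)" .
next
  fix k assume f: "higher_differentiable_on R (\<lambda>p. f (fst (snd (snd p)))) k"
  show "higher_differentiable_on R
    (\<lambda>p. (b * f (fst (snd (snd p))) + (b * fst (snd (snd p)) + c) * G) * inverse (a * fst (snd (snd p)) + c)) k"
    using coordinate_smooth smooth_reciprocal unfolding smooth_on_def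
    by (intro higher_differentiable_on_mult higher_differentiable_on_add higher_differentiable_on_const f) blast+
qed

lemma smooth_substitution_form:
  assumes "profile G f f'" "substitution_form \<gamma> E0 D0 G f \<phi> \<psi>"
  shows "smooth_on R \<phi>" "smooth_on R \<psi>"
proof -
  have "smooth_on R (\<lambda>p. \<gamma> * fst (snd p) + f (fst (snd (snd p))) + (E0 + (- a * \<gamma>) * fst p) * snd (snd (snd p)))"
    by (intro smooth_on_add smooth_on_mult smooth_on_const coordinate_smooth smooth_profile[OF assms(1)])
  then show "smooth_on R \<phi>"
    by (rule smooth_on_cong[THEN iffD1, rotated]) (use assms(2) in \<open>auto simp: substitution_form_def\<close>)
  have "smooth_on R (\<lambda>p. D0 + (- c * \<gamma>) * fst p + (E0 + (- a * \<gamma>) * fst p) * fst (snd (snd p)) + G * snd (snd (snd p)))"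
    by (intro smooth_on_add smooth_on_mult smooth_on_const coordinate_smooth)
  then show "smooth_on R \<psi>"
    by (rule smooth_on_cong[THEN iffD1, rotated]) (use assms(2) in \<open>auto simp: substitution_form_def\<close>)
qed

text \<open>With \<open>E = E0 - a \<gamma> t\<close> the derivatives of \<open>\<phi>\<close> in \<open>u\<close>, \<open>v\<close> are \<open>f'\<close>, \<open>E\<close> and those of \<open>\<psi>\<close> are
  \<open>E\<close>, \<open>G\<close>. Hence \<open>F\<^sub>1\<^sup>* = f' F\<^sub>1 + E F\<^sub>2\<close> and \<open>F\<^sub>2\<^sup>* = E F\<^sub>1 + G F\<^sub>2\<close> up to multiples of the
  expressions that the conditions on \<open>\<gamma>\<close>, \<open>E0\<close>, \<open>G\<close> and \<open>f\<close> set to zero.\<close>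

lemma substitution_form_solves_adjoint:
  assumes prof: "profile G f f'" and comp: "compatible \<gamma> E0"
    and form: "substitution_form \<gamma> E0 D0 G f \<phi> \<psi>"
    and z: "base_pt z \<in> R" "F1 z = 0" "F2 z = 0"
  shows "adj1 \<phi> \<psi> z = 0" "adj2 \<phi> \<psi> z = 0"
proof -
  have \<phi>: "smooth_on R \<phi>" and \<psi>: "smooth_on R \<psi>" using smooth_substitution_form[OF prof form] .
  have \<phi>_eq: "\<phi> (t, x, u, v) = \<gamma> * x + f u + (E0 - a * \<gamma> * t) * v"
    and \<psi>_eq: "\<psi> (t, x, u, v) = D0 - c * \<gamma> * t + (E0 - a * \<gamma> * t) * u + G * v"
    if "(t, x, u, v) \<in> R" for t x u v
    using form that by (auto simp: substitution_form_def)
  have f: "(f has_real_derivative f' u) (at u)" if "u \<in> I" for u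
    using prof that by (simp add: profile_def)
  note ex = pd_explicit[OF \<phi>, of "\<lambda>t x u v. \<gamma> * x + f u + (E0 - a * \<gamma> * t) * v", OF \<phi>_eq]
    pd_explicit[OF \<psi>, of "\<lambda>t x u v. D0 - c * \<gamma> * t + (E0 - a * \<gamma> * t) * u + G * v", OF \<psi>_eq]
  have p1: "dT \<phi> (t, x, u, v) = - a * \<gamma> * v" "dX \<phi> (t, x, u, v) = \<gamma>" "dU \<phi> (t, x, u, v) = f' u"
    "dV \<phi> (t, x, u, v) = E0 - a * \<gamma> * t"
    "dT \<psi> (t, x, u, v) = - c * \<gamma> - a * \<gamma> * u" "dX \<psi> (t, x, u, v) = 0"
    "dU \<psi> (t, x, u, v) = E0 - a * \<gamma> * t" "dV \<psi> (t, x, u, v) = G"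
    if p: "(t, x, u, v) \<in> R" for t x u v
  proof -
    have "u \<in> I" using p region_iff by blast
    note f = f[OF this]
    show "dT \<phi> (t, x, u, v) = - a * \<gamma> * v" "dX \<phi> (t, x, u, v) = \<gamma>" "dU \<phi> (t, x, u, v) = f' u"
      "dV \<phi> (t, x, u, v) = E0 - a * \<gamma> * t"
      "dT \<psi> (t, x, u, v) = - c * \<gamma> - a * \<gamma> * u" "dX \<psi> (t, x, u, v) = 0"
      "dU \<psi> (t, x, u, v) = E0 - a * \<gamma> * t" "dV \<psi> (t, x, u, v) = G"
      by (rule ex[OF _ p], assumption, (auto intro!: derivative_eq_intros f)[1])+
  qed
  have const: "pd h (dX \<phi>) = (\<lambda>_. 0)" "pd h (dX \<psi>) = (\<lambda>_. 0)" "pd h (dV \<psi>) = (\<lambda>_. 0)" for h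
    by (rule pd_of_constant[of _ \<gamma>] pd_of_constant[of _ 0] pd_of_constant[of _ G]; force simp: p1)+
  have V: "dT (dV \<phi>) (t, x, u, v) = - a * \<gamma>" "dT (dU \<psi>) (t, x, u, v) = - a * \<gamma>"
    "dX (dV \<phi>) (t, x, u, v) = 0" "dX (dU \<psi>) (t, x, u, v) = 0"
    "dU (dV \<phi>) (t, x, u, v) = 0" "dU (dU \<psi>) (t, x, u, v) = 0"
    "dV (dV \<phi>) (t, x, u, v) = 0" "dV (dU \<psi>) (t, x, u, v) = 0"
    if p: "(t, x, u, v) \<in> R" for t x u v
  proof -
    note ex = pd_explicit[OF smooth_on_pd[OF \<phi>], where g = "\<lambda>t x u v. E0 - a * \<gamma> * t", OF p1(4) p]
      pd_explicit[OF smooth_on_pd[OF \<psi>], where g = "\<lambda>t x u v. E0 - a * \<gamma> * t", OF p1(7) p]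
    show "dT (dV \<phi>) (t, x, u, v) = - a * \<gamma>" "dT (dU \<psi>) (t, x, u, v) = - a * \<gamma>"
      "dX (dV \<phi>) (t, x, u, v) = 0" "dX (dU \<psi>) (t, x, u, v) = 0"
      "dU (dV \<phi>) (t, x, u, v) = 0" "dU (dU \<psi>) (t, x, u, v) = 0"
      "dV (dV \<phi>) (t, x, u, v) = 0" "dV (dU \<psi>) (t, x, u, v) = 0"
      by (rule ex, assumption, (auto intro!: derivative_eq_intros)[1])+
  qed
  have aff\<psi>: "affine_in_uv \<psi>"
    unfolding affine_in_uv_def using const V by (auto intro!: pd_zeroI)
  have f'_const: "\<exists>B. \<forall>u\<in>I. f' u = B" if "\<epsilon> \<noteq> 0 \<or> \<kappa> \<noteq> 0"
  proof (cases "\<epsilon> = 0")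
    case True
    have "\<kappa> * f' u = lam * G" if "u \<in> I" for u using prof that unfolding profile_def by blast
    moreover have "\<kappa> \<noteq> 0" using True that by simp
    ultimately have "f' u = lam * G / \<kappa>" if "u \<in> I" for u
      using that by (simp add: nonzero_eq_divide_eq mult.commute)
    then show ?thesis by blast
  qed (use prof in \<open>simp add: profile_def\<close>)
  have U: "pd h (dU \<phi>) = (\<lambda>_. 0)" if nz: "\<epsilon> \<noteq> 0 \<or> \<kappa> \<noteq> 0" for h
  proof -
    obtain B where "\<forall>u\<in>I. f' u = B" using f'_const[OF nz] by blast
    then have "dU \<phi> p = B" if "p \<in> R" for p
      using that p1(3) by (cases p) (auto simp: region_iff)
    then show ?thesis by (rule pd_of_constant)
  qed
  have aff\<phi>: "affine_in_uv \<phi>" if "\<epsilon> \<noteq> 0 \<or> \<kappa> \<noteq> 0"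
    unfolding affine_in_uv_def using U[OF that] V by (auto intro!: pd_zeroI)
  obtain t x u v where p: "base_pt z = (t, x, u, v)" by (cases "base_pt z")
  then have zc: "z (Der U 0 0) = u" "z (Der V 0 0) = v" by (simp_all add: base_pt_def)
  have pR: "(t, x, u, v) \<in> R" and u: "u \<in> I" using z(1) p region_iff by simp_all
  define E where "E = E0 - a * \<gamma> * t"
  have Dxxx\<phi>: "\<kappa> * Dxxx \<phi> z = \<kappa> * (z (Der U 0 3) * f' u + z (Der V 0 3) * E)"
    using affine_in_uv_jets(1)[OF \<phi> aff\<phi>] by (cases "\<kappa> = 0") (auto simp: p p1[OF pR] const E_def)
  have Dtx\<phi>: "\<epsilon> * Dtxx \<phi> z = \<epsilon> * (z (Der U 1 2) * f' u + z (Der V 1 2) * E - a * \<gamma> * z (Der V 0 2))"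
    using affine_in_uv_jets(2)[OF \<phi> aff\<phi>] U
    by (cases "\<epsilon> = 0") (auto simp: p p1[OF pR] const V[OF pR] E_def)
  have Dxxx\<psi>: "Dxxx \<psi> z = z (Der U 0 3) * E + z (Der V 0 3) * G"
    using affine_in_uv_jets(1)[OF \<psi> aff\<psi>] by (auto simp: p p1[OF pR] const E_def)
  have Dtx\<psi>: "Dtxx \<psi> z = z (Der U 1 2) * E + z (Der V 1 2) * G - a * \<gamma> * z (Der U 0 2)"
    using affine_in_uv_jets(2)[OF \<psi> aff\<psi>]
    by (auto simp: p p1[OF pR] const V[OF pR] E_def)
  have h: "(a * u + c) * f' u - b * f u - (b * u + c) * G = 0" "\<kappa> * f' u - lam * G = 0"
    using prof u by (simp_all add: profile_def)
  have k: "b * \<gamma> = 0" "b * E = 0" "\<epsilon> * E - \<sigma> * E = 0" "\<epsilon> * \<gamma> = 0" "\<sigma> * \<gamma> = 0"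
    using comp by (auto simp: compatible_def E_def algebra_simps)
  have F: "z (Der U 1 0) + (a + b) * v * z (Der U 0 1) + (a * u + c) * z (Der V 0 1)
      + \<epsilon> * z (Der U 1 2) + \<kappa> * z (Der V 0 3) = 0" (is "?F1 = 0")
    "z (Der V 1 0) + (b * u + c) * z (Der U 0 1) + (a + b) * v * z (Der V 0 1)
      + lam * z (Der U 0 3) + \<sigma> * z (Der V 1 2) = 0" (is "?F2 = 0")
    using z(2,3) by (simp_all add: sys_F1_def sys_F2_def zc)
  have "adj1 \<phi> \<psi> z = f' u * ?F1 + E * ?F2
    + (v + x * z (Der V 0 1)) * (b * \<gamma>) + v * z (Der V 0 1) * (b * E)
    - z (Der V 0 1) * ((a * u + c) * f' u - b * f u - (b * u + c) * G)
    + z (Der V 1 2) * (\<epsilon> * E - \<sigma> * E) - a * z (Der V 0 2) * (\<epsilon> * \<gamma>)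
    - z (Der V 0 3) * (\<kappa> * f' u - lam * G)"
    unfolding adj1_def Dtx\<phi> Dxxx\<psi> p zc Dt_def Dx_def p1[OF pR] \<phi>_eq[OF pR] E_def[symmetric]
    by (simp add: algebra_simps)
  then show "adj1 \<phi> \<psi> z = 0" unfolding F h k by simp
  have "adj2 \<phi> \<psi> z = E * ?F1 + G * ?F2 - x * z (Der U 0 1) * (b * \<gamma>) - v * z (Der U 0 1) * (b * E)
    + z (Der U 0 1) * ((a * u + c) * f' u - b * f u - (b * u + c) * G)
    - z (Der U 1 2) * (\<epsilon> * E - \<sigma> * E) - a * z (Der U 0 2) * (\<sigma> * \<gamma>)
    + z (Der U 0 3) * (\<kappa> * f' u - lam * G)"
    unfolding adj2_def Dxxx\<phi> Dtx\<psi> p zc Dt_def Dx_def p1[OF pR] \<phi>_eq[OF pR] E_def[symmetric]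
    by (simp add: algebra_simps)
  then show "adj2 \<phi> \<psi> z = 0" unfolding F h k by simp
qed

text \<open>The general solution, uniform in the parameters: what remains to be solved is the linear
  first-order equation for \<open>f\<close>.\<close>

lemma self_adjoint_subst_iff:
  assumes "(\<epsilon>, \<kappa>, lam, \<sigma>) \<noteq> (0, 0, 0, 0)"
  shows "self_adjoint_subst R F1 F2 \<phi> \<psi> \<longleftrightarrow> (\<exists>p\<in>R. \<phi> p \<noteq> 0 \<or> \<psi> p \<noteq> 0) \<and>
    (\<exists>\<gamma> E0 D0 G f f'. compatible \<gamma> E0 \<and> profile G f f' \<and> substitution_form \<gamma> E0 D0 G f \<phi> \<psi>)"
    (is "?L \<longleftrightarrow> ?N \<and> ?F")
proof
  assume L: ?L
  then interpret adjoint_pair a b c \<epsilon> \<kappa> lam \<sigma> \<phi> \<psi>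
    by unfold_locales (use assms in \<open>auto simp: self_adjoint_subst_iff_adj\<close>)
  obtain \<gamma> E0 D0 G f where bg: "b * \<gamma> = 0" "b * E0 = 0"
    and d: "\<And>p. p \<in> R \<Longrightarrow> dX \<phi> p = \<gamma>" "\<And>p. p \<in> R \<Longrightarrow> dV \<psi> p = G"
    "\<And>t x u v. (t, x, u, v) \<in> R \<Longrightarrow> dV \<phi> (t, x, u, v) = E0 - a * \<gamma> * t"
    and form: "\<And>t x u v. (t, x, u, v) \<in> R \<Longrightarrow> \<phi> (t, x, u, v) = \<gamma> * x + f u + (E0 - a * \<gamma> * t) * v"
    "\<And>t x u v. (t, x, u, v) \<in> R \<Longrightarrow>
       \<psi> (t, x, u, v) = D0 - c * \<gamma> * t + (E0 - a * \<gamma> * t) * u + G * v"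
    by (rule explicit_form) blast
  define f' where "f' u = dU \<phi> (0, 0, u, 0)" for u
  have I: "(0, 0, u, 0) \<in> R" if "u \<in> I" for u using that region_iff by blast
  have f: "(f has_real_derivative f' u) (at u)" if "u \<in> I" for u
  proof (rule DERIV_cong_ev[THEN iffD1, OF refl _ refl DERIV_U[OF \<phi> I[OF that], folded f'_def]])
    show "\<forall>\<^sub>F s in nhds u. \<phi> (0, 0, s, 0) = f s"
      using eventually_U[OF I[OF that]] by (rule eventually_mono) (simp add: form)
  qed
  have "profile G f f'"
    unfolding profile_def
  proof (intro conjI ballI impI)
    fix u assume u: "u \<in> I"
    show "(f has_real_derivative f' u) (at u)" by (rule f[OF u])
    show "(a * u + c) * f' u = b * f u + (b * u + c) * G"
      using phi_L[OF I[OF u]] form(1)[OF I[OF u]] d(2)[OF I[OF u]] by (simp add: f'_def)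
    show "\<kappa> * f' u = lam * G"
      using determining_equations(5)[OF I[OF u]] d(2)[OF I[OF u]] by (simp add: f'_def)
  next
    assume "\<epsilon> \<noteq> 0"
    then have "affine_in_uv \<phi>" by (intro affine_cases) simp
    then have "dU (dU \<phi>) = (\<lambda>_. 0)" "dX (dU \<phi>) = (\<lambda>_. 0)" by (simp_all add: affine_in_uv_def)
    then have 0: "(f' has_real_derivative 0) (at u within I)" if "u \<in> I" for u
      using DERIV_U[OF smooth_on_pd[OF \<phi>] I[OF that], of "(0,0,1,0)"]
      by (simp add: f'_def[abs_def] has_field_derivative_at_within)
    from has_field_derivative_zero_constant[OF convex_I 0]
    show "\<exists>B. \<forall>u\<in>I. f' u = B" .
  qed
  moreover have "compatible \<gamma> E0"
  proof -
    obtain u0 where u0: "u0 \<in> I" by (rule I_nonempty)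
    have p: "(t, 0, u0, 0) \<in> R" for t using u0 region_iff by blast
    have TV: "dT (dV \<phi>) (0, 0, u0, 0) = - a * \<gamma>"
      using bg d(1)[OF p] by (simp add: phi_TV algebra_simps)
    have a: "\<gamma> = 0" if "a * \<gamma> = 0" using that bg ab_c by (cases "a = 0") auto
    have "\<epsilon> * E0 = \<sigma> * E0" using determining_equations(3)[OF p] d(3)[OF p] by fastforce
    moreover have "\<epsilon> * (E0 - a * \<gamma>) = \<sigma> * (E0 - a * \<gamma>)"
      using determining_equations(3)[OF p] d(3)[OF p] by fastforce
    moreover have "\<epsilon> * (a * \<gamma>) = 0" "\<sigma> * (a * \<gamma>) = 0"
      using determining_equations(6,7)[OF p[of 0]] TV by (simp_all add: psi_second X_second psi_U)
    ultimately show ?thesis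
      using bg a by (auto simp: compatible_def)
  qed
  moreover have "substitution_form \<gamma> E0 D0 G f \<phi> \<psi>"
    using form by (auto simp: substitution_form_def)
  ultimately have ?F by blast
  then show "?N \<and> ?F" using L by (simp add: self_adjoint_subst_def)
next
  assume R: "?N \<and> ?F"
  then obtain \<gamma> E0 D0 G f f' where comp: "compatible \<gamma> E0" and prof: "profile G f f'"
    and form: "substitution_form \<gamma> E0 D0 G f \<phi> \<psi>" by blast
  show ?L
    unfolding self_adjoint_subst_iff_adj
    using R smooth_substitution_form[OF prof form] substitution_form_solves_adjoint[OF prof comp form] by simp
qed

section \<open>Solving the ordinary differential equation\<close>

lemma constant_on_I:
  assumes "\<And>u. u \<in> I \<Longrightarrow> (g has_real_derivative 0) (at u)"
  shows "\<exists>k. \<forall>u\<in>I. g u = k"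
  by (rule has_field_derivative_zero_constant[OF convex_I])
    (rule has_field_derivative_at_within[OF assms])

lemma open_I: "open I"
proof (cases "a = 0")
  case False
  then have "I = {u. - c < a * u}" by auto
  then show ?thesis by (simp only: open_Collect_less continuous_intros)
qed simp

lemma profileI:
  assumes "\<And>u. u \<in> I \<Longrightarrow> f u = g u" "\<And>u. u \<in> I \<Longrightarrow> (g has_real_derivative g' u) (at u)"
    and "\<And>u. u \<in> I \<Longrightarrow> (a * u + c) * g' u = b * g u + (b * u + c) * G"
    and "\<And>u. u \<in> I \<Longrightarrow> \<kappa> * g' u = lam * G" "\<epsilon> \<noteq> 0 \<Longrightarrow> \<exists>B. \<forall>u\<in>I. g' u = B"
  shows "profile G f g'"
proof -
  have "(f has_real_derivative g' u) (at u)" if "u \<in> I" for u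
    by (rule has_field_derivative_transform_within_open[OF assms(2)[OF that] open_I that])
      (simp only: assms(1))
  moreover have "(a * u + c) * g' u = b * f u + (b * u + c) * G" if "u \<in> I" for u
    unfolding assms(1)[OF that] by (rule assms(3)[OF that])
  ultimately show ?thesis
    unfolding profile_def using assms(4,5) by blast
qed

lemma profileD:
  assumes "profile G f f'" "u \<in> I"
  shows "(f has_real_derivative f' u) (at u)"
    and "(a * u + c) * f' u = b * f u + (b * u + c) * G"
    and "\<kappa> * f' u = lam * G"
  using assms unfolding profile_def by blast+

text \<open>If \<open>\<kappa> \<noteq> 0\<close>, then \<open>f' = \<lambda> G / \<kappa>\<close>. So whenever \<open>\<epsilon>\<close> or \<open>\<kappa>\<close> is nonzero, only affine profiles survive; this
  removes the transcendental terms of the solutions.\<close>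

lemma profile_rigid:
  assumes "profile G f f'" "(\<epsilon>, \<kappa>) \<noteq> (0, 0)" "u \<in> I" "w \<in> I"
  shows "f' u = f' w"
proof (cases "\<kappa> = 0")
  case True
  then show ?thesis using assms unfolding profile_def by force
next
  case False
  then show ?thesis using profileD(3)[OF assms(1)] assms(3,4) by (metis mult_left_cancel)
qed

text \<open>For \<open>b = 0\<close> the equation is \<open>(a u + c) f' = c G\<close>. In this and the following lemmas the function
  shown to be constant is what is left of \<open>f\<close> after subtracting a particular solution and dividing by a
  solution of the homogeneous equation.\<close>

lemma profile_b_zero:
  assumes b: "b = 0"
  shows "(\<exists>f'. profile G f f') \<longleftrightarrow> (\<exists>c3 c4. G = c3 * a \<and> (\<forall>u\<in>I. f u = c3 * c * ln (a * u + c) + c4) \<and>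
    ((\<epsilon>, \<kappa>, lam) \<noteq> (0, 0, 0) \<longrightarrow> c3 = 0))" (is "?L \<longleftrightarrow> ?R")
proof
  have ac: "a \<noteq> 0" "c \<noteq> 0" using ab_c b by auto
  { assume ?L
    then obtain f' where p: "profile G f f'" by blast
    have f': "f' u = c * G / (a * u + c)" if "u \<in> I" for u
      using profileD(2)[OF p that] au_c_nonzero[OF that] b by (simp add: field_simps)
    have "((\<lambda>u. f u - G / a * c * ln (a * u + c)) has_real_derivative 0) (at u)" if u: "u \<in> I" for u
    proof -
      have "a * u + c > 0" using u ac by simp
      then show ?thesis
        using ac by (auto intro!: derivative_eq_intros profileD(1)[OF p u] simp: f'[OF u] field_simps)
    qed
    from constant_on_I[OF this] obtain c4 where c4: "\<And>u. u \<in> I \<Longrightarrow> f u - G / a * c * ln (a * u + c) = c4"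
      by blast
    \<comment> \<open>two points to compare values at: there \<open>a u + c\<close> is \<open>1\<close> and \<open>2\<close>\<close>
    have pts: "(1 - c) / a \<in> I" "(2 - c) / a \<in> I" using ac by simp_all
    have "G = 0" if nz: "(\<epsilon>, \<kappa>, lam) \<noteq> (0, 0, 0)"
    proof (cases "(\<epsilon>, \<kappa>) = (0, 0)")
      case True
      then show ?thesis using nz profileD(3)[OF p pts(1)] by simp
    next
      case False
      show ?thesis using profile_rigid[OF p False pts] f'[OF pts(1)] f'[OF pts(2)] ac by simp
    qed
    then show ?R using ac c4 by (intro exI[of _ "G / a"] exI[of _ c4]) (auto simp: algebra_simps) }
  { assume ?R
    then obtain c3 c4 where G: "G = c3 * a" and f: "\<And>u. u \<in> I \<Longrightarrow> f u = c3 * c * ln (a * u + c) + c4"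
      and z: "(\<epsilon>, \<kappa>, lam) \<noteq> (0, 0, 0) \<Longrightarrow> c3 = 0" by blast
    have "profile G f (\<lambda>u. c3 * c * a / (a * u + c))"
    proof (rule profileI[OF f])
      fix u assume u: "u \<in> I"
      then have pos: "a * u + c > 0" using ac by simp
      show "((\<lambda>u. c3 * c * ln (a * u + c) + c4) has_real_derivative c3 * c * a / (a * u + c)) (at u)"
        using pos by (auto intro!: derivative_eq_intros simp: field_simps)
      show "(a * u + c) * (c3 * c * a / (a * u + c)) = b * (c3 * c * ln (a * u + c) + c4) + (b * u + c) * G"
        using pos by (simp add: b G)
      show "\<kappa> * (c3 * c * a / (a * u + c)) = lam * G"
        using z by (cases "c3 = 0"; cases "\<kappa> = 0"; cases "lam = 0") (auto simp: G)
    next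
      assume "\<epsilon> \<noteq> 0"
      then show "\<exists>B. \<forall>u\<in>I. c3 * c * a / (a * u + c) = B" using z by auto
    qed
    then show ?L by blast }
qed

text \<open>The resonant case: the right-hand side \<open>(a u + c) G\<close> is itself a multiple of the homogeneous solution
  \<open>a u + c\<close>, which is why a logarithm appears.\<close>

lemma profile_a_eq_b:
  assumes ab: "a = b"
  shows "(\<exists>f'. profile G f f') \<longleftrightarrow> (\<exists>c1 c2. G = c1 * a \<and>
    (\<forall>u\<in>I. f u = (a * u + c) * (c1 * ln (a * u + c) + c2)) \<and>
    ((\<epsilon>, \<kappa>, lam) \<noteq> (0, 0, 0) \<longrightarrow> c1 = 0) \<and> (\<kappa> \<noteq> 0 \<longrightarrow> c2 = 0))" (is "?L \<longleftrightarrow> ?R")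
proof
  have ac: "a \<noteq> 0" "c \<noteq> 0" using ab_c ab by auto
  { assume ?L
    then obtain f' where p: "profile G f f'" by blast
    have f': "f' u = a * f u / (a * u + c) + G" if "u \<in> I" for u
      using profileD(2)[OF p that] au_c_nonzero[OF that] by (simp add: ab[symmetric] field_simps)
    have "((\<lambda>u. f u / (a * u + c) - G / a * ln (a * u + c)) has_real_derivative 0) (at u)"
      if u: "u \<in> I" for u
    proof -
      have pos: "a * u + c > 0" using u ac by simp
      then have "((\<lambda>u. f u / (a * u + c) - G / a * ln (a * u + c)) has_real_derivative
        (f' u * (a * u + c) - f u * a) / ((a * u + c) * (a * u + c)) - G / a * (a / (a * u + c))) (at u)"
        by (auto intro!: derivative_eq_intros profileD(1)[OF p u])
      moreover have "f' u * (a * u + c) - f u * a = G * (a * u + c)"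
        using profileD(2)[OF p u] by (simp add: ab[symmetric] algebra_simps)
      ultimately show ?thesis using pos ac by simp
    qed
    from constant_on_I[OF this] obtain c2 where c2: "\<And>u. u \<in> I \<Longrightarrow> f u / (a * u + c) - G / a * ln (a * u + c) = c2"
      by blast
    have f: "f u = (a * u + c) * (G / a * ln (a * u + c) + c2)" if "u \<in> I" for u
      using c2[OF that] au_c_nonzero[OF that] by (simp add: field_simps)
    have f'': "f' u = a * (G / a * ln (a * u + c) + c2) + G" if "u \<in> I" for u
      using f'[OF that] f[OF that] au_c_nonzero[OF that] by simp
    \<comment> \<open>two points to compare values at: there \<open>a u + c\<close> is \<open>1\<close> and \<open>2\<close>\<close>
    have pts: "(1 - c) / a \<in> I" "(2 - c) / a \<in> I" using ac by simp_all
    have G: "G = 0" if nz: "(\<epsilon>, \<kappa>, lam) \<noteq> (0, 0, 0)"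
    proof (cases "(\<epsilon>, \<kappa>) = (0, 0)")
      case True
      then show ?thesis using nz profileD(3)[OF p pts(1)] by simp
    next
      case False
      show ?thesis using profile_rigid[OF p False pts] f''[OF pts(1)] f''[OF pts(2)] ac by simp
    qed
    have "c2 = 0" if "\<kappa> \<noteq> 0"
      using G profileD(3)[OF p pts(1)] f''[OF pts(1)] that ac by simp
    then show ?R using ac f G by (intro exI[of _ "G / a"] exI[of _ c2]) simp }
  { assume ?R
    then obtain c1 c2 where G: "G = c1 * a"
      and f: "\<And>u. u \<in> I \<Longrightarrow> f u = (a * u + c) * (c1 * ln (a * u + c) + c2)"
      and z: "(\<epsilon>, \<kappa>, lam) \<noteq> (0, 0, 0) \<Longrightarrow> c1 = 0" "\<kappa> \<noteq> 0 \<Longrightarrow> c2 = 0" by blast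
    have "profile G f (\<lambda>u. a * (c1 * ln (a * u + c) + c2) + c1 * a)"
    proof (rule profileI[OF f])
      fix u assume u: "u \<in> I"
      then have pos: "a * u + c > 0" using ac by simp
      have "((\<lambda>u. (a * u + c) * (c1 * ln (a * u + c) + c2)) has_real_derivative
          a * (c1 * ln (a * u + c) + c2) + (a * u + c) * (c1 * (a / (a * u + c)))) (at u)"
        using pos by (auto intro!: derivative_eq_intros)
      then show "((\<lambda>u. (a * u + c) * (c1 * ln (a * u + c) + c2)) has_real_derivative
          a * (c1 * ln (a * u + c) + c2) + c1 * a) (at u)"
        using pos by simp
      show "(a * u + c) * (a * (c1 * ln (a * u + c) + c2) + c1 * a)
          = b * ((a * u + c) * (c1 * ln (a * u + c) + c2)) + (b * u + c) * G"
        by (simp add: ab[symmetric] G algebra_simps)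
      show "\<kappa> * (a * (c1 * ln (a * u + c) + c2) + c1 * a) = lam * G"
        using z by (cases "\<kappa> = 0"; cases "lam = 0") (auto simp: G)
    next
      assume "\<epsilon> \<noteq> 0"
      then show "\<exists>B. \<forall>u\<in>I. a * (c1 * ln (a * u + c) + c2) + c1 * a = B" using z by auto
    qed
    then show ?L by blast }
qed

text \<open>The equation \<open>c f' = b f + (b u + c) G\<close> has constant coefficients, and
  \<open>- (G / b) (b u + 2 c)\<close> is its affine solution.\<close>

lemma profile_a_zero:
  assumes a: "a = 0"
  shows "(\<exists>f'. profile G f f') \<longleftrightarrow> (\<exists>c1 c2. G = c2 * b \<and>
    (\<forall>u\<in>I. f u = c1 * exp (b * u / c) - c2 * (b * u + 2 * c)) \<and>
    ((\<epsilon>, \<kappa>) \<noteq> (0, 0) \<longrightarrow> c1 = 0) \<and> (\<kappa> \<noteq> - lam \<longrightarrow> c2 = 0))" (is "?L \<longleftrightarrow> ?R")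
proof
  have bc: "b \<noteq> 0" "c \<noteq> 0" using ab_c a by auto
  have UI: "u \<in> I" for u by (simp add: a)
  { assume ?L
    then obtain f' where p: "profile G f f'" by blast
    have f': "f' u = (b * f u + (b * u + c) * G) / c" for u
      using profileD(2)[OF p UI] bc by (simp add: a field_simps)
    have "((\<lambda>u. exp (- (b * u / c)) * (f u + G / b * (b * u + 2 * c))) has_real_derivative 0) (at u)" for u
    proof -
      have "((\<lambda>u. exp (- (b * u / c)) * (f u + G / b * (b * u + 2 * c))) has_real_derivative
        exp (- (b * u / c)) * (- (b / c)) * (f u + G / b * (b * u + 2 * c)) + exp (- (b * u / c)) * (f' u + G)) (at u)"
        using bc by (auto intro!: derivative_eq_intros profileD(1)[OF p UI])
      moreover have "(- (b / c)) * (f u + G / b * (b * u + 2 * c)) + (f' u + G) = 0"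
        using bc by (simp add: f' field_simps)
      then have "exp (- (b * u / c)) * (- (b / c)) * (f u + G / b * (b * u + 2 * c)) + exp (- (b * u / c)) * (f' u + G) = 0"
        by (metis distrib_left mult.assoc mult_zero_right)
      ultimately show ?thesis by simp
    qed
    from constant_on_I[OF this] obtain c1 where c1: "\<And>u. u \<in> I \<Longrightarrow> exp (- (b * u / c)) * (f u + G / b * (b * u + 2 * c)) = c1"
      by blast
    have f: "f u = c1 * exp (b * u / c) - G / b * (b * u + 2 * c)" for u
      using c1[OF UI, of u] by (simp add: exp_minus field_simps)
    have f'': "f' u = b / c * c1 * exp (b * u / c) - G" for u
      using bc by (simp add: f' f field_simps)
    have c1: "c1 = 0" if "(\<epsilon>, \<kappa>) \<noteq> (0, 0)"
      using profile_rigid[OF p that UI UI, of 0 "c / b"] f''[of 0] f''[of "c / b"] bc by simp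
    have "G = 0" if "\<kappa> \<noteq> - lam"
    proof -
      have "\<kappa> * c1 = 0" using c1 by auto
      then have "(\<kappa> + lam) * G = 0"
        using profileD(3)[OF p UI, of 0] by (auto simp: f'' algebra_simps)
      then show ?thesis using that by simp
    qed
    then show ?R using bc f c1 by (intro exI[of _ c1] exI[of _ "G / b"]) simp }
  { assume ?R
    then obtain c1 c2 where G: "G = c2 * b"
      and f: "\<And>u. u \<in> I \<Longrightarrow> f u = c1 * exp (b * u / c) - c2 * (b * u + 2 * c)"
      and z: "(\<epsilon>, \<kappa>) \<noteq> (0, 0) \<Longrightarrow> c1 = 0" "\<kappa> \<noteq> - lam \<Longrightarrow> c2 = 0" by blast
    have "profile G f (\<lambda>u. c1 * (b / c) * exp (b * u / c) - c2 * b)"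
    proof (rule profileI[OF f])
      fix u
      show "((\<lambda>u. c1 * exp (b * u / c) - c2 * (b * u + 2 * c)) has_real_derivative
          c1 * (b / c) * exp (b * u / c) - c2 * b) (at u)"
        using bc by (auto intro!: derivative_eq_intros)
      show "(a * u + c) * (c1 * (b / c) * exp (b * u / c) - c2 * b)
          = b * (c1 * exp (b * u / c) - c2 * (b * u + 2 * c)) + (b * u + c) * G"
        using bc by (simp add: a G field_simps)
      have "\<kappa> * c1 = 0" using z(1) by auto
      moreover have "\<kappa> * c2 = - lam * c2" using z(2) by (cases "\<kappa> = - lam") auto
      ultimately have "\<kappa> * c1 * ((b / c) * exp (b * u / c)) - \<kappa> * c2 * b = lam * c2 * b" by simp
      then show "\<kappa> * (c1 * (b / c) * exp (b * u / c) - c2 * b) = lam * G"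
        by (simp add: G algebra_simps)
    next
      assume "\<epsilon> \<noteq> 0"
      then show "\<exists>B. \<forall>u\<in>I. c1 * (b / c) * exp (b * u / c) - c2 * b = B" using z by auto
    qed
    then show ?L by blast }
qed

text \<open>For \<open>a \<noteq> b\<close> there is an affine solution, and the homogeneous solution \<open>(a u + c)\<^sup>b\<^sup>/\<^sup>a\<close> is not affine
  since \<open>b / a \<noteq> 0, 1\<close>.\<close>

lemma profile_generic:
  assumes ab: "a \<noteq> 0" "b \<noteq> 0" "a \<noteq> b"
  shows "(\<exists>f'. profile G f f') \<longleftrightarrow> (\<exists>c1 c2. G = c2 * (a - b) * b \<and>
    (\<forall>u\<in>I. f u = c1 * (a * u + c) powr (b / a) + c2 * (b\<^sup>2 * u + (2 * b - a) * c)) \<and>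
    ((\<epsilon>, \<kappa>) \<noteq> (0, 0) \<longrightarrow> c1 = 0) \<and> (lam * a \<noteq> (\<kappa> + lam) * b \<longrightarrow> c2 = 0))" (is "?L \<longleftrightarrow> ?R")
proof
  { assume ?L
    then obtain f' where p: "profile G f f'" by blast
    define k where "k = G / ((a - b) * b)"
    have G: "G = k * (a - b) * b" using ab by (simp add: k_def)
    have f': "f' u = (b * f u + (b * u + c) * G) / (a * u + c)" if "u \<in> I" for u
      using profileD(2)[OF p that] au_c_nonzero[OF that] by (simp add: field_simps)
    have "((\<lambda>u. (a * u + c) powr (- (b / a)) * (f u - k * (b\<^sup>2 * u + (2 * b - a) * c))) has_real_derivative 0) (at u)"
      if u: "u \<in> I" for u
    proof -
      have pos: "a * u + c > 0" using u ab by simp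
      let ?p = "(a * u + c) powr (- (b / a))"
      let ?r = "f u - k * (b\<^sup>2 * u + (2 * b - a) * c)"
      have "((\<lambda>u. (a * u + c) powr (- (b / a))) has_real_derivative - (b / a) * (a * u + c) powr (- (b / a) - 1) * a) (at u)"
        using pos by (auto intro!: derivative_eq_intros)
      then have D: "((\<lambda>u. (a * u + c) powr (- (b / a))) has_real_derivative ?p * (- b / (a * u + c))) (at u)"
        using ab pos by (simp add: powr_diff mult.commute)
      have "((\<lambda>u. (a * u + c) powr (- (b / a)) * (f u - k * (b\<^sup>2 * u + (2 * b - a) * c))) has_real_derivative
         ?p * (- b / (a * u + c)) * ?r + (f' u - k * b\<^sup>2) * ?p) (at u)"
        by (rule DERIV_mult[OF D]) (auto intro!: derivative_eq_intros profileD(1)[OF p u])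
      moreover have "- b / (a * u + c) * ?r + (f' u - k * b\<^sup>2) = 0"
        using pos by (simp add: f'[OF u] G field_simps power2_eq_square)
      then have "?p * (- b / (a * u + c)) * ?r + (f' u - k * b\<^sup>2) * ?p = ?p * 0"
        by (simp only: mult.assoc mult.commute[of _ ?p] distrib_left[symmetric])
      ultimately show ?thesis by simp
    qed
    from constant_on_I[OF this] obtain c1 where c1: "\<And>u. u \<in> I \<Longrightarrow> (a * u + c) powr (- (b / a)) * (f u - k * (b\<^sup>2 * u + (2 * b - a) * c)) = c1"
      by blast
    have f: "f u = c1 * (a * u + c) powr (b / a) + k * (b\<^sup>2 * u + (2 * b - a) * c)" if u: "u \<in> I" for u
    proof -
      have "a * u + c > 0" using u ab by simp
      then show ?thesis using c1[OF u] by (simp add: powr_minus field_simps)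
    qed
    have f'': "f' u = c1 * b * (a * u + c) powr (b / a - 1) + k * b\<^sup>2" if u: "u \<in> I" for u
    proof -
      have "a * u + c > 0" using u ab by simp
      then show ?thesis by (simp add: f'[OF u] f[OF u] G powr_diff field_simps power2_eq_square)
    qed
    \<comment> \<open>two points to compare values at: there \<open>a u + c\<close> is \<open>1\<close> and \<open>2\<close>\<close>
    have pts: "(1 - c) / a \<in> I" "(2 - c) / a \<in> I" using ab by simp_all
    have c1: "c1 = 0" if "(\<epsilon>, \<kappa>) \<noteq> (0, 0)"
    proof -
      have e: "a * ((1 - c) / a) + c = 1" "a * ((2 - c) / a) + c = 2" using ab by simp_all
      have "c1 * b * 1 + k * b\<^sup>2 = c1 * b * 2 powr (b / a - 1) + k * b\<^sup>2"
        using profile_rigid[OF p that pts] unfolding f''[OF pts(1)] f''[OF pts(2)] e powr_one_eq_one .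
      then have "c1 * b * (2 powr (b / a - 1) - 1) = 0" by (simp only: right_diff_distrib)
      moreover have "(2::real) powr (b / a - 1) \<noteq> 1" using ab by simp
      ultimately show ?thesis using ab by simp
    qed
    have "k = 0" if "lam * a \<noteq> (\<kappa> + lam) * b"
    proof -
      have "\<kappa> * c1 = 0" using c1 by auto
      then have "b * k * (lam * a - (\<kappa> + lam) * b) = 0"
        using profileD(3)[OF p pts(1)] unfolding f''[OF pts(1)] G power2_eq_square by algebra
      then show ?thesis using that ab by simp
    qed
    then show ?R using G f c1 by (intro exI[of _ c1] exI[of _ k]) simp }
  { assume ?R
    then obtain c1 c2 where G: "G = c2 * (a - b) * b"
      and f: "\<And>u. u \<in> I \<Longrightarrow> f u = c1 * (a * u + c) powr (b / a) + c2 * (b\<^sup>2 * u + (2 * b - a) * c)"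
      and z: "(\<epsilon>, \<kappa>) \<noteq> (0, 0) \<Longrightarrow> c1 = 0" "lam * a \<noteq> (\<kappa> + lam) * b \<Longrightarrow> c2 = 0" by blast
    have "profile G f (\<lambda>u. c1 * b * (a * u + c) powr (b / a - 1) + c2 * b\<^sup>2)"
    proof (rule profileI[OF f])
      fix u assume u: "u \<in> I"
      then have pos: "a * u + c > 0" using ab by simp
      show "((\<lambda>u. c1 * (a * u + c) powr (b / a) + c2 * (b\<^sup>2 * u + (2 * b - a) * c)) has_real_derivative
          c1 * b * (a * u + c) powr (b / a - 1) + c2 * b\<^sup>2) (at u)"
        using pos ab by (auto intro!: derivative_eq_intros)
      show "(a * u + c) * (c1 * b * (a * u + c) powr (b / a - 1) + c2 * b\<^sup>2)
          = b * (c1 * (a * u + c) powr (b / a) + c2 * (b\<^sup>2 * u + (2 * b - a) * c)) + (b * u + c) * G"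
        using pos by (simp add: G powr_diff field_simps power2_eq_square)
      have "\<kappa> * c1 = 0" "c2 * (lam * a) = c2 * ((\<kappa> + lam) * b)" using z by auto
      then show "\<kappa> * (c1 * b * (a * u + c) powr (b / a - 1) + c2 * b\<^sup>2) = lam * G"
        unfolding G power2_eq_square by algebra
    next
      assume "\<epsilon> \<noteq> 0"
      then show "\<exists>B. \<forall>u\<in>I. c1 * b * (a * u + c) powr (b / a - 1) + c2 * b\<^sup>2 = B" using z by auto
    qed
    then show ?L by blast }
qed

lemma region_ball: "(\<forall>(t, x, u, v)\<in>R. Q t x u v) \<longleftrightarrow> (\<forall>t x v. \<forall>u\<in>I. Q t x u v)"
  by (auto simp: region_def)

section \<open>The substitutions in the individual cases\<close>

text \<open>This is the only case in which \<open>\<gamma>\<close> and \<open>E0\<close> need not vanish; they are \<open>- c\<^sub>1\<close> and \<open>a c\<^sub>2\<close>.\<close>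

lemma self_adjoint_subst_iff_b_zero:
  assumes nz: "(\<epsilon>, \<kappa>, lam, \<sigma>) \<noteq> (0, 0, 0, 0)" and b: "b = 0"
  shows "self_adjoint_subst R F1 F2 \<phi> \<psi> \<longleftrightarrow> (\<exists>p\<in>R. \<phi> p \<noteq> 0 \<or> \<psi> p \<noteq> 0) \<and>
    (\<exists>c1 c2 c3 c4 c5 :: real.
      ((\<epsilon>, \<sigma>) \<noteq> (0, 0) \<longrightarrow> c1 = 0) \<and>
      (\<epsilon> \<noteq> \<sigma> \<longrightarrow> c2 = 0) \<and>
      ((\<epsilon>, \<kappa>, lam) \<noteq> (0, 0, 0) \<longrightarrow> c3 = 0) \<and>
      (\<forall>(t, x, u, v)\<in>R.
        \<phi> (t, x, u, v) = (c1 * t + c2) * a * v + c3 * c * ln (a * u + c) - c1 * x + c4 \<and>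
        \<psi> (t, x, u, v) = c3 * a * v + (c1 * t + c2) * (a * u + c) + c5))"
proof -
  have a: "a \<noteq> 0" using ab_c b by auto
  have "(\<exists>\<gamma> E0 D0 G f f'. compatible \<gamma> E0 \<and> profile G f f' \<and> substitution_form \<gamma> E0 D0 G f \<phi> \<psi>)
    \<longleftrightarrow> (\<exists>c1 c2 c3 c4 c5 :: real.
      ((\<epsilon>, \<sigma>) \<noteq> (0, 0) \<longrightarrow> c1 = 0) \<and>
      (\<epsilon> \<noteq> \<sigma> \<longrightarrow> c2 = 0) \<and>
      ((\<epsilon>, \<kappa>, lam) \<noteq> (0, 0, 0) \<longrightarrow> c3 = 0) \<and>
      (\<forall>(t, x, u, v)\<in>R.
        \<phi> (t, x, u, v) = (c1 * t + c2) * a * v + c3 * c * ln (a * u + c) - c1 * x + c4 \<and>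
        \<psi> (t, x, u, v) = c3 * a * v + (c1 * t + c2) * (a * u + c) + c5))" (is "?L \<longleftrightarrow> ?R")
  proof
    assume ?L
    then obtain \<gamma> E0 D0 G f f' where comp: "compatible \<gamma> E0" and p: "profile G f f'"
      and form: "substitution_form \<gamma> E0 D0 G f \<phi> \<psi>" by blast
    from p obtain c3 c4 where G: "G = c3 * a" and f: "\<forall>u\<in>I. f u = c3 * c * ln (a * u + c) + c4"
      and z: "(\<epsilon>, \<kappa>, lam) \<noteq> (0, 0, 0) \<longrightarrow> c3 = 0"
      using profile_b_zero[OF b] by blast
    obtain e where e: "E0 = a * e" using a by (metis nonzero_mult_div_cancel_left times_divide_eq_right)
    show ?R
    proof (intro exI conjI)
      show "(\<epsilon>, \<sigma>) \<noteq> (0, 0) \<longrightarrow> - \<gamma> = 0" "\<epsilon> \<noteq> \<sigma> \<longrightarrow> e = 0"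
        using comp a e by (auto simp: compatible_def)
      show "(\<epsilon>, \<kappa>, lam) \<noteq> (0, 0, 0) \<longrightarrow> c3 = 0" by (rule z)
      show "\<forall>(t, x, u, v)\<in>R. \<phi> (t, x, u, v) = (- \<gamma> * t + e) * a * v + c3 * c * ln (a * u + c) - - \<gamma> * x + c4 \<and>
        \<psi> (t, x, u, v) = c3 * a * v + (- \<gamma> * t + e) * (a * u + c) + (D0 - e * c)"
        using form[unfolded substitution_form_def, unfolded region_ball] f
        unfolding region_ball by (simp add: G e algebra_simps)
    qed
  next
    assume ?R
    then obtain c1 c2 c3 c4 c5 where z: "(\<epsilon>, \<sigma>) \<noteq> (0, 0) \<longrightarrow> c1 = 0" "\<epsilon> \<noteq> \<sigma> \<longrightarrow> c2 = 0"
      "(\<epsilon>, \<kappa>, lam) \<noteq> (0, 0, 0) \<longrightarrow> c3 = 0"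
      and form: "\<forall>t x v. \<forall>u\<in>I.
        \<phi> (t, x, u, v) = (c1 * t + c2) * a * v + c3 * c * ln (a * u + c) - c1 * x + c4 \<and>
        \<psi> (t, x, u, v) = c3 * a * v + (c1 * t + c2) * (a * u + c) + c5"
      unfolding region_ball by blast
    have "\<exists>f'. profile (c3 * a) (\<lambda>u. c3 * c * ln (a * u + c) + c4) f'"
      using profile_b_zero[OF b] z(3) by blast
    moreover have "compatible (- c1) (c2 * a)" unfolding compatible_def using z b by auto
    moreover have "substitution_form (- c1) (c2 * a) (c5 + c2 * c) (c3 * a) (\<lambda>u. c3 * c * ln (a * u + c) + c4) \<phi> \<psi>"
      unfolding substitution_form_def region_ball using form by (simp add: algebra_simps)
    ultimately show ?L by blast
  qed
  then show ?thesis unfolding self_adjoint_subst_iff[OF nz] by (rule arg_cong)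
qed

lemma self_adjoint_subst_iff_b_nonzero:
  assumes "(\<epsilon>, \<kappa>, lam, \<sigma>) \<noteq> (0, 0, 0, 0)" "b \<noteq> 0"
  shows "self_adjoint_subst R F1 F2 \<phi> \<psi> \<longleftrightarrow> (\<exists>p\<in>R. \<phi> p \<noteq> 0 \<or> \<psi> p \<noteq> 0) \<and>
    (\<exists>D0 G f. (\<exists>f'. profile G f f') \<and>
      (\<forall>(t, x, u, v)\<in>R. \<phi> (t, x, u, v) = f u \<and> \<psi> (t, x, u, v) = G * v + D0))"
proof -
  have "compatible \<gamma> E0 \<longleftrightarrow> \<gamma> = 0 \<and> E0 = 0" for \<gamma> E0
    using assms(2) by (auto simp: compatible_def)
  then show ?thesis
    unfolding self_adjoint_subst_iff[OF assms(1)] substitution_form_def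
    by (simp add: add.commute)
qed

text \<open>Transfers a description of the solutions \<open>(G, f)\<close> by two parameters to the substitutions; the third
  parameter is the additive constant of \<open>\<psi>\<close>.\<close>

lemma self_adjoint_subst_iff_profile:
  assumes nz: "(\<epsilon>, \<kappa>, lam, \<sigma>) \<noteq> (0, 0, 0, 0)" and b: "b \<noteq> 0"
    and prof: "\<And>G f. (\<exists>f'. profile G f f') \<longleftrightarrow>
      (\<exists>k1 k2. G = g k1 k2 \<and> (\<forall>u\<in>I. f u = h k1 k2 u) \<and> C k1 k2)"
  shows "self_adjoint_subst R F1 F2 \<phi> \<psi> \<longleftrightarrow> (\<exists>p\<in>R. \<phi> p \<noteq> 0 \<or> \<psi> p \<noteq> 0) \<and>
    (\<exists>k1 k2 k3 :: real. C k1 k2 \<and>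
      (\<forall>(t, x, u, v)\<in>R. \<phi> (t, x, u, v) = h k1 k2 u \<and> \<psi> (t, x, u, v) = g k1 k2 * v + k3))"
    (is "?L \<longleftrightarrow> ?N \<and> ?F")
proof -
  have "(\<exists>D0 G f. (\<exists>f'. profile G f f') \<and>
      (\<forall>(t, x, u, v)\<in>R. \<phi> (t, x, u, v) = f u \<and> \<psi> (t, x, u, v) = G * v + D0)) \<longleftrightarrow> ?F"
    unfolding prof region_ball
  proof safe
    fix k1 k2 k3
    assume C: "C k1 k2" and eq: "\<forall>t x v. \<forall>u\<in>I. \<phi> (t, x, u, v) = h k1 k2 u \<and> \<psi> (t, x, u, v) = g k1 k2 * v + k3"
    show "\<exists>D0 G f. (\<exists>k1 k2. G = g k1 k2 \<and> (\<forall>u\<in>I. f u = h k1 k2 u) \<and> C k1 k2) \<and>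
      (\<forall>t x v. \<forall>u\<in>I. \<phi> (t, x, u, v) = f u \<and> \<psi> (t, x, u, v) = G * v + D0)"
      by (rule exI[of _ k3], rule exI[of _ "g k1 k2"], rule exI[of _ "h k1 k2"]) (use C eq in blast)
  next
    fix D0 f k1 k2
    assume "\<forall>t x v. \<forall>u\<in>I. \<phi> (t, x, u, v) = f u \<and> \<psi> (t, x, u, v) = g k1 k2 * v + D0"
      and "\<forall>u\<in>I. f u = h k1 k2 u" "C k1 k2"
    then show "\<exists>k1 k2 k3. C k1 k2 \<and>
      (\<forall>t x v. \<forall>u\<in>I. \<phi> (t, x, u, v) = h k1 k2 u \<and> \<psi> (t, x, u, v) = g k1 k2 * v + k3)"
      by (intro exI[of _ k1] exI[of _ k2] exI[of _ D0]) simp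
  qed
  then show ?thesis unfolding self_adjoint_subst_iff_b_nonzero[OF nz b] by simp
qed

end

section \<open>The classification\<close>

theorem proposition2:
  fixes a b c \<epsilon> \<kappa> lam \<sigma> :: real
  assumes "(a + b) * c \<noteq> 0"
    and "(\<epsilon>, \<kappa>, lam, \<sigma>) \<noteq> (0, 0, 0, 0)"
  defines "\<Omega> \<equiv> region a c"
    and "F1 \<equiv> sys_F1 a b c \<epsilon> \<kappa>"
    and "F2 \<equiv> sys_F2 a b c lam \<sigma>"
  shows "nonlinearly_self_adjoint \<Omega> F1 F2 \<and>
    (b = 0 \<longrightarrow> (\<forall>\<phi> \<psi>. self_adjoint_subst \<Omega> F1 F2 \<phi> \<psi> \<longleftrightarrow>
      (\<exists>p\<in>\<Omega>. \<phi> p \<noteq> 0 \<or> \<psi> p \<noteq> 0) \<and>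
      (\<exists>c1 c2 c3 c4 c5 :: real.
        ((\<epsilon>, \<sigma>) \<noteq> (0, 0) \<longrightarrow> c1 = 0) \<and>
        (\<epsilon> \<noteq> \<sigma> \<longrightarrow> c2 = 0) \<and>
        ((\<epsilon>, \<kappa>, lam) \<noteq> (0, 0, 0) \<longrightarrow> c3 = 0) \<and>
        (\<forall>(t, x, u, v)\<in>\<Omega>.
          \<phi> (t, x, u, v) = (c1 * t + c2) * a * v + c3 * c * ln (a * u + c) - c1 * x + c4 \<and>
          \<psi> (t, x, u, v) = c3 * a * v + (c1 * t + c2) * (a * u + c) + c5)))) \<and>
    (a = b \<longrightarrow> (\<forall>\<phi> \<psi>. self_adjoint_subst \<Omega> F1 F2 \<phi> \<psi> \<longleftrightarrow>
      (\<exists>p\<in>\<Omega>. \<phi> p \<noteq> 0 \<or> \<psi> p \<noteq> 0) \<and>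
      (\<exists>c1 c2 c3 :: real.
        ((\<epsilon>, \<kappa>, lam) \<noteq> (0, 0, 0) \<longrightarrow> c1 = 0) \<and>
        (\<kappa> \<noteq> 0 \<longrightarrow> c2 = 0) \<and>
        (\<forall>(t, x, u, v)\<in>\<Omega>.
          \<phi> (t, x, u, v) = (a * u + c) * (c1 * ln (a * u + c) + c2) \<and>
          \<psi> (t, x, u, v) = c1 * a * v + c3)))) \<and>
    (b * (a - b) \<noteq> 0 \<longrightarrow>
      (a = 0 \<longrightarrow> (\<forall>\<phi> \<psi>. self_adjoint_subst \<Omega> F1 F2 \<phi> \<psi> \<longleftrightarrow>
        (\<exists>p\<in>\<Omega>. \<phi> p \<noteq> 0 \<or> \<psi> p \<noteq> 0) \<and>
        (\<exists>c1 c2 c3 :: real.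
          ((\<epsilon>, \<kappa>) \<noteq> (0, 0) \<longrightarrow> c1 = 0) \<and>
          (\<kappa> \<noteq> - lam \<longrightarrow> c2 = 0) \<and>
          (\<forall>(t, x, u, v)\<in>\<Omega>.
            \<phi> (t, x, u, v) = c1 * exp (b * u / c) - c2 * (b * u + 2 * c) \<and>
            \<psi> (t, x, u, v) = c2 * b * v + c3)))) \<and>
      (a \<noteq> 0 \<longrightarrow> (\<forall>\<phi> \<psi>. self_adjoint_subst \<Omega> F1 F2 \<phi> \<psi> \<longleftrightarrow>
        (\<exists>p\<in>\<Omega>. \<phi> p \<noteq> 0 \<or> \<psi> p \<noteq> 0) \<and>
        (\<exists>c1 c2 c3 :: real.
          ((\<epsilon>, \<kappa>) \<noteq> (0, 0) \<longrightarrow> c1 = 0) \<and>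
          (lam * a \<noteq> (\<kappa> + lam) * b \<longrightarrow> c2 = 0) \<and>
          (\<forall>(t, x, u, v)\<in>\<Omega>.
            \<phi> (t, x, u, v) = c1 * (a * u + c) powr (b / a)
              + c2 * (b\<^sup>2 * u + (2 * b - a) * c) \<and>
            \<psi> (t, x, u, v) = c2 * (a - b) * b * v + c3)))))"
proof -
  interpret dispersive_system a b c \<epsilon> \<kappa> lam \<sigma> by unfold_locales (rule assms(1))
  note nz = assms(2)
  show ?thesis
  proof (intro conjI impI allI)
    show "nonlinearly_self_adjoint \<Omega> F1 F2"
    proof -
      obtain u0 where "u0 \<in> I" by (rule I_nonempty)
      then have "(0, 0, u0, 0) \<in> R" using region_iff by blast
      moreover have "compatible 0 0" by (simp add: compatible_def)
      \<comment> \<open>the substitution \<open>\<phi> = 0\<close>, \<open>\<psi> = 1\<close> works for all parameters\<close>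
      moreover have "profile 0 (\<lambda>_. 0) (\<lambda>_. 0)" by (auto simp: profile_def)
      moreover have "substitution_form 0 0 1 0 (\<lambda>_. 0) (\<lambda>_. 0) (\<lambda>_. 1)" by (simp add: substitution_form_def)
      ultimately have "self_adjoint_subst \<Omega> F1 F2 (\<lambda>_. 0) (\<lambda>_. 1)"
        unfolding \<Omega>_def F1_def F2_def self_adjoint_subst_iff[OF nz] by (intro conjI bexI exI) simp_all
      then show ?thesis unfolding nonlinearly_self_adjoint_def by blast
    qed
  next
    fix \<phi> \<psi> assume b: "b = 0"
    show "self_adjoint_subst \<Omega> F1 F2 \<phi> \<psi> \<longleftrightarrow> (\<exists>p\<in>\<Omega>. \<phi> p \<noteq> 0 \<or> \<psi> p \<noteq> 0) \<and>
      (\<exists>c1 c2 c3 c4 c5 :: real.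
        ((\<epsilon>, \<sigma>) \<noteq> (0, 0) \<longrightarrow> c1 = 0) \<and>
        (\<epsilon> \<noteq> \<sigma> \<longrightarrow> c2 = 0) \<and>
        ((\<epsilon>, \<kappa>, lam) \<noteq> (0, 0, 0) \<longrightarrow> c3 = 0) \<and>
        (\<forall>(t, x, u, v)\<in>\<Omega>.
          \<phi> (t, x, u, v) = (c1 * t + c2) * a * v + c3 * c * ln (a * u + c) - c1 * x + c4 \<and>
          \<psi> (t, x, u, v) = c3 * a * v + (c1 * t + c2) * (a * u + c) + c5))"
      unfolding \<Omega>_def F1_def F2_def by (rule self_adjoint_subst_iff_b_zero[OF nz b])
  next
    fix \<phi> \<psi> assume ab: "a = b"
    then have b: "b \<noteq> 0" using assms(1) by auto
    show "self_adjoint_subst \<Omega> F1 F2 \<phi> \<psi> \<longleftrightarrow> (\<exists>p\<in>\<Omega>. \<phi> p \<noteq> 0 \<or> \<psi> p \<noteq> 0) \<and>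
      (\<exists>c1 c2 c3 :: real.
        ((\<epsilon>, \<kappa>, lam) \<noteq> (0, 0, 0) \<longrightarrow> c1 = 0) \<and>
        (\<kappa> \<noteq> 0 \<longrightarrow> c2 = 0) \<and>
        (\<forall>(t, x, u, v)\<in>\<Omega>.
          \<phi> (t, x, u, v) = (a * u + c) * (c1 * ln (a * u + c) + c2) \<and>
          \<psi> (t, x, u, v) = c1 * a * v + c3))"
      unfolding \<Omega>_def F1_def F2_def
        self_adjoint_subst_iff_profile[OF nz b profile_a_eq_b[OF ab]] conj_assoc by (rule refl)
  next
    fix \<phi> \<psi> assume "b * (a - b) \<noteq> 0" and a: "a = 0"
    then have b: "b \<noteq> 0" by simp
    show "self_adjoint_subst \<Omega> F1 F2 \<phi> \<psi> \<longleftrightarrow> (\<exists>p\<in>\<Omega>. \<phi> p \<noteq> 0 \<or> \<psi> p \<noteq> 0) \<and>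
      (\<exists>c1 c2 c3 :: real.
        ((\<epsilon>, \<kappa>) \<noteq> (0, 0) \<longrightarrow> c1 = 0) \<and>
        (\<kappa> \<noteq> - lam \<longrightarrow> c2 = 0) \<and>
        (\<forall>(t, x, u, v)\<in>\<Omega>.
          \<phi> (t, x, u, v) = c1 * exp (b * u / c) - c2 * (b * u + 2 * c) \<and>
          \<psi> (t, x, u, v) = c2 * b * v + c3))"
      unfolding \<Omega>_def F1_def F2_def
        self_adjoint_subst_iff_profile[OF nz b profile_a_zero[OF a]] conj_assoc by (rule refl)
  next
    fix \<phi> \<psi> assume "b * (a - b) \<noteq> 0" and a: "a \<noteq> 0"
    then have b: "b \<noteq> 0" and ab: "a \<noteq> b" by simp_all
    show "self_adjoint_subst \<Omega> F1 F2 \<phi> \<psi> \<longleftrightarrow> (\<exists>p\<in>\<Omega>. \<phi> p \<noteq> 0 \<or> \<psi> p \<noteq> 0) \<and>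
      (\<exists>c1 c2 c3 :: real.
        ((\<epsilon>, \<kappa>) \<noteq> (0, 0) \<longrightarrow> c1 = 0) \<and>
        (lam * a \<noteq> (\<kappa> + lam) * b \<longrightarrow> c2 = 0) \<and>
        (\<forall>(t, x, u, v)\<in>\<Omega>.
          \<phi> (t, x, u, v) = c1 * (a * u + c) powr (b / a)
            + c2 * (b\<^sup>2 * u + (2 * b - a) * c) \<and>
          \<psi> (t, x, u, v) = c2 * (a - b) * b * v + c3))"
      unfolding \<Omega>_def F1_def F2_def
        self_adjoint_subst_iff_profile[OF nz b profile_generic[OF a b ab]] conj_assoc by (rule refl)
  qed
qed

end
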